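(* For any directed graph $E$ and any field $K$, the following are equivalent: (1) each ideal of $L_K(E)$ is an annihilator ideal; (2) $E$ is strongly all-reflexive; (3) the lattice of ideals of $L_K(E)$ is a Boolean algebra.
   Context: $L_K(E)$ is the Leavitt path algebra of $E$ over $K$. For an ideal $I$, $\operatorname{ann}(I)=\{r\mid rI=Ir=0\}$; $I$ is an annihilator ideal if $\operatorname{ann}(\operatorname{ann}(I))=I$. $E$ is all-reflexive if: (a) each cycle is either without exits or extreme; (b) each vertex emitting infinitely many edges lies on a cycle; (c) for every infinite path $\alpha$ with vertex set $\alpha^0$, only finitely many edges $e$ satisfy $\mathbf{s}(e)\in\alpha^0$ and $\mathbf{r}(e)\notin R(\alpha^0)$. $E$ is strongly all-reflexive if it is all-reflexive and has no cycle without exits. Here a cycle is a closed path of positive length whose edges have distinct sources; an exit is an edge with source on the cycle not on it; a cycle $c$ is extreme if it has exits and for every path $p$ with $\mathbf{s}(p)\in c^0$ there is a path from $\mathbf{r}(p)$ to a vertex of $c$; $R(V)=\{u\mid$ there is a path (possibly of length 0) from $u$ to some $v\in V\}$. *)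

theory Defs
  imports Main
begin

definition edge_rel :: "'e set \<Rightarrow> ('e \<Rightarrow> 'v) \<Rightarrow> ('e \<Rightarrow> 'v) \<Rightarrow> ('v \<times> 'v) set" where
  "edge_rel Es s r = {(s e, r e) | e. e \<in> Es}"

definition reaches :: "'e set \<Rightarrow> ('e \<Rightarrow> 'v) \<Rightarrow> ('e \<Rightarrow> 'v) \<Rightarrow> 'v \<Rightarrow> 'v \<Rightarrow> bool" where
  "reaches Es s r u w \<longleftrightarrow> (u, w) \<in> (edge_rel Es s r)\<^sup>*"

definition RR :: "'v set \<Rightarrow> 'e set \<Rightarrow> ('e \<Rightarrow> 'v) \<Rightarrow> ('e \<Rightarrow> 'v) \<Rightarrow> 'v set \<Rightarrow> 'v set" where
  "RR V Es s r W = {u \<in> V. \<exists>w\<in>W. reaches Es s r u w}"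

definition is_path :: "'e set \<Rightarrow> ('e \<Rightarrow> 'v) \<Rightarrow> ('e \<Rightarrow> 'v) \<Rightarrow> 'e list \<Rightarrow> bool" where
  "is_path Es s r p \<longleftrightarrow> p \<noteq> [] \<and> set p \<subseteq> Es \<and>
     (\<forall>i. Suc i < length p \<longrightarrow> r (p ! i) = s (p ! Suc i))"

definition is_cycle :: "'e set \<Rightarrow> ('e \<Rightarrow> 'v) \<Rightarrow> ('e \<Rightarrow> 'v) \<Rightarrow> 'e list \<Rightarrow> bool" where
  "is_cycle Es s r c \<longleftrightarrow> is_path Es s r c \<and> r (last c) = s (hd c) \<and> distinct (map s c)"

definition cycle_verts :: "('e \<Rightarrow> 'v) \<Rightarrow> 'e list \<Rightarrow> 'v set" where
  "cycle_verts s c = s ` set c"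

definition is_exit :: "'e set \<Rightarrow> ('e \<Rightarrow> 'v) \<Rightarrow> 'e list \<Rightarrow> 'e \<Rightarrow> bool" where
  "is_exit Es s c e \<longleftrightarrow> e \<in> Es \<and> s e \<in> cycle_verts s c \<and> e \<notin> set c"

definition has_exit :: "'e set \<Rightarrow> ('e \<Rightarrow> 'v) \<Rightarrow> 'e list \<Rightarrow> bool" where
  "has_exit Es s c \<longleftrightarrow> (\<exists>e. is_exit Es s c e)"

definition is_extreme :: "'e set \<Rightarrow> ('e \<Rightarrow> 'v) \<Rightarrow> ('e \<Rightarrow> 'v) \<Rightarrow> 'e list \<Rightarrow> bool" where
  "is_extreme Es s r c \<longleftrightarrow> has_exit Es s c \<and>
     (\<forall>p. is_path Es s r p \<and> s (hd p) \<in> cycle_verts s c \<longrightarrow>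
          (\<exists>w\<in>cycle_verts s c. reaches Es s r (r (last p)) w))"

definition is_inf_path :: "'e set \<Rightarrow> ('e \<Rightarrow> 'v) \<Rightarrow> ('e \<Rightarrow> 'v) \<Rightarrow> (nat \<Rightarrow> 'e) \<Rightarrow> bool" where
  "is_inf_path Es s r \<alpha> \<longleftrightarrow> (\<forall>i. \<alpha> i \<in> Es) \<and> (\<forall>i. r (\<alpha> i) = s (\<alpha> (Suc i)))"

definition inf_path_verts :: "('e \<Rightarrow> 'v) \<Rightarrow> (nat \<Rightarrow> 'e) \<Rightarrow> 'v set" where
  "inf_path_verts s \<alpha> = range (\<lambda>i. s (\<alpha> i))"

definition all_reflexive :: "'v set \<Rightarrow> 'e set \<Rightarrow> ('e \<Rightarrow> 'v) \<Rightarrow> ('e \<Rightarrow> 'v) \<Rightarrow> bool" where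
  "all_reflexive V Es s r \<longleftrightarrow>
     (\<forall>c. is_cycle Es s r c \<longrightarrow> \<not> has_exit Es s c \<or> is_extreme Es s r c) \<and>
     (\<forall>v\<in>V. infinite {e \<in> Es. s e = v} \<longrightarrow> (\<exists>c. is_cycle Es s r c \<and> v \<in> cycle_verts s c)) \<and>
     (\<forall>\<alpha>. is_inf_path Es s r \<alpha> \<longrightarrow>
        finite {e \<in> Es. s e \<in> inf_path_verts s \<alpha> \<and> r e \<notin> RR V Es s r (inf_path_verts s \<alpha>)})"

definition strongly_all_reflexive :: "'v set \<Rightarrow> 'e set \<Rightarrow> ('e \<Rightarrow> 'v) \<Rightarrow> ('e \<Rightarrow> 'v) \<Rightarrow> bool" where
  "strongly_all_reflexive V Es s r \<longleftrightarrow>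
     all_reflexive V Es s r \<and> (\<forall>c. is_cycle Es s r c \<longrightarrow> has_exit Es s c)"

record 'a rng_str =
  carr :: "'a set"
  radd :: "'a \<Rightarrow> 'a \<Rightarrow> 'a"
  rmul :: "'a \<Rightarrow> 'a \<Rightarrow> 'a"
  rzero :: 'a
  rneg :: "'a \<Rightarrow> 'a"

definition is_ideal :: "'a rng_str \<Rightarrow> 'a set \<Rightarrow> bool" where
  "is_ideal R I \<longleftrightarrow> I \<subseteq> carr R \<and> rzero R \<in> I \<and>
     (\<forall>x\<in>I. \<forall>y\<in>I. radd R x y \<in> I) \<and> (\<forall>x\<in>I. rneg R x \<in> I) \<and>
     (\<forall>a\<in>carr R. \<forall>x\<in>I. rmul R a x \<in> I \<and> rmul R x a \<in> I)"

definition ann :: "'a rng_str \<Rightarrow> 'a set \<Rightarrow> 'a set" where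
  "ann R I = {a \<in> carr R. \<forall>x\<in>I. rmul R a x = rzero R \<and> rmul R x a = rzero R}"

definition ideal_join :: "'a rng_str \<Rightarrow> 'a set \<Rightarrow> 'a set \<Rightarrow> 'a set" where
  "ideal_join R A B = \<Inter>{C. is_ideal R C \<and> A \<union> B \<subseteq> C}"

definition boolean_ideal_lattice :: "'a rng_str \<Rightarrow> bool" where
  "boolean_ideal_lattice R \<longleftrightarrow>
     (\<forall>A B C. is_ideal R A \<and> is_ideal R B \<and> is_ideal R C \<longrightarrow>
        A \<inter> ideal_join R B C = ideal_join R (A \<inter> B) (A \<inter> C)) \<and>
     (\<forall>A. is_ideal R A \<longrightarrow> (\<exists>B. is_ideal R B \<and> A \<inter> B = {rzero R} \<and> ideal_join R A B = carr R))"

datatype ('v, 'e) lgen = Vg 'v | Eg 'e | Gg 'e  \<comment> \<open>vertex, edge, ghost edge e*\<close>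

text \<open>Elements of the free (non-commutative) K-algebra: finitely supported coefficient
  functions on words.\<close>
type_synonym ('v, 'e, 'k) fa = "('v, 'e) lgen list \<Rightarrow> 'k"

definition fa_zero :: "('v, 'e, 'k::field) fa" where "fa_zero = (\<lambda>w. 0)"
definition fa_add :: "('v, 'e, 'k::field) fa \<Rightarrow> ('v, 'e, 'k) fa \<Rightarrow> ('v, 'e, 'k) fa" where
  "fa_add p q = (\<lambda>w. p w + q w)"
definition fa_sub :: "('v, 'e, 'k::field) fa \<Rightarrow> ('v, 'e, 'k) fa \<Rightarrow> ('v, 'e, 'k) fa" where
  "fa_sub p q = (\<lambda>w. p w - q w)"
definition fa_smul :: "'k::field \<Rightarrow> ('v, 'e, 'k) fa \<Rightarrow> ('v, 'e, 'k) fa" where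
  "fa_smul c p = (\<lambda>w. c * p w)"
definition fa_mul :: "('v, 'e, 'k::field) fa \<Rightarrow> ('v, 'e, 'k) fa \<Rightarrow> ('v, 'e, 'k) fa" where
  "fa_mul p q = (\<lambda>w. \<Sum>i\<le>length w. p (take i w) * q (drop i w))"
definition fa_gen :: "('v, 'e) lgen \<Rightarrow> ('v, 'e, 'k::field) fa" where
  "fa_gen x = (\<lambda>w. if w = [x] then 1 else 0)"

definition allowed :: "'v set \<Rightarrow> 'e set \<Rightarrow> ('v, 'e) lgen \<Rightarrow> bool" where
  "allowed V Es x = (case x of Vg v \<Rightarrow> v \<in> V | Eg e \<Rightarrow> e \<in> Es | Gg e \<Rightarrow> e \<in> Es)"

text \<open>The free non-unital K-algebra on the generators v (v in V), e, e* (e in Es).\<close>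
definition fa_carrier :: "'v set \<Rightarrow> 'e set \<Rightarrow> ('v, 'e, 'k::field) fa set" where
  "fa_carrier V Es = {p. finite {w. p w \<noteq> 0} \<and> p [] = 0 \<and>
      (\<forall>w. p w \<noteq> 0 \<longrightarrow> (\<forall>x\<in>set w. allowed V Es x))}"

definition lpa_rels :: "'v set \<Rightarrow> 'e set \<Rightarrow> ('e \<Rightarrow> 'v) \<Rightarrow> ('e \<Rightarrow> 'v) \<Rightarrow> ('v, 'e, 'k::field) fa set" where
  "lpa_rels V Es s r =
     {fa_sub (fa_mul (fa_gen (Vg v)) (fa_gen (Vg u))) (if v = u then fa_gen (Vg v) else fa_zero)
        | v u. v \<in> V \<and> u \<in> V}
   \<union> {fa_sub (fa_mul (fa_gen (Vg (s e))) (fa_gen (Eg e))) (fa_gen (Eg e)) | e. e \<in> Es}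
   \<union> {fa_sub (fa_mul (fa_gen (Eg e)) (fa_gen (Vg (r e)))) (fa_gen (Eg e)) | e. e \<in> Es}
   \<union> {fa_sub (fa_mul (fa_gen (Vg (r e))) (fa_gen (Gg e))) (fa_gen (Gg e)) | e. e \<in> Es}
   \<union> {fa_sub (fa_mul (fa_gen (Gg e)) (fa_gen (Vg (s e)))) (fa_gen (Gg e)) | e. e \<in> Es}
   \<union> {fa_sub (fa_mul (fa_gen (Gg e)) (fa_gen (Eg f))) (if e = f then fa_gen (Vg (r e)) else fa_zero)
        | e f. e \<in> Es \<and> f \<in> Es}
   \<union> {fa_sub (fa_gen (Vg v)) (\<lambda>w. \<Sum>e\<in>{e \<in> Es. s e = v}. fa_mul (fa_gen (Eg e)) (fa_gen (Gg e)) w)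
        | v. v \<in> V \<and> finite {e \<in> Es. s e = v} \<and> {e \<in> Es. s e = v} \<noteq> {}}"

definition lpa_J :: "'v set \<Rightarrow> 'e set \<Rightarrow> ('e \<Rightarrow> 'v) \<Rightarrow> ('e \<Rightarrow> 'v) \<Rightarrow> ('v, 'e, 'k::field) fa set" where
  "lpa_J V Es s r = \<Inter>{I. I \<subseteq> fa_carrier V Es \<and> lpa_rels V Es s r \<subseteq> I \<and> fa_zero \<in> I \<and>
      (\<forall>x\<in>I. \<forall>y\<in>I. fa_add x y \<in> I) \<and> (\<forall>c. \<forall>x\<in>I. fa_smul c x \<in> I) \<and>
      (\<forall>a\<in>fa_carrier V Es. \<forall>x\<in>I. fa_mul a x \<in> I \<and> fa_mul x a \<in> I)}"

definition fa_coset :: "'v set \<Rightarrow> 'e set \<Rightarrow> ('e \<Rightarrow> 'v) \<Rightarrow> ('e \<Rightarrow> 'v) \<Rightarrow> ('v, 'e, 'k::field) fa \<Rightarrow> ('v, 'e, 'k) fa set" where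
  "fa_coset V Es s r p = {q \<in> fa_carrier V Es. fa_sub q p \<in> lpa_J V Es s r}"

definition LPA :: "'v set \<Rightarrow> 'e set \<Rightarrow> ('e \<Rightarrow> 'v) \<Rightarrow> ('e \<Rightarrow> 'v) \<Rightarrow> ('v, 'e, 'k::field) fa set rng_str" where
  "LPA V Es s r =
     \<lparr> carr = fa_coset V Es s r ` fa_carrier V Es,
       radd = (\<lambda>X Y. {q \<in> fa_carrier V Es. \<exists>x\<in>X. \<exists>y\<in>Y. fa_sub q (fa_add x y) \<in> lpa_J V Es s r}),
       rmul = (\<lambda>X Y. {q \<in> fa_carrier V Es. \<exists>x\<in>X. \<exists>y\<in>Y. fa_sub q (fa_mul x y) \<in> lpa_J V Es s r}),
       rzero = lpa_J V Es s r,
       rneg = (\<lambda>X. {q \<in> fa_carrier V Es. \<exists>x\<in>X. fa_add q x \<in> lpa_J V Es s r}) \<rparr>"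

end

theory Submission
  imports Defs Complex_Main
begin

text \<open>
  Both ring-theoretic conditions say that every ideal \<open>I\<close> has a complement \<open>B\<close> with \<open>I \<inter> B = 0\<close> and
  \<open>I + B = L\<close>. Since \<open>L\<close> has local units, such a \<open>B\<close> is the annihilator of \<open>I\<close> and ideals
  distribute; since \<open>L\<close> is semiprime, \<open>I\<close> meets its annihilator trivially. Semiprimeness follows from
  the reduction lemma: every nonzero \<open>x\<close> can be multiplied by a path into the nonzero part of the path
  algebra, and then by a ghost path to \<open>u + y\<close> with a vertex \<open>u\<close> and a combination \<open>y\<close> of closed paths
  at \<open>u\<close>.

  Let \<open>E\<close> be strongly all-reflexive, \<open>H\<close> the set of vertices in \<open>I\<close> and \<open>H'\<close> the complement of
  \<open>R(H)\<close>. Graph combinatorics shows that the ideals of \<open>H\<close> and \<open>H'\<close> have direct sum \<open>L\<close>. The ideal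
  of \<open>H'\<close> meets \<open>I\<close> trivially, as otherwise the intersection would contain a vertex by
  Cuntz-Krieger uniqueness. Working inside a direct summand makes quotient graphs superfluous.

  Conversely, decompose a vertex as \<open>v = i + b\<close> along an ideal and its complement, and multiply by a
  path \<open>q\<close> so long that \<open>b q\<close> lies in the path algebra. If \<open>q\<close> avoids the vertices of the ideal, then
  \<open>i q = 0\<close>, so that \<open>b q = q\<close>; if moreover a path \<open>t\<close> leads from the end of \<open>q\<close> into the ideal, then
  \<open>b q t = 0\<close>, which is impossible because paths are right cancellable in the path algebra.
\<close>

section \<open>The free algebra\<close>

text \<open>The presentation by generators and relations bounds the algebra only from above: it does
  not show that vertices and paths survive. What is needed is the linear independence of the paths
  into each vertex. It comes from a concrete representation; afterwards the proof works with the
  relations and this independence alone.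

  Infinite emitters are one obstacle: without a Cuntz-Krieger relation at \<open>v\<close>, an
  element cannot be rebuilt from its products with the edges at \<open>v\<close>. But only finitely
  many edges occur in its ghost parts, and any other edge can serve as a test.

  The other obstacle is a cycle \<open>c\<close> at \<open>v\<close> without exits. No path leaves
  it, so the argument with long paths that still lead into an ideal has nothing to start from. The
  obstruction is the ideal generated by \<open>v - c\<close>, modelled on the ideal of
  \<open>1 - x\<close> in the Laurent polynomials: proper, but without complement. Ghost edges are
  removed by multiplying with powers of \<open>c\<close>, and the sum of coefficients detects that
  the ideal is proper.\<close>

definition fa_mono :: "('v, 'e) lgen list \<Rightarrow> ('v, 'e, 'k::field) fa" where
  "fa_mono u = (\<lambda>w. if w = u then 1 else 0)"

lemma fa_gen_mono: "fa_gen x = fa_mono [x]"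
  by (simp add: fa_gen_def fa_mono_def)

text \<open>Pairs of factors instead of cut positions: associativity of the product becomes a
  bijection between two ways of cutting a word into three pieces.\<close>

definition splits :: "'a list \<Rightarrow> ('a list \<times> 'a list) set" where
  "splits w = {(x, y). x @ y = w}"

lemma mem_splits: "a \<in> splits w \<longleftrightarrow> fst a @ snd a = w"
  by (auto simp: splits_def)

lemma fa_mul_splits:
  "fa_mul p q w = (\<Sum>a\<in>splits w. p (fst a) * q (snd a))"
  unfolding fa_mul_def
  by (rule sum.reindex_bij_witness[of _ "\<lambda>a. length (fst a)" "\<lambda>i. (take i w, drop i w)"])
    (auto simp: mem_splits)

lemma finite_splits: "finite (splits w)"
proof (rule finite_subset)
  show "splits w \<subseteq> (\<lambda>i. (take i w, drop i w)) ` {..length w}"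
  proof
    fix a assume "a \<in> splits w"
    then show "a \<in> (\<lambda>i. (take i w, drop i w)) ` {..length w}"
      by (intro image_eqI[where x = "length (fst a)"]) (auto simp: mem_splits)
  qed
qed simp

lemma fa_mul_assoc: "fa_mul (fa_mul p q) r = fa_mul p (fa_mul q r)"
proof
  fix w
  have "fa_mul (fa_mul p q) r w
      = (\<Sum>a\<in>splits w. \<Sum>b\<in>splits (fst a). p (fst b) * q (snd b) * r (snd a))"
    by (simp add: fa_mul_splits case_prod_unfold sum_distrib_right)
  also have "\<dots> = (\<Sum>a\<in>(SIGMA a:splits w. splits (fst a)).
      p (fst (snd a)) * q (snd (snd a)) * r (snd (fst a)))"
    by (subst sum.Sigma) (auto simp: finite_splits case_prod_unfold)
  also have "\<dots> = (\<Sum>a\<in>(SIGMA a:splits w. splits (snd a)).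
      p (fst (fst a)) * (q (fst (snd a)) * r (snd (snd a))))"
    by (rule sum.reindex_bij_witness[of _ "\<lambda>((x, yz), (y, z)). ((x @ y, z), (x, y))"
          "\<lambda>((xy, z), (x, y)). ((x, y @ z), (y, z))"]) (auto simp: mult.assoc mem_splits)
  also have "\<dots> = (\<Sum>a\<in>splits w. \<Sum>b\<in>splits (snd a). p (fst a) * (q (fst b) * r (snd b)))"
    by (subst sum.Sigma) (auto simp: finite_splits case_prod_unfold)
  also have "\<dots> = fa_mul p (fa_mul q r) w"
    by (simp add: fa_mul_splits case_prod_unfold sum_distrib_left)
  finally show "fa_mul (fa_mul p q) r w = fa_mul p (fa_mul q r) w" .
qed

lemma fa_mul_add_left: "fa_mul (fa_add p q) r = fa_add (fa_mul p r) (fa_mul q r)"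
  and fa_mul_add_right: "fa_mul r (fa_add p q) = fa_add (fa_mul r p) (fa_mul r q)"
  and fa_mul_sub_left: "fa_mul (fa_sub p q) r = fa_sub (fa_mul p r) (fa_mul q r)"
  and fa_mul_sub_right: "fa_mul r (fa_sub p q) = fa_sub (fa_mul r p) (fa_mul r q)"
  and fa_mul_smul_left: "fa_mul (fa_smul c p) r = fa_smul c (fa_mul p r)"
  and fa_mul_smul_right: "fa_mul r (fa_smul c p) = fa_smul c (fa_mul r p)"
  and fa_mul_zero_left: "fa_mul fa_zero r = fa_zero"
  and fa_mul_zero_right: "fa_mul r fa_zero = fa_zero"
  by (simp_all add: fun_eq_iff fa_mul_def fa_add_def fa_sub_def fa_smul_def fa_zero_def
      distrib_left distrib_right left_diff_distrib right_diff_distrib mult.assoc mult.left_commute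
      sum.distrib sum_subtractf sum_distrib_left)

lemma fa_sub_add_smul: "fa_sub p q = fa_add p (fa_smul (- 1) q)"
  by (simp add: fa_sub_def fa_add_def fa_smul_def)

lemma fa_mul_mono: "fa_mul (fa_mono u) (fa_mono v) = fa_mono (u @ v)"
proof
  fix w
  have "(\<Sum>a\<in>splits w. fa_mono u (fst a) * fa_mono v (snd a))
      = (\<Sum>a\<in>splits w. if a = (u, v) then 1 else 0)"
    by (rule sum.cong) (auto simp: fa_mono_def prod_eq_iff)
  then show "fa_mul (fa_mono u) (fa_mono v) w = fa_mono (u @ v) w"
    unfolding fa_mul_splits by (simp add: sum.delta[OF finite_splits] fa_mono_def mem_splits eq_commute)
qed

lemma fa_zero_carrier: "fa_zero \<in> fa_carrier V Es"
  by (simp add: fa_zero_def fa_carrier_def)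

lemma fa_add_carrier:
  assumes "p \<in> fa_carrier V Es" "q \<in> fa_carrier V Es"
  shows "fa_add p q \<in> fa_carrier V Es"
proof -
  have "finite {w. fa_add p q w \<noteq> 0}"
    by (rule finite_subset[of _ "{w. p w \<noteq> 0} \<union> {w. q w \<noteq> 0}"])
      (use assms in \<open>auto simp: fa_carrier_def fa_add_def\<close>)
  moreover have "p w \<noteq> 0 \<or> q w \<noteq> 0" if "fa_add p q w \<noteq> 0" for w
    using that by (auto simp: fa_add_def)
  ultimately show ?thesis
    using assms by (auto simp: fa_carrier_def fa_add_def)
qed

lemma fa_smul_carrier: "p \<in> fa_carrier V Es \<Longrightarrow> fa_smul c p \<in> fa_carrier V Es"
  by (auto simp: fa_carrier_def fa_smul_def elim: finite_subset[rotated])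

lemma fa_sub_carrier:
  "p \<in> fa_carrier V Es \<Longrightarrow> q \<in> fa_carrier V Es \<Longrightarrow> fa_sub p q \<in> fa_carrier V Es"
  by (simp add: fa_sub_add_smul fa_add_carrier fa_smul_carrier)

lemma fa_mono_carrier: "w \<noteq> [] \<Longrightarrow> \<forall>x\<in>set w. allowed V Es x \<Longrightarrow> fa_mono w \<in> fa_carrier V Es"
  by (simp add: fa_carrier_def fa_mono_def)

lemma fa_mul_support:
  assumes "fa_mul p q w \<noteq> 0"
  obtains x y where "w = x @ y" "p x \<noteq> 0" "q y \<noteq> 0"
proof -
  have "\<exists>a\<in>splits w. p (fst a) * q (snd a) \<noteq> 0"
  proof (rule ccontr)
    assume "\<not> ?thesis"
    then have "fa_mul p q w = 0" unfolding fa_mul_splits by (intro sum.neutral) simp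
    then show False using assms by simp
  qed
  then obtain a where "a \<in> splits w" "p (fst a) * q (snd a) \<noteq> 0" by blast
  then show thesis using that[of "fst a" "snd a"] by (simp add: mem_splits)
qed

lemma fa_mul_carrier:
  assumes p: "p \<in> fa_carrier V Es" and q: "q \<in> fa_carrier V Es"
  shows "fa_mul p q \<in> fa_carrier V Es"
proof -
  have "{w. fa_mul p q w \<noteq> 0} \<subseteq> (\<lambda>(x, y). x @ y) ` ({w. p w \<noteq> 0} \<times> {w. q w \<noteq> 0})"
    by (auto elim!: fa_mul_support)
  then have "finite {w. fa_mul p q w \<noteq> 0}"
    using p q by (auto simp: fa_carrier_def intro: finite_subset)
  moreover have "fa_mul p q [] = 0"
    using p by (simp add: fa_mul_def fa_carrier_def)
  moreover have "\<forall>x\<in>set w. allowed V Es x" if "fa_mul p q w \<noteq> 0" for w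
    using that p q by (auto simp: fa_carrier_def elim!: fa_mul_support)
  ultimately show ?thesis by (simp add: fa_carrier_def)
qed

text \<open>Setting one coefficient to zero shrinks the finite support, and an empty support leaves
  only zero. Linear statements thus need to be checked on words only.\<close>

lemma fa_carrier_induct [consumes 1, case_names zero add]:
  assumes p: "p \<in> fa_carrier V Es"
    and zero: "P fa_zero"
    and add: "\<And>c w p. w \<noteq> [] \<Longrightarrow> \<forall>x\<in>set w. allowed V Es x \<Longrightarrow> p \<in> fa_carrier V Es \<Longrightarrow> P p
      \<Longrightarrow> P (fa_add (fa_smul c (fa_mono w)) p)"
  shows "P p"
proof -
  have "finite {w. p w \<noteq> 0}" using p by (simp add: fa_carrier_def)
  then show ?thesis using p
  proof (induction "{w. p w \<noteq> 0}" arbitrary: p rule: finite_psubset_induct)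
    case psubset
    show ?case
    proof (cases "p = fa_zero")
      case False
      then obtain w where w: "p w \<noteq> 0" by (auto simp: fa_zero_def)
      define q where "q = p(w := 0)"
      have sub: "{x. q x \<noteq> 0} \<subset> {x. p x \<noteq> 0}"
        using w by (auto simp: q_def)
      have q: "q \<in> fa_carrier V Es"
        using psubset.prems finite_subset[OF psubset_imp_subset[OF sub]]
        by (auto simp: fa_carrier_def q_def)
      have "p = fa_add (fa_smul (p w) (fa_mono w)) q"
        by (auto simp: fa_add_def fa_smul_def fa_mono_def q_def)
      moreover have "w \<noteq> []" "\<forall>x\<in>set w. allowed V Es x"
        using w psubset.prems by (auto simp: fa_carrier_def)
      ultimately show ?thesis
        using add[OF _ _ q psubset.hyps(2)[OF sub q]] by metis
    qed (use zero in simp)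
  qed
qed

lemma fa_sum_carrier:
  "finite S \<Longrightarrow> (\<And>i. i \<in> S \<Longrightarrow> f i \<in> fa_carrier V Es) \<Longrightarrow> (\<lambda>w. \<Sum>i\<in>S. f i w) \<in> fa_carrier V Es"
proof (induction S rule: finite_induct)
  case empty
  then show ?case using fa_zero_carrier by (simp add: fa_zero_def)
next
  case (insert i S)
  then have "fa_add (f i) (\<lambda>w. \<Sum>i\<in>S. f i w) \<in> fa_carrier V Es"
    by (intro fa_add_carrier) auto
  then show ?case using insert by (simp add: fa_add_def)
qed

section \<open>Two-sided ideals of the free algebra and the ideal of relations\<close>

definition fa_ideal :: "'v set \<Rightarrow> 'e set \<Rightarrow> ('v, 'e, 'k::field) fa set \<Rightarrow> bool" where
  "fa_ideal V Es I \<longleftrightarrow> I \<subseteq> fa_carrier V Es \<and> fa_zero \<in> I \<and>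
      (\<forall>x\<in>I. \<forall>y\<in>I. fa_add x y \<in> I) \<and> (\<forall>c. \<forall>x\<in>I. fa_smul c x \<in> I) \<and>
      (\<forall>a\<in>fa_carrier V Es. \<forall>x\<in>I. fa_mul a x \<in> I \<and> fa_mul x a \<in> I)"

lemma lpa_J_Inter: "lpa_J V Es s r = \<Inter>{I. fa_ideal V Es I \<and> lpa_rels V Es s r \<subseteq> I}"
  by (simp add: lpa_J_def fa_ideal_def conj_ac)

lemma lpa_rels_carrier:
  assumes "s ` Es \<subseteq> V" "r ` Es \<subseteq> V"
  shows "lpa_rels V Es s r \<subseteq> fa_carrier V Es"
proof -
  have V: "fa_gen (Vg v) \<in> fa_carrier V Es" if "v \<in> V" for v
    using that by (simp add: fa_gen_mono fa_mono_carrier allowed_def)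
  have E: "fa_gen (Eg e) \<in> fa_carrier V Es" "fa_gen (Gg e) \<in> fa_carrier V Es"
      "fa_gen (Vg (s e)) \<in> fa_carrier V Es" "fa_gen (Vg (r e)) \<in> fa_carrier V Es" if "e \<in> Es" for e
    using that assms by (auto simp: fa_gen_mono fa_mono_carrier allowed_def)
  have if_carrier: "(if b then p else fa_zero) \<in> fa_carrier V Es"
    if "p \<in> fa_carrier V Es" for b p
    using that fa_zero_carrier by auto
  note c = fa_sub_carrier fa_mul_carrier if_carrier
  have sum: "fa_sub (fa_gen (Vg v))
      (\<lambda>w. \<Sum>e\<in>{e \<in> Es. s e = v}. fa_mul (fa_gen (Eg e)) (fa_gen (Gg e)) w) \<in> fa_carrier V Es"
    if "v \<in> V" "finite {e \<in> Es. s e = v}" for v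
    using that by (intro fa_sub_carrier fa_sum_carrier) (auto intro: fa_mul_carrier V E)
  show ?thesis
    unfolding lpa_rels_def Un_subset_iff
    using assms by (auto intro!: c V sum simp: E fa_zero_carrier)
qed

lemma fa_ideal_lpa_J:
  assumes "s ` Es \<subseteq> V" "r ` Es \<subseteq> V"
  shows "fa_ideal V Es (lpa_J V Es s r)" and "lpa_rels V Es s r \<subseteq> lpa_J V Es s r"
proof -
  \<comment> \<open>The family whose intersection is \<open>lpa_J\<close> must have a member inside
    the carrier; the carrier itself is one, because edges have their endpoints in
    \<open>V\<close>.\<close>
  have "fa_ideal V Es (fa_carrier V Es)"
    by (auto simp: fa_ideal_def fa_zero_carrier fa_add_carrier fa_smul_carrier fa_mul_carrier)
  then have "lpa_J V Es s r \<subseteq> fa_carrier V Es"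
    using lpa_rels_carrier[OF assms] by (auto simp: lpa_J_Inter)
  then show "fa_ideal V Es (lpa_J V Es s r)"
    unfolding fa_ideal_def lpa_J_Inter by auto
  show "lpa_rels V Es s r \<subseteq> lpa_J V Es s r"
    unfolding lpa_J_Inter by auto
qed

section \<open>Embedding algebras into a ring type\<close>

text \<open>The constructions depending on a graph live on a subset of a type. To have an honest
  ring type, we embed every algebra whose carrier consists of elements of \<^typ>\<open>'a\<close> into the
  product of all such algebras.\<close>

definition is_algebra :: "'a rng_str \<times> ('k::field \<Rightarrow> 'a \<Rightarrow> 'a) \<Rightarrow> bool" where
  "is_algebra S \<longleftrightarrow> (let R = fst S; sc = snd S; C = carr R in
     rzero R \<in> C \<and>
     (\<forall>x\<in>C. rneg R x \<in> C \<and> radd R (rzero R) x = x \<and> radd R (rneg R x) x = rzero R \<and> sc 1 x = x \<and>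
        (\<forall>c. sc c x \<in> C) \<and> (\<forall>c d. sc c (sc d x) = sc (c * d) x \<and> sc (c + d) x = radd R (sc c x) (sc d x))) \<and>
     (\<forall>x\<in>C. \<forall>y\<in>C. radd R x y \<in> C \<and> rmul R x y \<in> C \<and> radd R x y = radd R y x \<and>
        (\<forall>c. sc c (radd R x y) = radd R (sc c x) (sc c y) \<and>
           rmul R (sc c x) y = sc c (rmul R x y) \<and> rmul R x (sc c y) = sc c (rmul R x y))) \<and>
     (\<forall>x\<in>C. \<forall>y\<in>C. \<forall>z\<in>C. radd R (radd R x y) z = radd R x (radd R y z) \<and>
        rmul R (rmul R x y) z = rmul R x (rmul R y z) \<and>
        rmul R (radd R x y) z = radd R (rmul R x z) (rmul R y z) \<and>
        rmul R x (radd R y z) = radd R (rmul R x y) (rmul R x z)))"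

context
  fixes S :: "'a rng_str \<times> ('k::field \<Rightarrow> 'a \<Rightarrow> 'a)"
  assumes S: "is_algebra S"
begin

lemma is_algebra_closed:
  "rzero (fst S) \<in> carr (fst S)"
  "x \<in> carr (fst S) \<Longrightarrow> rneg (fst S) x \<in> carr (fst S)"
  "x \<in> carr (fst S) \<Longrightarrow> snd S c x \<in> carr (fst S)"
  "x \<in> carr (fst S) \<Longrightarrow> y \<in> carr (fst S) \<Longrightarrow> radd (fst S) x y \<in> carr (fst S)"
  "x \<in> carr (fst S) \<Longrightarrow> y \<in> carr (fst S) \<Longrightarrow> rmul (fst S) x y \<in> carr (fst S)"
  using S unfolding is_algebra_def Let_def by blast+

lemma is_algebra_laws:
  "x \<in> carr (fst S) \<Longrightarrow> radd (fst S) (rzero (fst S)) x = x"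
  "x \<in> carr (fst S) \<Longrightarrow> radd (fst S) (rneg (fst S) x) x = rzero (fst S)"
  "x \<in> carr (fst S) \<Longrightarrow> snd S 1 x = x"
  "x \<in> carr (fst S) \<Longrightarrow> snd S c (snd S d x) = snd S (c * d) x"
  "x \<in> carr (fst S) \<Longrightarrow> snd S (c + d) x = radd (fst S) (snd S c x) (snd S d x)"
  "x \<in> carr (fst S) \<Longrightarrow> y \<in> carr (fst S) \<Longrightarrow>
    snd S c (radd (fst S) x y) = radd (fst S) (snd S c x) (snd S c y)"
  "x \<in> carr (fst S) \<Longrightarrow> y \<in> carr (fst S) \<Longrightarrow> rmul (fst S) (snd S c x) y = snd S c (rmul (fst S) x y)"
  "x \<in> carr (fst S) \<Longrightarrow> y \<in> carr (fst S) \<Longrightarrow> rmul (fst S) x (snd S c y) = snd S c (rmul (fst S) x y)"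
  "x \<in> carr (fst S) \<Longrightarrow> y \<in> carr (fst S) \<Longrightarrow> z \<in> carr (fst S) \<Longrightarrow>
    radd (fst S) (radd (fst S) x y) z = radd (fst S) x (radd (fst S) y z)"
  "x \<in> carr (fst S) \<Longrightarrow> y \<in> carr (fst S) \<Longrightarrow> z \<in> carr (fst S) \<Longrightarrow>
    rmul (fst S) (rmul (fst S) x y) z = rmul (fst S) x (rmul (fst S) y z)"
  "x \<in> carr (fst S) \<Longrightarrow> y \<in> carr (fst S) \<Longrightarrow> z \<in> carr (fst S) \<Longrightarrow>
    rmul (fst S) (radd (fst S) x y) z = radd (fst S) (rmul (fst S) x z) (rmul (fst S) y z)"
  "x \<in> carr (fst S) \<Longrightarrow> y \<in> carr (fst S) \<Longrightarrow> z \<in> carr (fst S) \<Longrightarrow>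
    rmul (fst S) x (radd (fst S) y z) = radd (fst S) (rmul (fst S) x y) (rmul (fst S) x z)"
  using S unfolding is_algebra_def Let_def by metis+

lemma is_algebra_add_comm:
  "x \<in> carr (fst S) \<Longrightarrow> y \<in> carr (fst S) \<Longrightarrow> radd (fst S) x y = radd (fst S) y x"
  using S unfolding is_algebra_def Let_def by blast

end

text \<open>The index ranges over all records, algebras or not. The fixed value
  \<open>undefined\<close> at the others makes equality in the type the same as equality at all
  algebras, so that each ring law can be checked componentwise.\<close>

typedef (overloaded) ('a, 'k) alg_prod =
  "{F :: 'a rng_str \<times> ('k::field \<Rightarrow> 'a \<Rightarrow> 'a) \<Rightarrow> 'a.
      \<forall>S. if is_algebra S then F S \<in> carr (fst S) else F S = undefined}"
  by (rule exI[where x = "\<lambda>S. if is_algebra S then rzero (fst S) else undefined"])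
    (simp add: is_algebra_closed del: split_paired_All)

declare split_paired_All [simp del]

setup_lifting type_definition_alg_prod

instantiation alg_prod :: (type, field) ring
begin

lift_definition zero_alg_prod :: "('a, 'k::field) alg_prod" is
  "\<lambda>S. if is_algebra S then rzero (fst S) else undefined"
  by (simp add: is_algebra_closed is_algebra_laws)

lift_definition plus_alg_prod :: "('a, 'k::field) alg_prod \<Rightarrow> ('a, 'k::field) alg_prod \<Rightarrow> ('a, 'k::field) alg_prod" is
  "\<lambda>F G S. if is_algebra S then radd (fst S) (F S) (G S) else undefined"
  by (simp add: is_algebra_closed)

lift_definition uminus_alg_prod :: "('a, 'k::field) alg_prod \<Rightarrow> ('a, 'k::field) alg_prod" is
  "\<lambda>F S. if is_algebra S then rneg (fst S) (F S) else undefined"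
  by (simp add: is_algebra_closed)

lift_definition times_alg_prod :: "('a, 'k::field) alg_prod \<Rightarrow> ('a, 'k::field) alg_prod \<Rightarrow> ('a, 'k::field) alg_prod" is
  "\<lambda>F G S. if is_algebra S then rmul (fst S) (F S) (G S) else undefined"
  by (simp add: is_algebra_closed)

definition minus_alg_prod :: "('a, 'k::field) alg_prod \<Rightarrow> ('a, 'k::field) alg_prod \<Rightarrow> ('a, 'k::field) alg_prod" where
  "minus_alg_prod x y = x + - y"

instance
proof
  fix a b c :: "('a, 'k::field) alg_prod"
  show "a + b + c = a + (b + c)"
    by transfer (simp add: fun_eq_iff is_algebra_closed is_algebra_laws)
  show "a + b = b + a"
    by transfer (simp add: fun_eq_iff is_algebra_add_comm)
  show "0 + a = a"
    by transfer (simp add: fun_eq_iff is_algebra_closed is_algebra_laws)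
  show "- a + a = 0"
    by transfer (simp add: fun_eq_iff is_algebra_closed is_algebra_laws)
  show "a - b = a + - b"
    by (simp add: minus_alg_prod_def)
  show "a * b * c = a * (b * c)"
    by transfer (simp add: fun_eq_iff is_algebra_closed is_algebra_laws)
  show "(a + b) * c = a * c + b * c"
    by transfer (simp add: fun_eq_iff is_algebra_closed is_algebra_laws)
  show "a * (b + c) = a * b + a * c"
    by transfer (simp add: fun_eq_iff is_algebra_closed is_algebra_laws)
qed

end

lift_definition alg_scale :: "'k \<Rightarrow> ('a, 'k::field) alg_prod \<Rightarrow> ('a, 'k) alg_prod" is
  "\<lambda>c F S. if is_algebra S then snd S c (F S) else undefined"
  by (simp add: is_algebra_closed)

lemma vector_space_alg_scale: "vector_space (alg_scale :: 'k \<Rightarrow> ('a, 'k::field) alg_prod \<Rightarrow> _)"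
proof
  fix c d :: 'k and x y :: "('a, 'k) alg_prod"
  show "alg_scale c (x + y) = alg_scale c x + alg_scale c y"
    by transfer (simp add: fun_eq_iff is_algebra_closed is_algebra_laws)
  show "alg_scale (c + d) x = alg_scale c x + alg_scale d x"
    by transfer (simp add: fun_eq_iff is_algebra_closed is_algebra_laws)
  show "alg_scale c (alg_scale d x) = alg_scale (c * d) x"
    by transfer (simp add: fun_eq_iff is_algebra_closed is_algebra_laws)
  show "alg_scale 1 x = x"
    by transfer (simp add: fun_eq_iff is_algebra_closed is_algebra_laws)
qed

lemma alg_scale_mult_left: "alg_scale c x * y = alg_scale c (x * y)"
  and alg_scale_mult_right: "x * alg_scale c y = alg_scale c (x * y)"
  by (transfer; simp add: fun_eq_iff is_algebra_closed is_algebra_laws)+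

text \<open>The inclusion of a single factor into the product.\<close>

definition alg_embed :: "'a rng_str \<times> ('k::field \<Rightarrow> 'a \<Rightarrow> 'a) \<Rightarrow> 'a \<Rightarrow> ('a, 'k) alg_prod" where
  "alg_embed S x = Abs_alg_prod
     (\<lambda>T. if T = S then x else if is_algebra T then rzero (fst T) else undefined)"

context
  fixes S :: "'a rng_str \<times> ('k::field \<Rightarrow> 'a \<Rightarrow> 'a)"
  assumes S: "is_algebra S"
begin

lemma Rep_alg_embed:
  assumes "x \<in> carr (fst S)"
  shows "Rep_alg_prod (alg_embed S x)
    = (\<lambda>T. if T = S then x else if is_algebra T then rzero (fst T) else undefined)"
  unfolding alg_embed_def
  by (rule Abs_alg_prod_inverse) (use assms S in \<open>auto simp: is_algebra_closed is_algebra_laws\<close>)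

lemma Rep_alg_embed_same: "x \<in> carr (fst S) \<Longrightarrow> Rep_alg_prod (alg_embed S x) S = x"
  by (simp add: Rep_alg_embed)

lemma inj_on_alg_embed: "inj_on (alg_embed S) (carr (fst S))"
  by (rule inj_on_inverseI[of _ "\<lambda>y. Rep_alg_prod y S"]) (rule Rep_alg_embed_same)

lemma Rep_alg_prod_carr: "Rep_alg_prod x S \<in> carr (fst S)"
  using Rep_alg_prod[of x] S by (simp split: if_splits)

lemma alg_embed_zero: "alg_embed S (rzero (fst S)) = 0"
  unfolding Rep_alg_prod_inject[symmetric]
  by (subst Rep_alg_embed) (use S in \<open>auto simp: zero_alg_prod.rep_eq is_algebra_closed is_algebra_laws fun_eq_iff\<close>)

lemma alg_embed_add:
  "x \<in> carr (fst S) \<Longrightarrow> y \<in> carr (fst S) \<Longrightarrow> alg_embed S (radd (fst S) x y) = alg_embed S x + alg_embed S y"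
  unfolding Rep_alg_prod_inject[symmetric]
  by (subst Rep_alg_embed)
    (use S in \<open>auto simp: plus_alg_prod.rep_eq Rep_alg_embed is_algebra_closed is_algebra_laws fun_eq_iff\<close>)

lemma alg_embed_neg:
  assumes x: "x \<in> carr (fst S)"
  shows "alg_embed S (rneg (fst S) x) = - alg_embed S x"
proof -
  have "alg_embed S (rneg (fst S) x) + alg_embed S x = alg_embed S (radd (fst S) (rneg (fst S) x) x)"
    by (rule alg_embed_add[symmetric]) (use S x in \<open>auto simp: is_algebra_closed is_algebra_laws\<close>)
  also have "\<dots> = 0"
    using S x by (simp add: is_algebra_closed is_algebra_laws flip: alg_embed_zero)
  finally show ?thesis by (simp add: eq_neg_iff_add_eq_0)
qed

text \<open>The embedding is zero in all other components, so its multiplicativity rests on this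
  law. It is not listed in \<open>is_algebra\<close>; distributivity gives \<open>m + m = m\<close>
  for the product \<open>m\<close>.\<close>

lemma rmul_zero:
  assumes T: "is_algebra T"
  shows "rmul (fst T) (rzero (fst T)) (rzero (fst T)) = rzero (fst T)"
proof -
  define z where "z = rzero (fst T)"
  define m where "m = rmul (fst T) z z"
  have C: "z \<in> carr (fst T)" "m \<in> carr (fst T)" "radd (fst T) z z = z"
    using T by (auto simp: is_algebra_closed is_algebra_laws z_def m_def)
  have mm: "radd (fst T) m m = m"
    using is_algebra_laws(11)[OF T C(1,1,1)] C(3) by (simp add: m_def)
  have "m = radd (fst T) (radd (fst T) (rneg (fst T) m) m) m"
    using T C(2) by (simp add: is_algebra_laws)
  also have "\<dots> = radd (fst T) (rneg (fst T) m) (radd (fst T) m m)"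
    using T C(2) by (intro is_algebra_laws(9) is_algebra_closed)
  also have "\<dots> = z"
    unfolding mm using T C(2) by (simp add: is_algebra_laws z_def)
  finally show ?thesis by (simp add: m_def z_def)
qed

lemma alg_embed_mul:
  assumes "x \<in> carr (fst S)" "y \<in> carr (fst S)"
  shows "alg_embed S (rmul (fst S) x y) = alg_embed S x * alg_embed S y"
proof -
  have "rmul (fst S) x y \<in> carr (fst S)"
    using S assms by (simp add: is_algebra_closed is_algebra_laws)
  then show ?thesis
    unfolding Rep_alg_prod_inject[symmetric] times_alg_prod.rep_eq
    using assms S by (simp add: Rep_alg_embed rmul_zero fun_eq_iff)
qed

lemma alg_embed_scale:
  assumes x: "x \<in> carr (fst S)"
  shows "alg_embed S (snd S c x) = alg_scale c (alg_embed S x)"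
proof -
  interpret vector_space "alg_scale :: 'k \<Rightarrow> ('a, 'k) alg_prod \<Rightarrow> _"
    by (rule vector_space_alg_scale)
  have c: "snd S c x \<in> carr (fst S)"
    using S x by (simp add: is_algebra_closed is_algebra_laws)
  \<comment> \<open>This is not a listed law either; it is the component at \<open>T\<close> of a
    vector space law of the product.\<close>
  have z: "snd T c (rzero (fst T)) = rzero (fst T)" if "is_algebra T" for T :: "'a rng_str \<times> ('k \<Rightarrow> 'a \<Rightarrow> 'a)"
  proof -
    have "Rep_alg_prod (alg_scale c (0 :: ('a, 'k) alg_prod)) T = Rep_alg_prod (0 :: ('a, 'k) alg_prod) T"
      by simp
    then show ?thesis using that by (simp only: alg_scale.rep_eq zero_alg_prod.rep_eq if_True)
  qed
  show ?thesis
    unfolding Rep_alg_prod_inject[symmetric] alg_scale.rep_eq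
    using x c S z by (simp add: Rep_alg_embed fun_eq_iff)
qed

end

declare split_paired_All [simp]

section \<open>Leavitt path algebras and their action on boundary paths\<close>

locale digraph =
  fixes V :: "'v set" and Es :: "'e set" and s r :: "'e \<Rightarrow> 'v"
  assumes source: "e \<in> Es \<Longrightarrow> s e \<in> V" and target: "e \<in> Es \<Longrightarrow> r e \<in> V"
begin

text \<open>In contrast to \<open>is_path\<close> there is a path of length zero at each vertex. The
  empty list does not tell at which one, hence the explicit endpoints.\<close>

fun vpath :: "'v \<Rightarrow> 'e list \<Rightarrow> 'v \<Rightarrow> bool" where
  "vpath v [] u \<longleftrightarrow> v = u \<and> v \<in> V"
| "vpath v (e # p) u \<longleftrightarrow> e \<in> Es \<and> s e = v \<and> vpath (r e) p u"

end

locale leavitt_coset = digraph V Es s r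
  for V :: "'v set" and Es :: "'e set" and s r :: "'e \<Rightarrow> 'v" +
  fixes field_type :: "'k::field itself"
begin

abbreviation "C \<equiv> fa_carrier V Es :: ('v, 'e, 'k) fa set"
abbreviation "J \<equiv> lpa_J V Es s r :: ('v, 'e, 'k) fa set"
abbreviation "coset \<equiv> fa_coset V Es s r :: ('v, 'e, 'k) fa \<Rightarrow> _"
abbreviation "L \<equiv> LPA V Es s r :: ('v, 'e, 'k) fa set rng_str"

section \<open>The quotient by the ideal of relations\<close>

lemma source_target: "s ` Es \<subseteq> V" "r ` Es \<subseteq> V"
  using source target by auto

lemma J_ideal: "fa_ideal V Es J" and rels_J: "lpa_rels V Es s r \<subseteq> J"
  using fa_ideal_lpa_J[OF source_target] by auto

lemma J_carrier: "J \<subseteq> C"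
  and J_zero: "fa_zero \<in> J"
  and J_add: "x \<in> J \<Longrightarrow> y \<in> J \<Longrightarrow> fa_add x y \<in> J"
  and J_smul: "x \<in> J \<Longrightarrow> fa_smul c x \<in> J"
  and J_mul: "a \<in> C \<Longrightarrow> x \<in> J \<Longrightarrow> fa_mul a x \<in> J" "a \<in> C \<Longrightarrow> x \<in> J \<Longrightarrow> fa_mul x a \<in> J"
  using J_ideal by (auto simp: fa_ideal_def)

lemma J_sub_self: "fa_sub p p \<in> J"
  using J_zero by (simp add: fa_sub_def fa_zero_def)

lemma J_sub_sym: "fa_sub p q \<in> J \<Longrightarrow> fa_sub q p \<in> J"
  using J_smul[of "fa_sub p q" "- 1"] by (simp add: fa_sub_def fa_smul_def)

lemma J_sub_trans: "fa_sub p q \<in> J \<Longrightarrow> fa_sub q t \<in> J \<Longrightarrow> fa_sub p t \<in> J"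
  using J_add[of "fa_sub p q" "fa_sub q t"] by (simp add: fa_sub_def fa_add_def)

lemma mem_coset: "q \<in> coset p \<longleftrightarrow> q \<in> C \<and> fa_sub q p \<in> J"
  by (simp add: fa_coset_def)

lemma coset_self: "p \<in> C \<Longrightarrow> p \<in> coset p"
  by (simp add: mem_coset J_sub_self)

lemma coset_eq_iff: "p \<in> C \<Longrightarrow> coset p = coset q \<longleftrightarrow> fa_sub p q \<in> J"
proof
  assume "p \<in> C" and "coset p = coset q"
  then show "fa_sub p q \<in> J" using coset_self[of p] by (simp add: mem_coset)
next
  assume pq: "fa_sub p q \<in> J"
  show "coset p = coset q"
    by (intro set_eqI) (use J_sub_trans[OF _ pq] J_sub_trans[OF _ J_sub_sym[OF pq]] in
      \<open>auto simp: mem_coset\<close>)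
qed

text \<open>The operations of \<open>LPA\<close> range over all representatives. When
  \<open>f\<close> respects congruence modulo \<open>J\<close>, one representative suffices.\<close>

lemma coset_lift:
  assumes "p \<in> C" and "\<And>x. x \<in> coset p \<Longrightarrow> fa_sub (f x) (f p) \<in> J"
  shows "{q \<in> C. \<exists>x\<in>coset p. fa_sub q (f x) \<in> J} = coset (f p)"
proof (intro set_eqI iffI)
  fix q assume "q \<in> {q \<in> C. \<exists>x\<in>coset p. fa_sub q (f x) \<in> J}"
  then show "q \<in> coset (f p)" using assms(2) by (auto simp: mem_coset[of q] intro: J_sub_trans)
next
  fix q assume "q \<in> coset (f p)"
  then show "q \<in> {q \<in> C. \<exists>x\<in>coset p. fa_sub q (f x) \<in> J}"
    using coset_self[OF assms(1)] by (auto simp: mem_coset[of q])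
qed

lemma coset_lift2:
  assumes "p \<in> C" "q \<in> C"
    and "\<And>x y. x \<in> coset p \<Longrightarrow> y \<in> coset q \<Longrightarrow> fa_sub (f x y) (f p q) \<in> J"
  shows "{t \<in> C. \<exists>x\<in>coset p. \<exists>y\<in>coset q. fa_sub t (f x y) \<in> J} = coset (f p q)"
proof (intro set_eqI iffI)
  fix t assume "t \<in> {t \<in> C. \<exists>x\<in>coset p. \<exists>y\<in>coset q. fa_sub t (f x y) \<in> J}"
  then show "t \<in> coset (f p q)" using assms(3) by (auto simp: mem_coset[of t] intro: J_sub_trans)
next
  fix t assume "t \<in> coset (f p q)"
  then show "t \<in> {t \<in> C. \<exists>x\<in>coset p. \<exists>y\<in>coset q. fa_sub t (f x y) \<in> J}"
    using coset_self[OF assms(1)] coset_self[OF assms(2)] by (auto simp: mem_coset[of t])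
qed

lemma carr_LPA: "carr L = coset ` C"
  by (simp add: LPA_def)

lemma rzero_LPA: "rzero L = coset fa_zero"
proof -
  have "coset fa_zero = J"
    using J_carrier by (auto simp: mem_coset fa_sub_def fa_zero_def)
  then show ?thesis by (simp add: LPA_def)
qed

lemma radd_LPA: "p \<in> C \<Longrightarrow> q \<in> C \<Longrightarrow> radd L (coset p) (coset q) = coset (fa_add p q)"
proof -
  assume pq: "p \<in> C" "q \<in> C"
  have "fa_sub (fa_add x y) (fa_add p q) \<in> J" if "x \<in> coset p" "y \<in> coset q" for x y
    using J_add[of "fa_sub x p" "fa_sub y q"] that
    by (simp add: mem_coset fa_add_def fa_sub_def algebra_simps)
  then show ?thesis using coset_lift2[OF pq, of fa_add] by (simp add: LPA_def)
qed

lemma rmul_LPA: "p \<in> C \<Longrightarrow> q \<in> C \<Longrightarrow> rmul L (coset p) (coset q) = coset (fa_mul p q)"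
proof -
  assume pq: "p \<in> C" "q \<in> C"
  have "fa_sub (fa_mul x y) (fa_mul p q) \<in> J" if xy: "x \<in> coset p" "y \<in> coset q" for x y
  proof -
    \<comment> \<open>The usual splitting \<open>x y - p q = (x - p) y + p (y - q)\<close>.\<close>
    have "fa_add (fa_mul (fa_sub x p) y) (fa_mul p (fa_sub y q)) \<in> J"
      using xy pq by (intro J_add J_mul) (auto simp: mem_coset)
    moreover have "fa_add (fa_mul (fa_sub x p) y) (fa_mul p (fa_sub y q)) = fa_sub (fa_mul x y) (fa_mul p q)"
      by (simp add: fa_mul_sub_left fa_mul_sub_right) (simp add: fa_add_def fa_sub_def)
    ultimately show ?thesis by simp
  qed
  then show ?thesis using coset_lift2[OF pq, of fa_mul] by (simp add: LPA_def)
qed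

lemma rneg_LPA: "p \<in> C \<Longrightarrow> rneg L (coset p) = coset (fa_smul (- 1) p)"
proof -
  assume p: "p \<in> C"
  have "fa_sub (fa_smul (- 1) x) (fa_smul (- 1) p) \<in> J" if "x \<in> coset p" for x
    using J_smul[of "fa_sub x p" "- 1"] that by (simp add: mem_coset fa_smul_def fa_sub_def algebra_simps)
  then have "{q \<in> C. \<exists>x\<in>coset p. fa_sub q (fa_smul (- 1) x) \<in> J} = coset (fa_smul (- 1) p)"
    by (rule coset_lift[OF p])
  moreover have "fa_sub q (fa_smul (- 1) x) = fa_add q x" for q x :: "('v, 'e, 'k) fa"
    by (simp add: fa_sub_def fa_smul_def fa_add_def)
  ultimately show ?thesis by (simp add: LPA_def)
qed

text \<open>The record \<open>LPA\<close> carries no scalar multiplication, so the vector space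
  structure is supplied separately.\<close>

definition coset_smul :: "'k \<Rightarrow> ('v, 'e, 'k) fa set \<Rightarrow> ('v, 'e, 'k) fa set" where
  "coset_smul c X = {q \<in> C. \<exists>x\<in>X. fa_sub q (fa_smul c x) \<in> J}"

lemma coset_smul: "p \<in> C \<Longrightarrow> coset_smul c (coset p) = coset (fa_smul c p)"
proof -
  assume p: "p \<in> C"
  have "fa_sub (fa_smul c x) (fa_smul c p) \<in> J" if "x \<in> coset p" for x
    using J_smul[of "fa_sub x p" c] that by (simp add: mem_coset fa_smul_def fa_sub_def algebra_simps)
  then show ?thesis unfolding coset_smul_def by (rule coset_lift[OF p])
qed

lemmas C_closed = fa_zero_carrier fa_add_carrier fa_smul_carrier fa_mul_carrier
lemmas LPA_ops = rzero_LPA radd_LPA rmul_LPA rneg_LPA coset_smul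

lemma fa_module_laws:
  fixes p q t :: "('v, 'e, 'k) fa"
  shows "fa_add fa_zero p = p" "fa_add (fa_smul (- 1) p) p = fa_zero" "fa_smul 1 p = p"
    "fa_smul c (fa_smul d p) = fa_smul (c * d) p"
    "fa_smul (c + d) p = fa_add (fa_smul c p) (fa_smul d p)"
    "fa_smul c (fa_add p q) = fa_add (fa_smul c p) (fa_smul c q)"
    "fa_add (fa_add p q) t = fa_add p (fa_add q t)" "fa_add p fa_zero = p"
    "fa_add p (fa_smul (- 1) p) = fa_zero" "fa_add p (fa_add q t) = fa_add q (fa_add p t)"
  by (simp_all add: fun_eq_iff fa_add_def fa_smul_def fa_zero_def algebra_simps)

lemma fa_add_comm: "fa_add p q = fa_add q (p :: ('v, 'e, 'k) fa)"
  by (simp add: fun_eq_iff fa_add_def)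

lemma is_algebra_LPA: "is_algebra (L, coset_smul)"
  unfolding is_algebra_def Let_def fst_conv snd_conv carr_LPA
  by (simp add: LPA_ops C_closed image_eqI fa_module_laws fa_mul_assoc fa_mul_add_left fa_mul_add_right
      fa_mul_smul_left fa_mul_smul_right fa_add_comm)

definition emb :: "('v, 'e, 'k) fa \<Rightarrow> (('v, 'e, 'k) fa set, 'k) alg_prod" where
  "emb p = alg_embed (L, coset_smul) (coset p)"

lemma emb_ops:
  "emb fa_zero = 0"
  "p \<in> C \<Longrightarrow> q \<in> C \<Longrightarrow> emb (fa_add p q) = emb p + emb q"
  "p \<in> C \<Longrightarrow> q \<in> C \<Longrightarrow> emb (fa_mul p q) = emb p * emb q"
  "p \<in> C \<Longrightarrow> emb (fa_smul c p) = alg_scale c (emb p)"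
  using alg_embed_zero[OF is_algebra_LPA] alg_embed_add[OF is_algebra_LPA]
    alg_embed_mul[OF is_algebra_LPA] alg_embed_scale[OF is_algebra_LPA]
  by (simp_all add: emb_def carr_LPA flip: LPA_ops)

lemma emb_eq_iff: "p \<in> C \<Longrightarrow> q \<in> C \<Longrightarrow> emb p = emb q \<longleftrightarrow> fa_sub p q \<in> J"
proof -
  assume pq: "p \<in> C" "q \<in> C"
  then have "coset p \<in> carr (fst (L, coset_smul))" "coset q \<in> carr (fst (L, coset_smul))"
    by (auto simp: carr_LPA)
  then show ?thesis
    using inj_on_eq_iff[OF inj_on_alg_embed[OF is_algebra_LPA]] pq by (simp add: emb_def coset_eq_iff)
qed

text \<open>A boundary path is an infinite path or a finite path into a sink, the latter padded with
  \<^const>\<open>None\<close>. The free algebra acts on functions on boundary paths decorated with an integer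
  degree; the degree separates different paths with the same boundary path extension.\<close>

definition boundary_path :: "(nat \<Rightarrow> 'v \<times> 'e option) \<Rightarrow> bool" where
  "boundary_path y \<longleftrightarrow> (\<forall>i. case snd (y i) of
      Some e \<Rightarrow> e \<in> Es \<and> s e = fst (y i) \<and> r e = fst (y (Suc i))
    | None \<Rightarrow> y (Suc i) = y i \<and> (\<forall>e\<in>Es. s e \<noteq> fst (y i)))"

definition pcons :: "'e \<Rightarrow> (nat \<Rightarrow> 'v \<times> 'e option) \<Rightarrow> nat \<Rightarrow> 'v \<times> 'e option" where
  "pcons e y = case_nat (s e, Some e) y"

lemma pcons_simps [simp]: "pcons e y 0 = (s e, Some e)" "pcons e y (Suc i) = y i"
  by (simp_all add: pcons_def)

lemma boundary_path_pcons: "e \<in> Es \<Longrightarrow> fst (y 0) = r e \<Longrightarrow> boundary_path y \<Longrightarrow> boundary_path (pcons e y)"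
  unfolding boundary_path_def
proof (intro allI, goal_cases)
  case (1 i)
  then show ?case
    by (cases i) (auto split: option.splits dest: spec[of _ "i - 1"])
qed

lemma boundary_path_shift: "boundary_path y \<Longrightarrow> boundary_path (\<lambda>i. y (Suc i))"
  by (simp add: boundary_path_def)

lemma boundary_path_0:
  assumes "boundary_path y" "snd (y 0) = Some e"
  shows "e \<in> Es" "fst (y 0) = s e" "fst (y (Suc 0)) = r e" "pcons e (\<lambda>i. y (Suc i)) = y"
proof -
  show *: "e \<in> Es" "fst (y 0) = s e" "fst (y (Suc 0)) = r e"
    using assms spec[OF assms(1)[unfolded boundary_path_def], of 0] by auto
  show "pcons e (\<lambda>i. y (Suc i)) = y"
    using assms(2) *(2) by (auto simp: pcons_def fun_eq_iff prod_eq_iff split: nat.split)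
qed

lemma boundary_path_sink: "boundary_path y \<Longrightarrow> snd (y 0) = None \<Longrightarrow> e \<in> Es \<Longrightarrow> s e \<noteq> fst (y 0)"
  unfolding boundary_path_def by (drule spec[of _ 0]) auto

text \<open>Follow a chosen outgoing edge as long as there is one; at a sink the walk stays put, as
  the padding demands.\<close>

lemma boundary_path_exists: "\<exists>y. boundary_path y \<and> fst (y 0) = v"
proof -
  define ch where "ch v = (if \<exists>e\<in>Es. s e = v then Some (SOME e. e \<in> Es \<and> s e = v) else None)" for v
  define nx where "nx v = (case ch v of Some e \<Rightarrow> r e | None \<Rightarrow> v)" for v
  have ch: "e \<in> Es \<and> s e = v" if "ch v = Some e" for v e
    using that someI_ex[of "\<lambda>e. e \<in> Es \<and> s e = v"] by (auto simp: ch_def split: if_splits)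
  have ch': "\<forall>e\<in>Es. s e \<noteq> v" if "ch v = None" for v
    using that by (auto simp: ch_def split: if_splits)
  have "boundary_path (\<lambda>i. ((nx ^^ i) v, ch ((nx ^^ i) v)))"
    unfolding boundary_path_def by (auto split: option.split simp: nx_def dest: ch ch')
  then show ?thesis by (intro exI[of _ "\<lambda>i. ((nx ^^ i) v, ch ((nx ^^ i) v))"]) simp
qed

text \<open>On point masses an edge prepends itself and raises the degree by one, and its ghost
  undoes this. On arbitrary functions these operations become substitutions, so that no finiteness
  condition has to be maintained.\<close>

fun gact :: "('v, 'e) lgen \<Rightarrow> ((nat \<Rightarrow> 'v \<times> 'e option) \<times> int \<Rightarrow> 'k) \<Rightarrow> (nat \<Rightarrow> 'v \<times> 'e option) \<times> int \<Rightarrow> 'k" where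
  "gact (Vg v) f (y, n) = (if boundary_path y \<and> fst (y 0) = v then f (y, n) else 0)"
| "gact (Eg e) f (y, n) = (if boundary_path y \<and> snd (y 0) = Some e then f (\<lambda>i. y (Suc i), n - 1) else 0)"
| "gact (Gg e) f (y, n) = (if boundary_path y \<and> fst (y 0) = r e then f (pcons e y, n + 1) else 0)"

definition wact :: "('v, 'e) lgen list \<Rightarrow> ((nat \<Rightarrow> 'v \<times> 'e option) \<times> int \<Rightarrow> 'k) \<Rightarrow> (nat \<Rightarrow> 'v \<times> 'e option) \<times> int \<Rightarrow> 'k" where
  "wact w = foldr gact w"

definition fa_act :: "('v, 'e, 'k) fa \<Rightarrow> ((nat \<Rightarrow> 'v \<times> 'e option) \<times> int \<Rightarrow> 'k) \<Rightarrow> (nat \<Rightarrow> 'v \<times> 'e option) \<times> int \<Rightarrow> 'k" where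
  "fa_act p f z = (\<Sum>w | p w \<noteq> 0. p w * wact w f z)"

lemma gact_linear:
  "gact x (\<lambda>z. f z + g z) = (\<lambda>z. gact x f z + gact x g z)"
  "gact x (\<lambda>z. c * f z) = (\<lambda>z. c * gact x f z)"
  "gact x (\<lambda>z. 0) = (\<lambda>z. 0)"
  by (cases x; auto simp: fun_eq_iff)+

lemma wact_linear:
  "wact w (\<lambda>z. f z + g z) = (\<lambda>z. wact w f z + wact w g z)"
  "wact w (\<lambda>z. c * f z) = (\<lambda>z. c * wact w f z)"
  "wact w (\<lambda>z. 0) = (\<lambda>z. 0)"
  unfolding wact_def by (induction w) (auto simp: gact_linear)

lemma wact_append: "wact (u @ w) f = wact u (wact w f)"
  by (simp add: wact_def)

lemma fa_act_superset:
  "finite A \<Longrightarrow> {w. p w \<noteq> 0} \<subseteq> A \<Longrightarrow> fa_act p f z = (\<Sum>w\<in>A. p w * wact w f z)"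
  unfolding fa_act_def by (rule sum.mono_neutral_left) auto

lemma C_finite: "p \<in> C \<Longrightarrow> finite {w. p w \<noteq> 0}"
  by (simp add: fa_carrier_def)

lemma fa_act_add: "p \<in> C \<Longrightarrow> q \<in> C \<Longrightarrow> fa_act (fa_add p q) f z = fa_act p f z + fa_act q f z"
proof -
  assume pq: "p \<in> C" "q \<in> C"
  let ?A = "{w. p w \<noteq> 0} \<union> {w. q w \<noteq> 0}"
  have "finite ?A" using pq C_finite by simp
  moreover have "{w. fa_add p q w \<noteq> 0} \<subseteq> ?A" by (auto simp: fa_add_def)
  ultimately show ?thesis
    using fa_act_superset[of ?A _ f z] by (simp add: fa_add_def distrib_right sum.distrib)
qed

lemma fa_act_smul: "p \<in> C \<Longrightarrow> fa_act (fa_smul c p) f z = c * fa_act p f z"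
proof -
  assume p: "p \<in> C"
  have "{w. fa_smul c p w \<noteq> 0} \<subseteq> {w. p w \<noteq> 0}" by (auto simp: fa_smul_def)
  then show ?thesis
    using fa_act_superset[OF C_finite[OF p], of _ f z] by (simp add: fa_smul_def sum_distrib_left mult.assoc)
qed

lemma fa_act_zero: "fa_act fa_zero f z = 0"
  by (simp add: fa_act_def fa_zero_def)

lemma fa_act_sub: "p \<in> C \<Longrightarrow> q \<in> C \<Longrightarrow> fa_act (fa_sub p q) f z = fa_act p f z - fa_act q f z"
  by (simp add: fa_sub_add_smul fa_act_add fa_act_smul C_closed)

lemma fa_act_mono: "fa_act (fa_mono w) f = wact w f"
  by (rule ext, subst fa_act_superset[of "{w}"]) (auto simp: fa_mono_def)

lemma fa_act_mono_mul:
  assumes w: "fa_mono w \<in> C" and q: "q \<in> C"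
  shows "fa_act (fa_mul (fa_mono w) q) f = wact w (fa_act q f)"
  using q
proof (induction rule: fa_carrier_induct)
  case zero
  then show ?case by (simp add: fun_eq_iff fa_mul_zero_right fa_act_zero wact_linear)
next
  case (add c u q)
  then have u: "fa_mono u \<in> C" by (intro fa_mono_carrier)
  have "fa_act (fa_add (fa_smul c (fa_mono u)) q) f = (\<lambda>z. c * wact u f z + fa_act q f z)"
    using u add by (simp add: fun_eq_iff fa_act_add fa_act_smul fa_act_mono C_closed)
  then have R: "wact w (fa_act (fa_add (fa_smul c (fa_mono u)) q) f)
      = (\<lambda>z. c * wact (w @ u) f z + wact w (fa_act q f) z)"
    by (simp add: wact_linear wact_append)
  have "fa_mul (fa_mono w) (fa_add (fa_smul c (fa_mono u)) q)
      = fa_add (fa_smul c (fa_mono (w @ u))) (fa_mul (fa_mono w) q)"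
    by (simp add: fa_mul_add_right fa_mul_smul_right fa_mul_mono)
  moreover have "fa_mono (w @ u) \<in> C"
    using u w C_closed(4) by (simp flip: fa_mul_mono)
  ultimately show ?case
    unfolding R using add w by (intro ext) (simp add: fa_act_add fa_act_smul fa_act_mono C_closed)
qed

lemma fa_act_mul:
  assumes p: "p \<in> C" and q: "q \<in> C"
  shows "fa_act (fa_mul p q) f z = fa_act p (fa_act q f) z"
  using p
proof (induction rule: fa_carrier_induct)
  case zero
  then show ?case by (simp add: fa_mul_zero_left fa_act_zero)
next
  case (add c u p)
  then have u: "fa_mono u \<in> C" by (intro fa_mono_carrier)
  show ?case
    using u add q
    by (simp add: fa_mul_add_left fa_mul_smul_left fa_act_add fa_act_smul fa_act_mono fa_act_mono_mul C_closed)
qed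

lemma fa_act_sum:
  "finite S \<Longrightarrow> (\<And>i. i \<in> S \<Longrightarrow> g i \<in> C) \<Longrightarrow> fa_act (\<lambda>w. \<Sum>i\<in>S. g i w) f z = (\<Sum>i\<in>S. fa_act (g i) f z)"
proof (induction S rule: finite_induct)
  case empty
  then show ?case using fa_act_zero by (simp add: fa_zero_def)
next
  case (insert i S)
  have "fa_act (fa_add (g i) (\<lambda>w. \<Sum>i\<in>S. g i w)) f z = fa_act (g i) f z + fa_act (\<lambda>w. \<Sum>i\<in>S. g i w) f z"
    using insert by (intro fa_act_add fa_sum_carrier) auto
  then show ?case using insert by (simp add: fa_add_def)
qed

lemma gen_C: "allowed V Es x \<Longrightarrow> fa_gen x \<in> C"
  by (simp add: fa_gen_mono fa_mono_carrier)

lemma allowed_simps [simp]: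
  "allowed V Es (Vg v) \<longleftrightarrow> v \<in> V" "allowed V Es (Eg e) \<longleftrightarrow> e \<in> Es" "allowed V Es (Gg e) \<longleftrightarrow> e \<in> Es"
  by (simp_all add: allowed_def)

lemma fa_act_gen: "fa_act (fa_gen x) f = gact x f"
  by (simp add: fa_gen_mono fa_act_mono wact_def)

lemma fa_act_gens: "allowed V Es x \<Longrightarrow> allowed V Es x' \<Longrightarrow>
    fa_act (fa_mul (fa_gen x) (fa_gen x')) f z = gact x (gact x' f) z"
  by (simp add: fa_act_mul gen_C fa_act_gen)

lemma fa_act_rels:
  assumes "p \<in> lpa_rels V Es s r"
  shows "fa_act p f (y, n) = 0"
proof -
  note simps = fa_act_sub fa_act_gens fa_act_gen fa_act_zero gen_C C_closed source target
  \<comment> \<open>A boundary path at a vertex that emits edges starts with exactly one of them, so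
    exactly one summand survives. This is why the paths may stop only at sinks.\<close>
  have cuntz_krieger: "gact (Vg v) f (y, n)
      = (\<Sum>e\<in>{e \<in> Es. s e = v}. gact (Eg e) (gact (Gg e) f) (y, n))"
    if fin: "finite {e \<in> Es. s e = v}" and ne: "{e \<in> Es. s e = v} \<noteq> {}" for v
  proof (cases "boundary_path y \<and> fst (y 0) = v")
    case True
    then obtain e where e: "snd (y 0) = Some e"
      using ne boundary_path_sink[of y] by (cases "snd (y 0)") auto
    have "(\<Sum>e'\<in>{e \<in> Es. s e = v}. gact (Eg e') (gact (Gg e') f) (y, n))
        = (\<Sum>e'\<in>{e \<in> Es. s e = v}. if e' = e then f (y, n) else 0)"
      using True e boundary_path_0[of y e] by (intro sum.cong) (auto simp: boundary_path_shift)
    also have "\<dots> = f (y, n)"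
      using True e boundary_path_0[of y e] fin by (simp add: sum.delta)
    finally show ?thesis using True by simp
  next
    case False
    have "gact (Eg e) (gact (Gg e) f) (y, n) = 0" if "s e = v" for e
      using False that boundary_path_0[of y e] by auto
    then have "(\<Sum>e\<in>{e \<in> Es. s e = v}. gact (Eg e) (gact (Gg e) f) (y, n)) = 0"
      by (intro sum.neutral) blast
    then show ?thesis using False by auto
  qed
  show ?thesis
    using assms unfolding lpa_rels_def
  proof (elim UnE, goal_cases)
    case 1
    then show ?thesis by (auto simp: simps)
  next
    case 2
    then show ?thesis by (auto simp: simps dest: boundary_path_0)
  next
    case 3
    then show ?thesis by (auto simp: simps boundary_path_shift dest: boundary_path_0)
  next
    case 4
    then show ?thesis by (auto simp: simps)
  next
    case 5
    then show ?thesis by (auto simp: simps boundary_path_pcons)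
  next
    case 6
    then show ?thesis by (auto simp: simps boundary_path_pcons)
  next
    case 7
    then obtain v where v: "v \<in> V" "finite {e \<in> Es. s e = v}" "{e \<in> Es. s e = v} \<noteq> {}"
      and p: "p = fa_sub (fa_gen (Vg v)) (\<lambda>w. \<Sum>e\<in>{e \<in> Es. s e = v}. fa_mul (fa_gen (Eg e)) (fa_gen (Gg e)) w)"
      by blast
    have sum: "(\<lambda>w. \<Sum>e\<in>{e \<in> Es. s e = v}. fa_mul (fa_gen (Eg e)) (fa_gen (Gg e)) w) \<in> C"
      using v by (intro fa_sum_carrier) (auto simp: gen_C C_closed)
    have "fa_act p f (y, n) = gact (Vg v) f (y, n)
        - (\<Sum>e\<in>{e \<in> Es. s e = v}. fa_act (fa_mul (fa_gen (Eg e)) (fa_gen (Gg e))) f (y, n))"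
      using v sum unfolding p
      by (subst fa_act_sub) (auto simp: fa_act_gen gen_C C_closed intro!: fa_act_sum)
    also have "\<dots> = 0"
      using cuntz_krieger[OF v(2,3)] by (simp add: fa_act_gens)
    finally show ?thesis .
  qed
qed

text \<open>The elements that act as zero form an ideal containing the relations, and
  \<open>J\<close> is the least such ideal.\<close>

lemma fa_act_J: "p \<in> J \<Longrightarrow> fa_act p f z = 0"
proof -
  let ?K = "{p \<in> C. \<forall>f z. fa_act p f z = 0}"
  have "fa_act a (fa_act x f) z = 0" if "\<forall>f z. fa_act x f z = 0" for a x f z
  proof -
    have "fa_act x f = (\<lambda>z. 0)" using that by blast
    then show ?thesis by (simp add: fa_act_def wact_linear)
  qed
  then have "fa_ideal V Es ?K"
    unfolding fa_ideal_def
    by (simp add: C_closed fa_act_add fa_act_smul fa_act_zero fa_act_mul)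
  moreover have "lpa_rels V Es s r \<subseteq> ?K"
    using fa_act_rels lpa_rels_carrier[OF source_target] by fastforce
  ultimately have "J \<subseteq> ?K" unfolding lpa_J_Inter by auto
  then show "p \<in> J \<Longrightarrow> fa_act p f z = 0" by blast
qed

section \<open>Coefficient functionals of paths\<close>

definition ev :: "((nat \<Rightarrow> 'v \<times> 'e option) \<times> int \<Rightarrow> 'k) \<Rightarrow> (nat \<Rightarrow> 'v \<times> 'e option) \<times> int
    \<Rightarrow> (('v, 'e, 'k) fa set, 'k) alg_prod \<Rightarrow> 'k" where
  "ev f z x = fa_act (SOME q. q \<in> Rep_alg_prod x (L, coset_smul)) f z"

lemma ev_Rep:
  assumes p: "p \<in> C" and x: "Rep_alg_prod x (L, coset_smul) = coset p"
  shows "ev f z x = fa_act p f z"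
proof -
  define q where "q = (SOME q. q \<in> coset p)"
  have q: "q \<in> coset p" unfolding q_def by (rule someI[of _ p]) (rule coset_self[OF p])
  then have "fa_act (fa_sub q p) f z = 0" by (intro fa_act_J) (simp add: mem_coset)
  then have "fa_act q f z = fa_act p f z" using q p by (simp add: fa_act_sub mem_coset)
  then show ?thesis by (simp add: ev_def x q_def)
qed

lemma Rep_coset: "\<exists>p\<in>C. Rep_alg_prod x (L, coset_smul) = coset p"
  using Rep_alg_prod_carr[OF is_algebra_LPA, of x] by (auto simp: carr_LPA)

lemma ev_add: "ev f z (x + y) = ev f z x + ev f z y"
proof -
  obtain p q where pq: "p \<in> C" "q \<in> C" "Rep_alg_prod x (L, coset_smul) = coset p"
    "Rep_alg_prod y (L, coset_smul) = coset q"
    using Rep_coset by meson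
  then have "Rep_alg_prod (x + y) (L, coset_smul) = coset (fa_add p q)"
    by (simp add: plus_alg_prod.rep_eq is_algebra_LPA radd_LPA)
  then show ?thesis using pq by (simp add: ev_Rep[of "fa_add p q"] ev_Rep[of p] ev_Rep[of q] C_closed fa_act_add)
qed

lemma ev_scale: "ev f z (alg_scale c x) = c * ev f z x"
proof -
  obtain p where p: "p \<in> C" "Rep_alg_prod x (L, coset_smul) = coset p"
    using Rep_coset by meson
  then have "Rep_alg_prod (alg_scale c x) (L, coset_smul) = coset (fa_smul c p)"
    by (simp add: alg_scale.rep_eq is_algebra_LPA coset_smul)
  then show ?thesis using p by (simp add: ev_Rep[of "fa_smul c p"] ev_Rep[of p] C_closed fa_act_smul)
qed

lemma ev_emb: "p \<in> C \<Longrightarrow> ev f z (emb p) = fa_act p f z"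
  by (rule ev_Rep) (auto simp: emb_def carr_LPA intro!: Rep_alg_embed_same[OF is_algebra_LPA])

lemma boundary_path_append:
  "vpath v p (fst (y 0)) \<Longrightarrow> boundary_path y \<Longrightarrow> boundary_path (foldr pcons p y) \<and> fst (foldr pcons p y 0) = v"
  by (induction p arbitrary: v) (auto intro!: boundary_path_pcons)

text \<open>The infinite repetition of a cycle does not change when the cycle is prepended, so paths
  of different lengths have to be told apart by the degree.\<close>

lemma wact_path_degree:
  "n \<noteq> int (length p) \<Longrightarrow> wact (map Eg p @ [Vg u]) (\<lambda>z. if z = (y, 0) then 1 else 0) (y', n) = 0"
  by (induction p arbitrary: y' n) (auto simp: wact_def)

lemma wact_path:
  assumes y: "boundary_path y" "fst (y 0) = u"
  shows "vpath v p u \<Longrightarrow> vpath v' q u \<Longrightarrow>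
    wact (map Eg p @ [Vg u]) (\<lambda>z. if z = (y, 0) then 1 else 0) (foldr pcons q y, int (length q))
      = (if p = q then 1 else 0)"
proof (induction p arbitrary: v v' q)
  case Nil
  then show ?case using y by (auto simp: wact_def)
next
  case (Cons e p)
  show ?case
  proof (cases q)
    case Nil
    \<comment> \<open>Stripping \<open>e\<close> lowers the degree to -1, which is the length of no
      path.\<close>
    then show ?thesis
      using wact_path_degree[of "- 1" p] by (simp add: wact_def)
  next
    case (Cons e' q')
    have "boundary_path (pcons e' (foldr pcons q' y))"
      using boundary_path_append[of v' q y] Cons.prems y \<open>q = _\<close> by auto
    then show ?thesis
      using Cons.IH[of "r e" "r e'" q'] Cons.prems \<open>q = _\<close> by (auto simp: wact_def)
  qed
qed

text \<open>The functionals live on the whole product type, because \<open>ev\<close> first projects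
  to the component of \<open>L\<close>. If \<open>q\<close> is not a path into \<open>u\<close>, no
  path \<open>p\<close> into \<open>u\<close> equals it and the zero functional will do.\<close>

lemma path_functional:
  "\<exists>g :: (('v, 'e, 'k) fa set, 'k) alg_prod \<Rightarrow> 'k. (\<forall>x y. g (x + y) = g x + g y) \<and>
    (\<forall>c x. g (alg_scale c x) = c * g x) \<and>
    (\<forall>p v. vpath v p u \<longrightarrow> g (emb (fa_mono (map Eg p @ [Vg u]))) = (if p = q then 1 else 0))"
proof (cases "\<exists>v. vpath v q u")
  case True
  then obtain v where q: "vpath v q u" by blast
  obtain y where y: "boundary_path y" "fst (y 0) = u" using boundary_path_exists by blast
  have C: "fa_mono (map Eg p @ [Vg u]) \<in> C" if "vpath v p u" for v p
  proof -
    have "\<forall>x\<in>set (map Eg p @ [Vg u]). allowed V Es x"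
      using that by (induction p arbitrary: v) auto
    then show ?thesis by (intro fa_mono_carrier) auto
  qed
  \<comment> \<open>The path \<open>p\<close> moves the point mass at \<open>(y, 0)\<close> to
    \<open>p\<close> followed by \<open>y\<close>, in degree \<open>length p\<close>; the functional
    reads off the value at \<open>q\<close> followed by \<open>y\<close>, in degree
    \<open>length q\<close>.\<close>
  show ?thesis
    by (intro exI[of _ "ev (\<lambda>z. if z = (y, 0) then 1 else 0) (foldr pcons q y, int (length q))"])
      (use wact_path[OF y _ q] in \<open>auto simp: ev_add ev_scale ev_emb C fa_act_mono\<close>)
next
  case False
  then show ?thesis by (intro exI[of _ "\<lambda>x. 0"]) auto
qed

end

section \<open>Algebras generated by a Leavitt family\<close>

context digraph begin

lemma vpath_V: "vpath v p u \<Longrightarrow> v \<in> V \<and> u \<in> V"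
  by (induction p arbitrary: v) (auto simp: source)

lemma vpath_append: "vpath v (p @ q) u \<longleftrightarrow> (\<exists>w. vpath v p w \<and> vpath w q u)"
  by (induction p arbitrary: v) (auto dest: vpath_V simp: source)

lemma vpath_end_unique: "vpath v p u \<Longrightarrow> vpath v p u' \<Longrightarrow> u = u'"
  by (induction p arbitrary: v) auto

lemma vpath_append_cancel: "vpath v p w \<Longrightarrow> vpath v (p @ q) u \<Longrightarrow> vpath w q u"
  using vpath_end_unique by (auto simp: vpath_append)

definition hereditary :: "'v set \<Rightarrow> bool" where
  "hereditary W \<longleftrightarrow> W \<subseteq> V \<and> (\<forall>e\<in>Es. s e \<in> W \<longrightarrow> r e \<in> W)"

lemma hereditary_V: "hereditary V"
  by (simp add: hereditary_def target)

lemma vpath_hereditary: "vpath u p w \<Longrightarrow> hereditary W \<Longrightarrow> u \<in> W \<Longrightarrow> w \<in> W"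
  by (induction p arbitrary: u) (auto simp: hereditary_def)

end

text \<open>The assumption \<open>path_coeff\<close> states the independence of the paths into
  \<open>u\<close> through dual functionals. It is the only assumption that forbids collapse; with
  \<open>q = []\<close> it shows that no vertex vanishes.\<close>

locale leavitt = digraph V Es s r + vector_space scale
  for V :: "'v set" and Es :: "'e set" and s r :: "'e \<Rightarrow> 'v"
    and scale :: "'k::field \<Rightarrow> 'a::ring \<Rightarrow> 'a" (infixr "*s" 75) +
  fixes vx :: "'v \<Rightarrow> 'a" and ed gh :: "'e \<Rightarrow> 'a"
  assumes scale_mult_left: "(c *s x) * y = c *s (x * y)"
    and scale_mult_right: "x * (c *s y) = c *s (x * y)"
    and vx_vx: "v \<in> V \<Longrightarrow> u \<in> V \<Longrightarrow> vx v * vx u = (if v = u then vx v else 0)"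
    and s_ed: "e \<in> Es \<Longrightarrow> vx (s e) * ed e = ed e"
    and ed_r: "e \<in> Es \<Longrightarrow> ed e * vx (r e) = ed e"
    and r_gh: "e \<in> Es \<Longrightarrow> vx (r e) * gh e = gh e"
    and gh_s: "e \<in> Es \<Longrightarrow> gh e * vx (s e) = gh e"
    and gh_ed: "e \<in> Es \<Longrightarrow> f \<in> Es \<Longrightarrow> gh e * ed f = (if e = f then vx (r e) else 0)"
    and vx_sum: "v \<in> V \<Longrightarrow> finite {e \<in> Es. s e = v} \<Longrightarrow> {e \<in> Es. s e = v} \<noteq> {} \<Longrightarrow>
      vx v = (\<Sum>e\<in>{e \<in> Es. s e = v}. ed e * gh e)"
    and path_coeff: "\<exists>g. (\<forall>x y. g (x + y) = g x + g y) \<and> (\<forall>c x. g (c *s x) = c * g x) \<and>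
      (\<forall>p v. vpath v p u \<longrightarrow> g (foldr (\<lambda>e. (*) (ed e)) p (vx u)) = (if p = q then 1 else 0))"
begin

text \<open>The final vertex takes the place of the empty product: the ring need not have a
  unit.\<close>

fun mp :: "'e list \<Rightarrow> 'v \<Rightarrow> 'a" where
  "mp [] u = vx u"
| "mp (e # p) u = ed e * mp p u"

fun gp :: "'e list \<Rightarrow> 'v \<Rightarrow> 'a" where
  "gp [] u = vx u"
| "gp (e # p) u = gp p u * gh e"

lemma mult_zero_trans: "a * b = 0 \<Longrightarrow> a * (b * c) = 0" "b * c = 0 \<Longrightarrow> (a * b) * c = 0" for a b c :: 'a
  by (simp add: mult.assoc[symmetric]) (simp add: mult.assoc)

lemma vx_mp: "vpath v p u \<Longrightarrow> vx v * mp p u = mp p u"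
  by (cases p) (auto simp: vx_vx s_ed mult.assoc[symmetric])

lemma mp_vx: "vpath v p u \<Longrightarrow> mp p u * vx u = mp p u"
  by (induction p arbitrary: v) (auto simp: vx_vx mult.assoc)

lemma gp_vx: "vpath v p u \<Longrightarrow> gp p u * vx v = gp p u"
  by (cases p) (auto simp: vx_vx gh_s mult.assoc)

lemma vx_gp: "vpath v p u \<Longrightarrow> vx u * gp p u = gp p u"
  by (induction p arbitrary: v) (auto simp: vx_vx mult.assoc[symmetric])

lemma vx_mp_other: "vpath v p u \<Longrightarrow> w \<in> V \<Longrightarrow> w \<noteq> v \<Longrightarrow> vx w * mp p u = 0"
  using mult_zero_trans(1)[of "vx w" "vx v" "mp p u"] vpath_V by (auto simp: vx_vx vx_mp)

lemma gp_vx_other: "vpath v p u \<Longrightarrow> w \<in> V \<Longrightarrow> w \<noteq> v \<Longrightarrow> gp p u * vx w = 0"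
  using mult_zero_trans(2)[of "vx v" "vx w" "gp p u"] vpath_V by (auto simp: vx_vx gp_vx)

lemma mp_append: "vpath v p w \<Longrightarrow> vpath w q u \<Longrightarrow> mp (p @ q) u = mp p w * mp q u"
  by (induction p arbitrary: v) (auto simp: vx_mp mult.assoc)

lemma gp_append: "vpath v p w \<Longrightarrow> vpath w q u \<Longrightarrow> gp (p @ q) u = gp q u * gp p w"
  by (induction p arbitrary: v) (auto simp: gp_vx mult.assoc)

lemma gp_mp: "vpath v p u \<Longrightarrow> gp p u * mp p u = vx u"
proof (induction p arbitrary: v)
  case (Cons e p)
  then have e: "e \<in> Es" "vpath (r e) p u" by auto
  have "gp (e # p) u * mp (e # p) u = gp p u * (gh e * ed e) * mp p u"
    by (simp add: mult.assoc)
  also have "\<dots> = gp p u * (vx (r e) * mp p u)"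
    using e by (simp add: gh_ed mult.assoc)
  finally show ?case using e Cons.IH by (simp add: vx_mp)
qed (simp add: vx_vx)

lemma gp_mp_longer: "vpath v q w \<Longrightarrow> vpath w t u \<Longrightarrow> gp q w * mp (q @ t) u = mp t u"
  by (simp add: mp_append[of v] mult.assoc[symmetric] gp_mp[of v] vx_mp)

lemma gp_mp_shorter: "vpath v q w \<Longrightarrow> vpath w t u \<Longrightarrow> gp (q @ t) u * mp q w = gp t u"
  by (simp add: gp_append[of v] mult.assoc gp_mp[of v] gp_vx)

text \<open>Common initial edges cancel until the paths first differ, and there \<open>gh_ed\<close>
  gives zero.\<close>

lemma gp_mp_other:
  "vpath v q w \<Longrightarrow> vpath v' p u \<Longrightarrow> (\<And>t. p \<noteq> q @ t) \<Longrightarrow> (\<And>t. q \<noteq> p @ t) \<Longrightarrow> gp q w * mp p u = 0"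
proof (induction q arbitrary: v v' p)
  case (Cons f q)
  from Cons.prems(4)[of "f # q"] obtain e p' where p: "p = e # p'" by (cases p) auto
  have e: "e \<in> Es" "f \<in> Es" "vpath (r f) q w" "vpath (r e) p' u" using Cons.prems(1,2) p by auto
  have "gp (f # q) w * mp p u = gp q w * ((gh f * ed e) * mp p' u)"
    by (simp add: p mult.assoc)
  also have "\<dots> = 0"
  proof (cases "e = f")
    case True
    have "gp q w * mp p' u = 0"
      using Cons.IH[OF e(3,4)] Cons.prems(3,4) True p by auto
    then show ?thesis using e True by (simp add: gh_ed vx_mp)
  qed (use e in \<open>simp add: gh_ed\<close>)
  finally show ?case .
next
  case Nil
  then show ?case by (metis append_Nil)
qed

text \<open>All products of monomials are computed by this trichotomy. A nonempty \<open>t\<close>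
  in the second case assigns equal paths to the first.\<close>

lemma gp_mp_cases:
  assumes q: "vpath v q w" and p: "vpath v' p u"
  obtains (longer) t where "v = v'" "p = q @ t" "vpath w t u" "gp q w * mp p u = mp t u"
  | (shorter) t where "v = v'" "t \<noteq> []" "q = p @ t" "vpath u t w" "gp q w * mp p u = gp t w"
  | (other) "gp q w * mp p u = 0"
proof (cases "v = v'")
  case False
  have "gp q w * mp p u = gp q w * vx v * (vx v' * mp p u)"
    using p q by (simp add: gp_vx vx_mp)
  also have "\<dots> = gp q w * (vx v * vx v') * mp p u" by (simp add: mult.assoc)
  also have "\<dots> = 0" using False p q vpath_V by (simp add: vx_vx)
  finally show ?thesis by (rule other)
next
  case True
  consider t where "p = q @ t" | t where "t \<noteq> []" "q = p @ t" | "\<And>t. p \<noteq> q @ t" "\<And>t. q \<noteq> p @ t"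
    by (metis append_Nil2)
  then show ?thesis
  proof cases
    case (1 t)
    then have "vpath w t u" using p q True by (metis vpath_append_cancel)
    then show ?thesis using longer[of t] 1 True q gp_mp_longer by blast
  next
    case (2 t)
    then have "vpath u t w" using p q True by (metis vpath_append_cancel)
    then show ?thesis using shorter[of t] 2 True p gp_mp_shorter by blast
  next
    case 3
    then show ?thesis using other gp_mp_other[OF q p] by blast
  qed
qed

section \<open>Monomials and the ideals they span\<close>

lemma span_mult:
  assumes "subspace S" "\<And>a b. a \<in> A \<Longrightarrow> b \<in> B \<Longrightarrow> a * b \<in> S" "x \<in> span A" "y \<in> span B"
  shows "x * y \<in> S"
  using assms(3)
proof (induction rule: span_induct_alt)
  case base
  then show ?case using assms(1) by (simp add: subspace_0)
next
  case (step c a x)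
  have "a * y \<in> S"
    using assms(4)
  proof (induction rule: span_induct_alt)
    case base
    then show ?case using assms(1) by (simp add: subspace_0)
  next
    case (step d b y)
    then show ?case using assms(1,2) \<open>a \<in> A\<close>
      by (simp add: distrib_left scale_mult_right subspace_add subspace_scale)
  qed
  then show ?case using assms(1) step
    by (simp add: distrib_right scale_mult_left subspace_add subspace_scale)
qed

definition monomials :: "'v set \<Rightarrow> 'a set" where
  "monomials W = {mp p u * gp q u | p q u. u \<in> W \<and> (\<exists>v. vpath v p u) \<and> (\<exists>w. vpath w q u)}"

text \<open>For hereditary \<open>W\<close> this is the ideal generated by the vertices in
  \<open>W\<close>; for \<open>W = V\<close> it is the whole algebra.\<close>

definition vspan :: "'v set \<Rightarrow> 'a set" where
  "vspan W = span (monomials W)"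

lemma monomialI: "vpath v p u \<Longrightarrow> vpath w q u \<Longrightarrow> u \<in> W \<Longrightarrow> mp p u * gp q u \<in> monomials W"
  by (auto simp: monomials_def)

lemma vspan_mono: "W \<subseteq> W' \<Longrightarrow> vspan W \<subseteq> vspan W'"
  unfolding vspan_def by (rule span_mono) (auto simp: monomials_def)

lemma subspace_vspan: "subspace (vspan W)"
  by (simp add: vspan_def)

lemma monomial_vspan: "x \<in> monomials W \<Longrightarrow> x \<in> vspan W"
  by (simp add: vspan_def span_base)

lemma mp_vspan: "vpath v p u \<Longrightarrow> u \<in> W \<Longrightarrow> mp p u \<in> vspan W"
  using monomialI[of v p u u "[]" W] vpath_V[of v p u] by (simp add: mp_vx monomial_vspan)

lemma gp_vspan: "vpath v p u \<Longrightarrow> u \<in> W \<Longrightarrow> gp p u \<in> vspan W"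
  using monomialI[of u "[]" u v p W] vpath_V[of v p u] by (simp add: vx_gp monomial_vspan)

text \<open>The paths \<open>t\<close> and \<open>t'\<close> record that the middle vertex of the
  product can be reached from the middle vertices of both factors. Hereditary sets therefore absorb
  products.\<close>

lemma monomial_mult:
  assumes "vpath v p u" "vpath w q u" "vpath v' p' u'" "vpath w' q' u'"
  shows "(mp p u * gp q u) * (mp p' u' * gp q' u') = 0 \<or>
    (\<exists>p'' q'' z t t'. vpath v p'' z \<and> vpath w' q'' z \<and> vpath u t z \<and> vpath u' t' z \<and>
      (mp p u * gp q u) * (mp p' u' * gp q' u') = mp p'' z * gp q'' z)"
proof -
  have M: "(mp p u * gp q u) * (mp p' u' * gp q' u') = mp p u * (gp q u * mp p' u') * gp q' u'"
    by (simp add: mult.assoc)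
  from assms(2,3) show ?thesis
  proof (cases rule: gp_mp_cases)
    case (longer t)
    have "(mp p u * gp q u) * (mp p' u' * gp q' u') = mp (p @ t) u' * gp q' u'"
      unfolding M longer(4) using assms(1) longer(3) by (simp add: mp_append[of v])
    moreover have "vpath v (p @ t) u'" using assms longer by (auto simp: vpath_append)
    moreover have "vpath u' [] u'" using assms(3) vpath_V by auto
    ultimately show ?thesis using assms longer by metis
  next
    case (shorter t)
    have "(mp p u * gp q u) * (mp p' u' * gp q' u') = mp p u * gp (q' @ t) u"
      unfolding M shorter(5) using assms(4) shorter(4) by (simp add: gp_append[of w'] mult.assoc)
    moreover have "vpath w' (q' @ t) u" using assms shorter by (auto simp: vpath_append)
    moreover have "vpath u [] u" using assms(1) vpath_V by auto
    ultimately show ?thesis using assms shorter by metis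
  qed (simp add: M)
qed

lemma monomial_mult_vspan:
  assumes "x \<in> monomials W" "y \<in> monomials W'"
    and "\<And>u u' z t t'. u \<in> W \<Longrightarrow> u' \<in> W' \<Longrightarrow> vpath u t z \<Longrightarrow> vpath u' t' z \<Longrightarrow> z \<in> W''"
  shows "x * y \<in> vspan W''"
proof -
  obtain p q u v w where x: "x = mp p u * gp q u" "u \<in> W" "vpath v p u" "vpath w q u"
    using assms(1) by (auto simp: monomials_def)
  obtain p' q' u' v' w' where y: "y = mp p' u' * gp q' u'" "u' \<in> W'" "vpath v' p' u'" "vpath w' q' u'"
    using assms(2) by (auto simp: monomials_def)
  from monomial_mult[OF x(3,4) y(3,4)] show ?thesis
  proof (elim disjE exE conjE)
    fix p'' q'' z t t'
    assume "vpath v p'' z" "vpath w' q'' z" "vpath u t z" "vpath u' t' z"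
      and eq: "mp p u * gp q u * (mp p' u' * gp q' u') = mp p'' z * gp q'' z"
    then show ?thesis
      using x y assms(3)[of u u' t z t'] by (auto intro: monomial_vspan monomialI)
  qed (simp add: x y vspan_def span_zero)
qed

text \<open>With \<open>W'' = {}\<close> this also yields vanishing products, for sets of vertices
  without common descendants.\<close>

lemma vspan_mult:
  assumes "\<And>u u' z t t'. u \<in> W \<Longrightarrow> u' \<in> W' \<Longrightarrow> vpath u t z \<Longrightarrow> vpath u' t' z \<Longrightarrow> z \<in> W''"
    and "x \<in> vspan W" "y \<in> vspan W'"
  shows "x * y \<in> vspan W''"
  by (rule span_mult[of _ "monomials W" "monomials W'"])
    (use assms in \<open>auto simp: subspace_vspan intro: monomial_mult_vspan simp flip: vspan_def\<close>)

definition leavitt_ring :: "'a rng_str" where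
  "leavitt_ring = \<lparr>carr = vspan V, radd = (+), rmul = (*), rzero = 0, rneg = uminus\<rparr>"

abbreviation "ideal \<equiv> is_ideal leavitt_ring"

lemma ideal_iff: "ideal I \<longleftrightarrow> I \<subseteq> vspan V \<and> 0 \<in> I \<and> (\<forall>x\<in>I. \<forall>y\<in>I. x + y \<in> I) \<and> (\<forall>x\<in>I. - x \<in> I) \<and>
    (\<forall>a\<in>vspan V. \<forall>x\<in>I. a * x \<in> I \<and> x * a \<in> I)"
  by (simp add: is_ideal_def leavitt_ring_def)

lemma ideal_vspan: "hereditary W \<Longrightarrow> ideal (vspan W)"
  unfolding ideal_iff
proof (intro conjI ballI)
  assume W: "hereditary W"
  then show "vspan W \<subseteq> vspan V" by (intro vspan_mono) (simp add: hereditary_def)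
  show "0 \<in> vspan W" "\<And>x y. x \<in> vspan W \<Longrightarrow> y \<in> vspan W \<Longrightarrow> x + y \<in> vspan W"
    "\<And>x. x \<in> vspan W \<Longrightarrow> - x \<in> vspan W"
    using subspace_vspan by (auto intro: subspace_0 subspace_add subspace_neg)
  show "a * x \<in> vspan W" if "a \<in> vspan V" "x \<in> vspan W" for a x
    using that W by (intro vspan_mult[of V W]) (auto elim: vpath_hereditary)
  show "x * a \<in> vspan W" if "a \<in> vspan V" "x \<in> vspan W" for a x
    using that W by (intro vspan_mult[of W V]) (auto elim: vpath_hereditary)
qed

text \<open>Demanding the property for all larger finite sets lets the induction merge the local
  units of two summands.\<close>

lemma local_unit:
  "x \<in> vspan V \<Longrightarrow> \<exists>F. finite F \<and> F \<subseteq> V \<and> (\<forall>F'. finite F' \<longrightarrow> F \<subseteq> F' \<longrightarrow> F' \<subseteq> V \<longrightarrow>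
    sum vx F' * x = x \<and> x * sum vx F' = x)"
  unfolding vspan_def
proof (induction rule: span_induct_alt)
  case base
  then show ?case by auto
next
  case (step c a x)
  then obtain p q u v w where a: "a = mp p u * gp q u" "vpath v p u" "vpath w q u"
    by (auto simp: monomials_def)
  from step obtain F where F: "finite F" "F \<subseteq> V" "\<forall>F'. finite F' \<longrightarrow> F \<subseteq> F' \<longrightarrow> F' \<subseteq> V \<longrightarrow>
    sum vx F' * x = x \<and> x * sum vx F' = x" by blast
  have 1: "sum vx F' * a = a" if F': "finite F'" "F' \<subseteq> V" "v \<in> F'" for F'
  proof -
    have "sum vx F' * mp p u = (\<Sum>v'\<in>F'. if v' = v then mp p u else 0)"
      unfolding sum_distrib_right
      using a F' by (intro sum.cong) (auto simp: vx_mp vx_mp_other)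
    then show ?thesis using F' a by (simp add: mult.assoc[symmetric])
  qed
  have 2: "a * sum vx F' = a" if F': "finite F'" "F' \<subseteq> V" "w \<in> F'" for F'
  proof -
    have "gp q u * sum vx F' = (\<Sum>v'\<in>F'. if v' = w then gp q u else 0)"
      unfolding sum_distrib_left
      using a F' by (intro sum.cong) (auto simp: gp_vx gp_vx_other)
    then show ?thesis using F' a by (simp add: mult.assoc)
  qed
  show ?case
    using F a 1 2 vpath_V
    by (intro exI[of _ "insert v (insert w F)"])
      (simp add: distrib_left distrib_right scale_mult_left scale_mult_right)
qed

lemma unit_vspan: "F \<subseteq> V \<Longrightarrow> sum vx F \<in> vspan V"
  using mp_vspan[of _ "[]"] by (intro subspace_sum[OF subspace_vspan]) auto

text \<open>Ideals in the ring-theoretic sense know no scalars, but a scalar multiple of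
  \<open>x\<close> is the product of \<open>x\<close> with a scaled local unit.\<close>

lemma ideal_subspace:
  assumes I: "ideal I"
  shows "subspace I"
  unfolding subspace_def
proof (intro conjI ballI allI)
  fix c x assume x: "x \<in> I"
  then obtain F where F: "F \<subseteq> V" "sum vx F * x = x"
    using local_unit[of x] I unfolding ideal_iff by blast
  have "c *s x = (c *s sum vx F) * x" by (simp add: scale_mult_left F)
  moreover have "c *s sum vx F \<in> vspan V"
    using unit_vspan[OF F(1)] subspace_vspan by (simp add: subspace_scale)
  ultimately show "c *s x \<in> I" using I x by (simp add: ideal_iff)
qed (use I in \<open>auto simp: ideal_iff\<close>)

lemma ideal_mult: "ideal I \<Longrightarrow> x \<in> I \<Longrightarrow> a \<in> vspan V \<Longrightarrow> a * x \<in> I"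
  "ideal I \<Longrightarrow> x \<in> I \<Longrightarrow> a \<in> vspan V \<Longrightarrow> x * a \<in> I"
  by (auto simp: ideal_iff)

lemma nonzero_vertex:
  assumes "x \<in> vspan V" "x \<noteq> 0"
  shows "\<exists>v\<in>V. x * vx v \<noteq> 0"
proof (rule ccontr)
  assume "\<not> ?thesis"
  moreover obtain F where "F \<subseteq> V" "x * sum vx F = x" using local_unit[OF assms(1)] by blast
  ultimately show False using assms(2) by (auto simp: sum_distrib_left subset_eq)
qed

end

section \<open>Reduction to the path algebra\<close>

context leavitt begin

text \<open>A choice among the functionals of \<open>path_coeff\<close>. Its values are determined
  on the span of the paths into \<open>u\<close> and arbitrary elsewhere.\<close>

definition coeff :: "'v \<Rightarrow> 'e list \<Rightarrow> 'a \<Rightarrow> 'k" where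
  "coeff u q = (SOME g. (\<forall>x y. g (x + y) = g x + g y) \<and> (\<forall>c x. g (c *s x) = c * g x) \<and>
      (\<forall>p v. vpath v p u \<longrightarrow> g (mp p u) = (if p = q then 1 else 0)))"

lemma mp_foldr: "mp p u = foldr (\<lambda>e. (*) (ed e)) p (vx u)"
  by (induction p) auto

lemma coeff_props:
  "coeff u q (x + y) = coeff u q x + coeff u q y"
  "coeff u q (c *s x) = c * coeff u q x"
  "vpath v p u \<Longrightarrow> coeff u q (mp p u) = (if p = q then 1 else 0)"
proof -
  let ?P = "\<lambda>g. (\<forall>x y. g (x + y) = g x + g y) \<and> (\<forall>c x. g (c *s x) = c * g x) \<and>
      (\<forall>p v. vpath v p u \<longrightarrow> g (mp p u) = (if p = q then 1 else 0))"
  have "?P (coeff u q)"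
    using path_coeff[of u q] unfolding coeff_def mp_foldr[symmetric] by (rule someI_ex)
  then show "coeff u q (x + y) = coeff u q x + coeff u q y" "coeff u q (c *s x) = c * coeff u q x"
    "vpath v p u \<Longrightarrow> coeff u q (mp p u) = (if p = q then 1 else 0)" by blast+
qed

lemma coeff_zero [simp]: "coeff u q 0 = 0"
  using coeff_props(2)[of u q 0 0] by simp

lemma coeff_sum: "coeff u q (sum f A) = (\<Sum>i\<in>A. coeff u q (f i))"
  by (induction A rule: infinite_finite_induct) (auto simp: coeff_props)

lemma coeff_diff: "coeff u q (x - y) = coeff u q x - coeff u q y"
  using coeff_props(1)[of u q "x - y" y] by simp

lemma mp_nonzero: "vpath v p u \<Longrightarrow> mp p u \<noteq> 0"
  using coeff_props(3)[of v p u p] by auto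

lemma vx_nonzero: "v \<in> V \<Longrightarrow> vx v \<noteq> 0"
  using mp_nonzero[of v "[]" v] by simp

section \<open>The path algebra at a vertex\<close>

definition paths_to :: "'v \<Rightarrow> 'e list set" where
  "paths_to u = {p. \<exists>v. vpath v p u}"

definition path_span :: "'v \<Rightarrow> 'a set" where
  "path_span u = span ((\<lambda>p. mp p u) ` paths_to u)"

lemma mp_path_span: "vpath v p u \<Longrightarrow> mp p u \<in> path_span u"
  unfolding path_span_def by (rule span_base) (auto simp: paths_to_def)

lemma subspace_path_span: "subspace (path_span u)"
  by (simp add: path_span_def)

lemma path_span_repr:
  "x \<in> path_span u \<Longrightarrow> \<exists>S k. finite S \<and> S \<subseteq> paths_to u \<and> x = (\<Sum>p\<in>S. k p *s mp p u)"
  unfolding path_span_def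
proof (induction rule: span_induct_alt)
  case base
  then show ?case by (intro exI[of _ "{}"]) auto
next
  case (step c x y)
  then obtain q where q: "q \<in> paths_to u" "x = mp q u" by auto
  from step obtain S k where S: "finite S" "S \<subseteq> paths_to u" "y = (\<Sum>p\<in>S. k p *s mp p u)" by blast
  define k' where "k' p = (if p = q then c else 0) + (if p \<in> S then k p else 0)" for p
  have "(\<Sum>p\<in>insert q S. k' p *s mp p u)
      = (\<Sum>p\<in>insert q S. (if p = q then c *s mp q u else 0)) + (\<Sum>p\<in>insert q S. if p \<in> S then k p *s mp p u else 0)"
    unfolding sum.distrib[symmetric] by (intro sum.cong) (auto simp: k'_def scale_left_distrib)
  also have "(\<Sum>p\<in>insert q S. if p \<in> S then k p *s mp p u else 0) = y"
    unfolding S(3) by (rule sum.mono_neutral_cong_right) (use S in auto)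
  also have "(\<Sum>p\<in>insert q S. (if p = q then c *s mp q u else 0)) = c *s x"
    using S(1) q by (subst sum.delta) auto
  finally show ?case using S q by (intro exI[of _ "insert q S"] exI[of _ k']) auto
qed

lemma coeff_repr:
  assumes "finite S" "S \<subseteq> paths_to u"
  shows "coeff u q (\<Sum>p\<in>S. k p *s mp p u) = (if q \<in> S then k q else 0)"
proof -
  have "coeff u q (\<Sum>p\<in>S. k p *s mp p u) = (\<Sum>p\<in>S. if p = q then k q else 0)"
    unfolding coeff_sum using assms(2)
    by (intro sum.cong) (auto simp: coeff_props paths_to_def subset_eq)
  then show ?thesis using assms(1) by simp
qed

lemma path_span_zero:
  assumes "x \<in> path_span u" "\<And>q. q \<in> paths_to u \<Longrightarrow> coeff u q x = 0"
  shows "x = 0"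
proof -
  obtain S k where S: "finite S" "S \<subseteq> paths_to u" "x = (\<Sum>p\<in>S. k p *s mp p u)"
    using path_span_repr[OF assms(1)] by blast
  have "k p = 0" if "p \<in> S" for p
    using assms(2)[of p] that S(2) coeff_repr[OF S(1,2), of p k] by (auto simp: S(3))
  then show ?thesis by (simp add: S(3))
qed

lemma path_span_mult: "x \<in> path_span v \<Longrightarrow> vpath v t u \<Longrightarrow> x * mp t u \<in> path_span u"
  unfolding path_span_def[of v]
proof (induction rule: span_induct_alt)
  case base
  then show ?case using subspace_path_span by (simp add: subspace_0)
next
  case (step c x y)
  then obtain w p where p: "x = mp p v" "vpath w p v" by (auto simp: paths_to_def)
  have "x * mp t u = mp (p @ t) u" using p step by (simp add: mp_append[of w])
  moreover have "vpath w (p @ t) u" using p step by (auto simp: vpath_append)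
  ultimately have "x * mp t u \<in> path_span u" by (auto intro: mp_path_span)
  then show ?case using step subspace_path_span[of u]
    by (simp add: distrib_right scale_mult_left subspace_add subspace_scale)
qed

lemma coeff_mult_path:
  assumes t: "vpath v t u"
  shows "x \<in> path_span v \<Longrightarrow> coeff u (q @ t) (x * mp t u) = coeff v q x"
  unfolding path_span_def[of v]
proof (induction rule: span_induct_alt)
  case (step c x y)
  then obtain w p where p: "x = mp p v" "vpath w p v" by (auto simp: paths_to_def)
  have "x * mp t u = mp (p @ t) u" using p t by (simp add: mp_append[of w])
  moreover have "vpath w (p @ t) u" using p t by (auto simp: vpath_append)
  ultimately have "coeff u (q @ t) (x * mp t u) = coeff v q x"
    using p by (simp add: coeff_props(3)[of w])
  then show ?case using step by (simp add: distrib_right scale_mult_left coeff_props)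
qed simp

text \<open>Appending \<open>t\<close> sends distinct paths to distinct paths, so no coefficient is
  lost.\<close>

lemma right_cancel:
  assumes "x \<in> path_span v" "vpath v t u" "x * mp t u = 0"
  shows "x = 0"
  using coeff_mult_path[OF assms(2,1)] assms(3) by (intro path_span_zero[OF assms(1)]) (metis coeff_zero)

text \<open>The elements of \<open>L v\<close> whose ghost parts have length at most \<open>n\<close>.\<close>

definition bounded_span :: "nat \<Rightarrow> 'v \<Rightarrow> 'a set" where
  "bounded_span n v = span {mp p w * gp q w | p q w. p \<in> paths_to w \<and> vpath v q w \<and> length q \<le> n}"

lemma subspace_bounded_span: "subspace (bounded_span n v)"
  by (simp add: bounded_span_def)

lemma bounded_span_base: "vpath u p w \<Longrightarrow> vpath v q w \<Longrightarrow> length q \<le> n \<Longrightarrow> mp p w * gp q w \<in> bounded_span n v"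
  unfolding bounded_span_def by (rule span_base) (auto simp: paths_to_def)

lemma bounded_span_mono: "m \<le> n \<Longrightarrow> bounded_span m v \<subseteq> bounded_span n v"
  unfolding bounded_span_def by (rule span_mono) (blast intro: le_trans)

lemma bounded_span_vx:
  "x \<in> bounded_span n v \<Longrightarrow> x * vx v = x"
  unfolding bounded_span_def
  by (induction rule: span_induct_alt) (auto simp: distrib_right scale_mult_left mult.assoc gp_vx)

lemma vspan_bounded:
  "x \<in> vspan V \<Longrightarrow> v \<in> V \<Longrightarrow> \<exists>n. x * vx v \<in> bounded_span n v"
  unfolding vspan_def
proof (induction rule: span_induct_alt)
  case base
  then show ?case using subspace_bounded_span by (auto simp: subspace_0)
next
  case (step c a x)
  then obtain n where n: "x * vx v \<in> bounded_span n v" by blast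
  obtain p q u v' w where a: "a = mp p u * gp q u" "vpath v' p u" "vpath w q u"
    using step by (auto simp: monomials_def)
  have "a * vx v \<in> bounded_span (length q) v"
  proof (cases "v = w")
    case True
    then show ?thesis using a by (auto simp: mult.assoc gp_vx intro: bounded_span_base)
  next
    case False
    then show ?thesis using a step.prems subspace_bounded_span
      by (simp add: mult.assoc gp_vx_other[of w] subspace_0)
  qed
  then have "a * vx v \<in> bounded_span (max n (length q)) v" "x * vx v \<in> bounded_span (max n (length q)) v"
    using n bounded_span_mono by (meson max.cobounded1 max.cobounded2 subsetD)+
  then show ?case
    by (intro exI[of _ "max n (length q)"])
      (simp add: distrib_right scale_mult_left subspace_add subspace_scale subspace_bounded_span)
qed

text \<open>An edge on the right meets the last ghost factor, which it cancels or annihilates; where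
  there is no ghost factor, it extends the real path.\<close>

lemma bounded_span_ed:
  assumes e: "e \<in> Es" "s e = v"
  shows "x \<in> bounded_span (Suc n) v \<Longrightarrow> x * ed e \<in> bounded_span n (r e)"
  unfolding bounded_span_def[of "Suc n"]
proof (induction rule: span_induct_alt)
  case base
  then show ?case using subspace_bounded_span by (simp add: subspace_0)
next
  case (step c a x)
  then obtain u p q w where a: "a = mp p w * gp q w" "vpath u p w" "vpath v q w" "length q \<le> Suc n"
    by (auto simp: paths_to_def)
  have "a * ed e \<in> bounded_span n (r e)"
  proof (cases q)
    case Nil
    then have "a * ed e = mp p v * (vx v * ed e)" using a by (simp add: mult.assoc)
    also have "\<dots> = mp p v * mp [e] (r e)" using e s_ed[OF e(1)] by (simp add: ed_r)
    also have "\<dots> = mp (p @ [e]) (r e) * gp [] (r e)"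
    proof -
      have "vpath v [e] (r e)" using e target by auto
      then have "mp p v * mp [e] (r e) = mp (p @ [e]) (r e)" "vpath u (p @ [e]) (r e)"
        using a Nil by (auto simp: mp_append[of u] vpath_append)
      then show ?thesis by (simp only: gp.simps mp_vx)
    qed
    finally have "a * ed e = mp (p @ [e]) (r e) * gp [] (r e)" .
    moreover have "vpath u (p @ [e]) (r e)" "vpath (r e) [] (r e)"
      using a e Nil target by (auto simp: vpath_append)
    ultimately show ?thesis using bounded_span_base[of u "p @ [e]" "r e" "r e" "[]" n] by simp
  next
    case (Cons f q')
    then have f: "f \<in> Es" "vpath (r f) q' w" using a by auto
    have "a * ed e = mp p w * (gp q' w * (gh f * ed e))" using a Cons by (simp add: mult.assoc)
    also have "\<dots> = (if f = e then mp p w * gp q' w else 0)"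
      using f e by (auto simp: gh_ed gp_vx)
    finally show ?thesis
      using a Cons f subspace_bounded_span[of n "r e"] by (auto intro: bounded_span_base simp: subspace_0)
  qed
  then show ?case using step
    by (simp add: distrib_right scale_mult_left subspace_add subspace_scale subspace_bounded_span)
qed

lemma bounded_span_path_span:
  assumes "n = 0 \<or> (\<forall>e\<in>Es. s e \<noteq> v)"
  shows "bounded_span n v \<subseteq> path_span v"
  unfolding bounded_span_def
proof (rule span_minimal[OF _ subspace_path_span], safe)
  fix p q w assume "p \<in> paths_to w" and q: "vpath v q w" "length q \<le> n"
  moreover have "q = []" using assms q by (cases q) auto
  ultimately show "mp p w * gp q w \<in> path_span v"
    by (auto simp: paths_to_def mp_vx intro: mp_path_span)
qed

text \<open>Here \<open>x0\<close> collects the monomials without ghost edges and \<open>F\<close>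
  the edges at which the ghost parts of the others start. The final equation replaces the
  Cuntz-Krieger relation at \<open>v\<close>, which may fail to exist.\<close>

lemma bounded_span_split:
  "x \<in> bounded_span n v \<Longrightarrow> \<exists>F x0 x1. finite F \<and> F \<subseteq> {e \<in> Es. s e = v} \<and> x0 \<in> path_span v \<and> x = x0 + x1 \<and>
    (\<forall>e\<in>Es. s e = v \<longrightarrow> e \<notin> F \<longrightarrow> x1 * ed e = 0) \<and> x1 = (\<Sum>e\<in>F. x1 * ed e * gh e)"
  unfolding bounded_span_def
proof (induction rule: span_induct_alt)
  case base
  then show ?case using subspace_path_span
    by (intro exI[of _ "{}"] exI[of _ 0]) (auto simp: subspace_0)
next
  case (step c a x)
  then obtain F x0 x1 where F: "finite F" "F \<subseteq> {e \<in> Es. s e = v}" "x0 \<in> path_span v" "x = x0 + x1"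
    "\<forall>e\<in>Es. s e = v \<longrightarrow> e \<notin> F \<longrightarrow> x1 * ed e = 0" "x1 = (\<Sum>e\<in>F. x1 * ed e * gh e)" by blast
  obtain u p q w where a: "a = mp p w * gp q w" "vpath u p w" "vpath v q w"
    using step by (auto simp: paths_to_def)
  show ?case
  proof (cases q)
    case Nil
    then have "a \<in> path_span v" using a by (auto simp: mp_vx intro: mp_path_span)
    then have "c *s a + x0 \<in> path_span v"
      using F(3) by (simp add: subspace_add subspace_scale subspace_path_span)
    then show ?thesis using F
      by (intro exI[of _ F] exI[of _ "c *s a + x0"] exI[of _ x1]) (auto simp: add.assoc)
  next
    case (Cons f q')
    then have f: "f \<in> Es" "s f = v" "vpath (r f) q' w" using a by auto
    have ae: "a * ed e = (if f = e then mp p w * gp q' w else 0)" if "e \<in> Es" for e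
      using a Cons f that by (auto simp: mult.assoc gh_ed gp_vx)
    have "a * ed f * gh f = mp p w * gp q' w * gh f" using ae[OF f(1)] by simp
    then have af: "a * ed f * gh f = a" using a Cons by (simp add: mult.assoc)
    define y where "y = c *s a + x1"
    have y0: "y * ed e = 0" if "e \<in> Es" "s e = v" "e \<notin> insert f F" for e
      using that F ae[of e] by (auto simp: y_def distrib_right scale_mult_left)
    have aF: "(\<Sum>e\<in>insert f F. a * ed e * gh e) = a"
    proof -
      have "(\<Sum>e\<in>insert f F. a * ed e * gh e) = (\<Sum>e\<in>insert f F. if e = f then a else 0)"
        using F(2) ae af f by (intro sum.cong) auto
      then show ?thesis using F(1) by simp
    qed
    have xF: "(\<Sum>e\<in>insert f F. x1 * ed e * gh e) = x1"
      using F f by (cases "f \<in> F") (auto simp: insert_absorb)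
    have "y = (\<Sum>e\<in>insert f F. y * ed e * gh e)"
      unfolding y_def distrib_right sum.distrib scale_mult_left scale_sum_right[symmetric] aF xF ..
    moreover have "c *s a + x = x0 + y" using F by (simp add: y_def algebra_simps)
    moreover have "insert f F \<subseteq> {e \<in> Es. s e = v}" "finite (insert f F)" using F f by auto
    moreover have "\<forall>e\<in>Es. s e = v \<longrightarrow> e \<notin> insert f F \<longrightarrow> y * ed e = 0" using y0 by blast
    ultimately show ?thesis using F(3)
      by (intro exI[of _ "insert f F"] exI[of _ x0] exI[of _ y] conjI)
  qed
qed

text \<open>At an infinite emitter the Cuntz-Krieger relation is missing; there, an edge not occurring in
  the ghost parts detects the real part of an element.\<close>

lemma zero_if_edges_zero:
  assumes x: "x \<in> bounded_span n v" and e: "e \<in> Es" "s e = v"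
    and zero: "\<And>e. e \<in> Es \<Longrightarrow> s e = v \<Longrightarrow> x * ed e = 0"
  shows "x = 0"
proof (cases "finite {e \<in> Es. s e = v}")
  case True
  have "x = x * vx v" using bounded_span_vx[OF x] by simp
  also have "\<dots> = (\<Sum>e\<in>{e \<in> Es. s e = v}. x * ed e * gh e)"
    using True e source by (subst vx_sum) (auto simp: sum_distrib_left mult.assoc)
  also have "\<dots> = 0" using zero by simp
  finally show ?thesis .
next
  case False
  obtain F x0 x1 where F: "finite F" "F \<subseteq> {e \<in> Es. s e = v}" "x0 \<in> path_span v" "x = x0 + x1"
    "\<forall>e\<in>Es. s e = v \<longrightarrow> e \<notin> F \<longrightarrow> x1 * ed e = 0" "x1 = (\<Sum>e\<in>F. x1 * ed e * gh e)"
    using bounded_span_split[OF x] by blast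
  obtain f where f: "f \<in> Es" "s f = v" "f \<notin> F"
    using False F(1) by (metis (mono_tags, lifting) finite_subset mem_Collect_eq subsetI)
  have "x0 * ed f = 0" using F f zero[of f] by (simp add: distrib_right)
  then have "x0 = 0"
    using right_cancel[OF F(3), of "[f]" "r f"] f target by (simp add: ed_r)
  then have "x = (\<Sum>e\<in>F. x * ed e * gh e)" using F by simp
  also have "\<dots> = 0" using zero F(2) by (intro sum.neutral) auto
  finally show ?thesis .
qed

text \<open>Each edge lowers the bound on the ghost parts by one, and
  \<open>zero_if_edges_zero\<close> provides an edge that keeps the element nonzero. At a sink there
  are no ghost parts of positive length to begin with.\<close>

lemma bounded_span_reduce:
  "x \<in> bounded_span n v \<Longrightarrow> x \<noteq> 0 \<Longrightarrow> v \<in> V \<Longrightarrow> \<exists>q u. vpath v q u \<and> x * mp q u \<in> path_span u \<and> x * mp q u \<noteq> 0"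
proof (induction n arbitrary: x v)
  case 0
  then have "x * mp [] v \<in> path_span v"
    using bounded_span_path_span[of 0 v] bounded_span_vx[of x] by auto
  then show ?case using 0 by (intro exI[of _ "[]"] exI[of _ v]) (auto simp: bounded_span_vx)
next
  case (Suc n)
  show ?case
  proof (cases "\<exists>e\<in>Es. s e = v")
    case False
    then have "x * mp [] v \<in> path_span v"
      using bounded_span_path_span[of "Suc n" v] bounded_span_vx[of x] Suc.prems by auto
    then show ?thesis using Suc.prems by (intro exI[of _ "[]"] exI[of _ v]) (auto simp: bounded_span_vx)
  next
    case True
    then obtain e where e: "e \<in> Es" "s e = v" "x * ed e \<noteq> 0"
      using zero_if_edges_zero[OF Suc.prems(1)] Suc.prems(2) by blast
    then obtain q u where q: "vpath (r e) q u" "x * ed e * mp q u \<in> path_span u" "x * ed e * mp q u \<noteq> 0"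
      using Suc.IH[OF bounded_span_ed[OF e(1,2) Suc.prems(1)]] target by blast
    then show ?thesis using e by (intro exI[of _ "e # q"] exI[of _ u]) (auto simp: mult.assoc)
  qed
qed

text \<open>The trivial path is left out, so that \<open>vx u + y\<close> has coefficient 1 at it
  for every \<open>y\<close> in this span.\<close>

definition closed_span :: "'v \<Rightarrow> 'a set" where
  "closed_span u = span {mp p u | p. p \<noteq> [] \<and> vpath u p u}"

lemma subspace_closed_span: "subspace (closed_span u)"
  by (simp add: closed_span_def)

lemma closed_span_mult: "x \<in> closed_span u \<Longrightarrow> y \<in> closed_span u \<Longrightarrow> x * y \<in> closed_span u"
  unfolding closed_span_def[of u]
proof (rule span_mult)
  fix a b assume "a \<in> {mp p u | p. p \<noteq> [] \<and> vpath u p u}" "b \<in> {mp p u | p. p \<noteq> [] \<and> vpath u p u}"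
  then obtain p q where "a = mp p u" "b = mp q u" "p \<noteq> []" "vpath u p u" "vpath u q u" by blast
  then have "a * b = mp (p @ q) u" "p @ q \<noteq> []" "vpath u (p @ q) u"
    by (auto simp: mp_append[of u] vpath_append)
  then show "a * b \<in> span {mp p u | p. p \<noteq> [] \<and> vpath u p u}" by (intro span_base) blast
qed auto

lemma closed_span_coeff: "x \<in> closed_span u \<Longrightarrow> coeff u [] x = 0"
  unfolding closed_span_def
  by (induction rule: span_induct_alt) (auto simp: coeff_props)

lemma closed_span_vx: "x \<in> closed_span u \<Longrightarrow> vx u * x = x \<and> x * vx u = x"
  unfolding closed_span_def
  by (induction rule: span_induct_alt)
    (auto simp: distrib_left distrib_right scale_mult_left scale_mult_right vx_mp mp_vx)

lemma reduction:
  assumes I: "ideal I" and x: "x \<in> I" "x \<noteq> 0"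
  shows "\<exists>u\<in>V. \<exists>y\<in>closed_span u. vx u + y \<in> I"
proof -
  have xV: "x \<in> vspan V" using I x by (auto simp: ideal_iff)
  obtain v where v: "v \<in> V" "x * vx v \<noteq> 0" using nonzero_vertex[OF xV x(2)] by blast
  obtain n where "x * vx v \<in> bounded_span n v" using vspan_bounded[OF xV v(1)] by blast
  then obtain q u where q: "vpath v q u" "x * vx v * mp q u \<in> path_span u" "x * vx v * mp q u \<noteq> 0"
    using bounded_span_reduce v by blast
  define b where "b = x * vx v * mp q u"
  have bI: "b \<in> I"
    using I x q v mp_vspan[of v "[]" v V] mp_vspan[OF q(1), of V] vpath_V[OF q(1)]
    unfolding b_def by (auto intro!: ideal_mult)
  obtain S k where S: "finite S" "S \<subseteq> paths_to u" "b = (\<Sum>p\<in>S. k p *s mp p u)"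
    using path_span_repr[OF q(2)[folded b_def]] by blast
  define S' where "S' = {p \<in> S. k p \<noteq> 0}"
  have b: "b = (\<Sum>p\<in>S'. k p *s mp p u)"
    unfolding S(3) S'_def by (rule sum.mono_neutral_right) (use S in auto)
  have "S' \<noteq> {}" using q(3) b by (auto simp: b_def[symmetric])
  \<comment> \<open>A shortest path of the support: its ghost turns any other path of the support
    into a nontrivial closed path or into zero, never into a ghost path.\<close>
  then obtain p0 where p0: "p0 \<in> S'" "\<And>p. p \<in> S' \<Longrightarrow> length p0 \<le> length p"
    using ex_has_least_nat[of "\<lambda>p. p \<in> S'" _ length] by blast
  then have "p0 \<in> paths_to u" "k p0 \<noteq> 0" using S(2) by (auto simp: S'_def)
  then obtain w where w: "vpath w p0 u" by (auto simp: paths_to_def)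
  have other: "gp p0 u * mp p u \<in> closed_span u" if p: "p \<in> S' - {p0}" for p
  proof -
    obtain w' where w': "vpath w' p u" using p S by (auto simp: S'_def paths_to_def subset_eq)
    from w w' show ?thesis
    proof (cases rule: gp_mp_cases)
      case (longer t)
      then show ?thesis using p unfolding closed_span_def by (intro span_base) auto
    next
      case (shorter t)
      then show ?thesis using p0(2)[of p] p by auto
    next
      case other
      then show ?thesis using subspace_closed_span by (simp add: subspace_0)
    qed
  qed
  define y where "y = (\<Sum>p\<in>S' - {p0}. (inverse (k p0) * k p) *s (gp p0 u * mp p u))"
  have y: "y \<in> closed_span u"
    unfolding y_def using other subspace_closed_span by (intro subspace_sum) (auto intro: subspace_scale)
  have "gp p0 u * b = (\<Sum>p\<in>S'. k p *s (gp p0 u * mp p u))"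
    unfolding b sum_distrib_left scale_mult_right ..
  then have "inverse (k p0) *s (gp p0 u * b) = (\<Sum>p\<in>S'. (inverse (k p0) * k p) *s (gp p0 u * mp p u))"
    by (simp add: scale_sum_right)
  also have "\<dots> = (inverse (k p0) * k p0) *s (gp p0 u * mp p0 u) + y"
    unfolding y_def using S p0 by (intro sum.remove) (auto simp: S'_def)
  also have "\<dots> = vx u + y"
    using \<open>k p0 \<noteq> 0\<close> gp_mp[OF w] by simp
  finally have "vx u + y = inverse (k p0) *s (gp p0 u * b)" by simp
  moreover have "gp p0 u * b \<in> I" using I bI gp_vspan[OF w, of V] vpath_V[OF w] by (auto intro: ideal_mult)
  ultimately have "vx u + y \<in> I" using ideal_subspace[OF I] by (simp add: subspace_scale)
  then show ?thesis using y vpath_V[OF w] by blast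
qed

text \<open>The square of \<open>vx u + y\<close> again has coefficient 1 at the trivial path, so an
  ideal with zero products cannot contain such an element.\<close>

lemma semiprime:
  assumes I: "ideal I" and zero: "\<And>x y. x \<in> I \<Longrightarrow> y \<in> I \<Longrightarrow> x * y = 0"
  shows "I = {0}"
proof (rule ccontr)
  assume "I \<noteq> {0}"
  then obtain x where "x \<in> I" "x \<noteq> 0" using I by (auto simp: ideal_iff)
  then obtain u y where u: "u \<in> V" "y \<in> closed_span u" "vx u + y \<in> I"
    using reduction[OF I] by blast
  have "(vx u + y) * (vx u + y) = vx u + (y + y + y * y)"
    using u closed_span_vx[OF u(2)] by (simp add: distrib_left distrib_right vx_vx add.assoc)
  moreover have "y + y + y * y \<in> closed_span u"
    using u(2) subspace_closed_span by (auto intro: subspace_add closed_span_mult)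
  ultimately have "coeff u [] ((vx u + y) * (vx u + y)) = coeff u [] (vx u)"
    by (metis coeff_props(1) closed_span_coeff add.right_neutral)
  also have "\<dots> = 1" using coeff_props(3)[of u "[]" u "[]"] u(1) by simp
  finally have "coeff u [] ((vx u + y) * (vx u + y)) = 1" .
  then show False using zero[OF u(3) u(3)] by simp
qed

end

section \<open>Paths and cycles\<close>

context digraph begin

lemma vpath_nonempty: "vpath v p u \<Longrightarrow> p \<noteq> [] \<Longrightarrow> s (hd p) = v \<and> r (last p) = u"
  by (induction p arbitrary: v) auto

lemma vpath_split_nth:
  assumes "vpath v p u" "i < length p"
  shows "vpath v (take i p) (s (p ! i))" "vpath (s (p ! i)) (drop i p) u"
proof -
  obtain w where w: "vpath v (take i p) w" "vpath w (drop i p) u"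
    using assms(1) vpath_append[of v "take i p" "drop i p" u] by auto
  moreover have "drop i p \<noteq> []" "hd (drop i p) = p ! i" using assms(2) by (auto simp: hd_drop_conv_nth)
  ultimately have "w = s (p ! i)" using vpath_nonempty by metis
  then show "vpath v (take i p) (s (p ! i))" "vpath (s (p ! i)) (drop i p) u" using w by auto
qed

lemma is_path_Cons:
  "is_path Es s r (e # p) \<longleftrightarrow> e \<in> Es \<and> (p = [] \<or> is_path Es s r p \<and> r e = s (hd p))"
proof (cases p)
  case (Cons f q)
  have "(\<forall>i. Suc i < length (e # p) \<longrightarrow> r ((e # p) ! i) = s ((e # p) ! Suc i)) \<longleftrightarrow>
      r e = s f \<and> (\<forall>i. Suc i < length p \<longrightarrow> r (p ! i) = s (p ! Suc i))"
    using Cons by (auto simp: nth_Cons split: nat.splits)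
  then show ?thesis using Cons by (auto simp: is_path_def)
qed (simp add: is_path_def)

lemma is_path_iff: "is_path Es s r p \<longleftrightarrow> p \<noteq> [] \<and> vpath (s (hd p)) p (r (last p))"
proof (induction p)
  case (Cons e p)
  then show ?case by (cases p) (auto simp: is_path_Cons target)
qed (simp add: is_path_def)

lemma reaches_iff:
  assumes "u \<in> V"
  shows "reaches Es s r u w \<longleftrightarrow> (\<exists>p. vpath u p w)"
proof
  assume "reaches Es s r u w"
  then show "\<exists>p. vpath u p w"
    unfolding reaches_def
  proof (induction rule: rtrancl_induct)
    case base
    show ?case using assms by (intro exI[of _ "[]"]) simp
  next
    case (step y z)
    then obtain e p where "e \<in> Es" "s e = y" "r e = z" "vpath u p y" by (auto simp: edge_rel_def)
    then show ?case by (intro exI[of _ "p @ [e]"]) (auto simp: vpath_append target)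
  qed
next
  assume "\<exists>p. vpath u p w"
  then obtain p where "vpath u p w" ..
  then show "reaches Es s r u w"
    unfolding reaches_def
    by (induction p arbitrary: u) (auto simp: edge_rel_def intro: converse_rtrancl_into_rtrancl)
qed

lemma mem_RR: "u \<in> RR V Es s r W \<longleftrightarrow> (\<exists>w\<in>W. \<exists>p. vpath u p w)"
  unfolding RR_def using reaches_iff vpath_V by blast

lemma hereditary_compl_RR: "hereditary (V - RR V Es s r W)"
  unfolding hereditary_def
proof (intro conjI ballI impI)
  fix e assume e: "e \<in> Es" "s e \<in> V - RR V Es s r W"
  have "r e \<notin> RR V Es s r W"
  proof
    assume "r e \<in> RR V Es s r W"
    then obtain w p where "w \<in> W" "vpath (r e) p w" by (auto simp: mem_RR)
    then have "w \<in> W" "vpath (s e) (e # p) w" using e by auto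
    then have "s e \<in> RR V Es s r W" unfolding mem_RR by blast
    then show False using e by simp
  qed
  then show "r e \<in> V - RR V Es s r W" using e target by auto
qed auto

abbreviation "cycle \<equiv> is_cycle Es s r"

lemma cycle_vpath: "cycle c \<Longrightarrow> vpath (s (hd c)) c (s (hd c))"
  by (auto simp: is_cycle_def is_path_iff)

lemma cycle_nonempty: "cycle c \<Longrightarrow> c \<noteq> []"
  by (simp add: is_cycle_def is_path_def)

lemma hd_cycle_verts: "cycle c \<Longrightarrow> s (hd c) \<in> cycle_verts s c"
  by (auto simp: cycle_verts_def dest: cycle_nonempty)

lemma cycle_verts_vpath:
  assumes "cycle c" "x \<in> cycle_verts s c" "y \<in> cycle_verts s c"
  shows "\<exists>p. vpath x p y"
proof -
  have "(\<exists>p. vpath (s (hd c)) p z) \<and> (\<exists>p. vpath z p (s (hd c)))" if z: "z \<in> cycle_verts s c" for z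
  proof -
    obtain i where "i < length c" "z = s (c ! i)"
      using z by (auto simp: cycle_verts_def in_set_conv_nth)
    then show ?thesis using vpath_split_nth[OF cycle_vpath[OF assms(1)]] by blast
  qed
  then show ?thesis using assms(2,3) vpath_append by blast
qed

text \<open>A shortest nontrivial closed path at \<open>u\<close> works. If a source occurred twice,
  dropping the segment between the two visits would leave a shorter closed path, still nonempty
  since the second visit is followed by an edge.\<close>

lemma closed_path_cycle:
  assumes "vpath u p u" "p \<noteq> []"
  shows "\<exists>c. cycle c \<and> s (hd c) = u"
proof -
  obtain c where c: "vpath u c u" "c \<noteq> []"
    and least: "\<And>q. vpath u q u \<Longrightarrow> q \<noteq> [] \<Longrightarrow> length c \<le> length q"
    using ex_has_least_nat[of "\<lambda>q. vpath u q u \<and> q \<noteq> []" p length] assms by blast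
  have "s (c ! i) \<noteq> s (c ! j)" if "i < j" "j < length c" for i j
  proof
    assume eq: "s (c ! i) = s (c ! j)"
    have "vpath u (take i c @ drop j c) u"
      using vpath_split_nth[OF c(1), of i] vpath_split_nth[OF c(1), of j] that eq
      by (auto simp: vpath_append)
    moreover have "take i c @ drop j c \<noteq> []" using that by auto
    ultimately show False using least[of "take i c @ drop j c"] that by auto
  qed
  then have "distinct (map s c)"
    unfolding distinct_conv_nth by (metis length_map linorder_neqE_nat nth_map)
  then show ?thesis
    using c vpath_nonempty[OF c] by (intro exI[of _ c]) (auto simp: is_cycle_def is_path_iff)
qed

text \<open>Being extreme only leads back to some vertex of the cycle; from there the cycle itself
  leads on to \<open>x\<close>.\<close>

lemma extremeD:
  assumes "cycle c" "is_extreme Es s r c" "x \<in> cycle_verts s c" "vpath x p y"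
  shows "\<exists>q. vpath y q x"
proof (cases "p = []")
  case True
  then show ?thesis using assms(4) by (intro exI[of _ "[]"]) auto
next
  case False
  then have p: "is_path Es s r p" "s (hd p) \<in> cycle_verts s c" "r (last p) = y"
    using assms vpath_nonempty[OF assms(4)] by (auto simp: is_path_iff)
  then obtain w where "w \<in> cycle_verts s c" "reaches Es s r y w"
    using assms(2) unfolding is_extreme_def by blast
  then obtain q where "vpath y q w" using reaches_iff vpath_V[OF assms(4)] by auto
  then show ?thesis
    using cycle_verts_vpath[OF assms(1) \<open>w \<in> _\<close> assms(3)] vpath_append by blast
qed

lemma inf_path_vpath:
  "is_inf_path Es s r \<alpha> \<Longrightarrow> \<exists>p. vpath (s (\<alpha> i)) p (s (\<alpha> (i + n))) \<and> length p = n"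
proof (induction n)
  case 0
  then show ?case by (intro exI[of _ "[]"]) (simp add: is_inf_path_def source)
next
  case (Suc n)
  then obtain p where "vpath (s (\<alpha> i)) p (s (\<alpha> (i + n)))" "length p = n" by blast
  then show ?case using Suc.prems
    by (intro exI[of _ "p @ [\<alpha> (i + n)]"]) (auto simp: vpath_append is_inf_path_def source)
qed

text \<open>If the hereditary saturated set \<open>H'\<close> missed a vertex, then outside \<open>H'\<close> one could follow an
  infinite path, always decreasing the distance to vertices with an edge into \<open>H'\<close>. By finiteness
  such a vertex is visited twice, so that it lies on a cycle; the edge into \<open>H'\<close> shows that this
  cycle is not extreme.\<close>

lemma hereditary_saturated_cover:
  assumes SAR: "strongly_all_reflexive V Es s r"
    and H: "hereditary H" and H': "hereditary H'" "H \<subseteq> H'" "V - RR V Es s r H \<subseteq> H'"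
    and sat: "\<And>v. v \<in> V \<Longrightarrow> finite {e \<in> Es. s e = v} \<Longrightarrow> {e \<in> Es. s e = v} \<noteq> {} \<Longrightarrow>
      (\<And>e. e \<in> Es \<Longrightarrow> s e = v \<Longrightarrow> r e \<in> H') \<Longrightarrow> v \<in> H'"
  shows "H' = V"
proof (rule ccontr)
  assume "H' \<noteq> V"
  define U where "U = V - H'"
  have extreme: "is_extreme Es s r c" if "cycle c" for c
    using SAR that by (auto simp: strongly_all_reflexive_def all_reflexive_def)
  obtain v0 where v0: "v0 \<in> U" using \<open>H' \<noteq> V\<close> H'(1) by (auto simp: U_def hereditary_def)
  have U_path: "v \<in> U" if "vpath v p u" "u \<in> U" for v p u
    using that vpath_hereditary[OF that(1) H'(1)] vpath_V[OF that(1)] by (auto simp: U_def)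
  have to_H: "\<exists>p h. vpath v p h \<and> h \<in> H" if "v \<in> U" for v
    using that H'(3) mem_RR[of v H] by (auto simp: U_def)
  define Esc where "Esc = {u \<in> U. \<exists>f\<in>Es. s f = u \<and> r f \<in> H'}"
  have to_Esc: "\<exists>p u. vpath v p u \<and> u \<in> Esc" if "v \<in> U" for v
  proof -
    have "\<exists>q u. vpath v q u \<and> u \<in> Esc" if "vpath v p h" "v \<in> U" "h \<in> H" for p h v
      using that
    proof (induction p arbitrary: v)
      case Nil
      then show ?case using H'(2) by (auto simp: U_def)
    next
      case (Cons e p)
      show ?case
      proof (cases "r e \<in> U")
        case True
        then obtain q u where "vpath (r e) q u" "u \<in> Esc"
          using Cons.IH[of "r e"] Cons.prems by auto
        then show ?thesis using Cons.prems by (intro exI[of _ "e # q"] exI[of _ u]) auto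
      next
        case False
        then have "v \<in> Esc" using Cons.prems target by (auto simp: Esc_def U_def)
        then show ?thesis using Cons.prems by (intro exI[of _ "[]"] exI[of _ v]) (auto simp: U_def)
      qed
    qed
    then show ?thesis using to_H that by blast
  qed
  have stay: "\<exists>e\<in>Es. s e = v \<and> r e \<in> U" if v: "v \<in> U" for v
  proof -
    obtain p h where p: "vpath v p h" "h \<in> H" using to_H[OF v] by blast
    have "p \<noteq> []" using p v H'(2) by (auto simp: U_def)
    then have ne: "{e \<in> Es. s e = v} \<noteq> {}" using p by (cases p) auto
    \<comment> \<open>An infinite emitter lies on an extreme cycle, so there would be a way back
      from \<open>h\<close> to \<open>v\<close>, and the hereditary set \<open>H\<close> would
      contain \<open>v\<close>.\<close>
    have "finite {e \<in> Es. s e = v}"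
    proof (rule ccontr)
      assume "infinite {e \<in> Es. s e = v}"
      then obtain c where c: "cycle c" "v \<in> cycle_verts s c"
        using SAR v by (auto simp: strongly_all_reflexive_def all_reflexive_def U_def)
      then obtain q where "vpath h q v" using extremeD[OF c(1) extreme[OF c(1)] c(2) p(1)] by blast
      then have "v \<in> H" using vpath_hereditary H p(2) by blast
      then show False using v H'(2) by (auto simp: U_def)
    qed
    then show ?thesis using sat[of v] ne v target by (auto simp: U_def)
  qed
  define D where "D v = (LEAST n. \<exists>p u. vpath v p u \<and> u \<in> Esc \<and> length p = n)" for v
  have D: "\<exists>p u. vpath v p u \<and> u \<in> Esc \<and> length p = D v" if v: "v \<in> U" for v
  proof -
    obtain p u where "vpath v p u" "u \<in> Esc" using to_Esc[OF v] by blast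
    then have "\<exists>n p u. vpath v p u \<and> u \<in> Esc \<and> length p = n" by blast
    then show ?thesis unfolding D_def by (rule LeastI_ex)
  qed
  have D_le: "D v \<le> length p" if "vpath v p u" "u \<in> Esc" for v p u
    unfolding D_def by (rule Least_le) (use that in blast)
  \<comment> \<open>On \<open>Esc\<close> any edge that stays in \<open>U\<close> will do. Elsewhere
    take the first edge of a shortest path to \<open>Esc\<close>; it stays in \<open>U\<close>
    because every vertex that reaches \<open>U\<close> lies in \<open>U\<close>.\<close>
  have "\<exists>e. e \<in> Es \<and> s e = v \<and> r e \<in> U \<and> (v \<notin> Esc \<longrightarrow> D (r e) < D v)" if v: "v \<in> U" for v
  proof (cases "v \<in> Esc")
    case True
    then show ?thesis using stay[OF v] by blast
  next
    case False
    obtain p u where p: "vpath v p u" "u \<in> Esc" "length p = D v" using D[OF v] by blast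
    then obtain e q where q: "p = e # q" using False by (cases p) auto
    then have e: "e \<in> Es" "s e = v" "vpath (r e) q u" using p by auto
    have "r e \<in> U" using U_path[OF e(3)] p(2) by (auto simp: Esc_def)
    moreover have "D (r e) < D v" using D_le[OF e(3) p(2)] p(3) q by simp
    ultimately show ?thesis using e by blast
  qed
  then obtain nx where nx: "\<And>v. v \<in> U \<Longrightarrow> nx v \<in> Es \<and> s (nx v) = v \<and> r (nx v) \<in> U \<and>
      (v \<notin> Esc \<longrightarrow> D (r (nx v)) < D v)" by metis
  define vs where "vs i = ((\<lambda>v. r (nx v)) ^^ i) v0" for i
  have vs_Suc: "vs (Suc i) = r (nx (vs i))" for i by (simp add: vs_def)
  have vs_U: "vs i \<in> U" for i by (induction i) (auto simp: vs_Suc nx, simp add: vs_def v0)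
  define \<alpha> where "\<alpha> i = nx (vs i)" for i
  have s\<alpha>: "s (\<alpha> i) = vs i" for i using nx[OF vs_U] by (simp add: \<alpha>_def)
  have \<alpha>: "is_inf_path Es s r \<alpha>"
    unfolding is_inf_path_def s\<alpha> vs_Suc using nx[OF vs_U] by (simp add: \<alpha>_def)
  have verts: "inf_path_verts s \<alpha> = range vs" by (simp add: inf_path_verts_def s\<alpha>)
  have cofinal: "\<exists>j\<ge>i. vs j \<in> Esc" for i
  proof (induction "D (vs i)" arbitrary: i rule: less_induct)
    case less
    show ?case
    proof (cases "vs i \<in> Esc")
      case False
      then have "D (vs (Suc i)) < D (vs i)" using nx[OF vs_U] by (simp add: vs_Suc)
      then show ?thesis using less[of "Suc i"] Suc_leD by blast
    qed auto
  qed
  have inf: "infinite {j. vs j \<in> Esc}"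
  proof
    assume "finite {j. vs j \<in> Esc}"
    then obtain m where "\<forall>j\<in>{j. vs j \<in> Esc}. j \<le> m" unfolding finite_nat_set_iff_bounded_le ..
    then show False using cofinal[of "Suc m"] by fastforce
  qed
  define g where "g u = (SOME f. f \<in> Es \<and> s f = u \<and> r f \<in> H')" for u
  have g: "g u \<in> Es \<and> s (g u) = u \<and> r (g u) \<in> H'" if "u \<in> Esc" for u
    unfolding g_def by (rule someI_ex) (use that in \<open>auto simp: Esc_def\<close>)
  let ?X = "{e \<in> Es. s e \<in> inf_path_verts s \<alpha> \<and> r e \<notin> RR V Es s r (inf_path_verts s \<alpha>)}"
  have "finite ?X" using SAR \<alpha> by (simp add: strongly_all_reflexive_def all_reflexive_def)
  moreover have "(\<lambda>j. g (vs j)) ` {j. vs j \<in> Esc} \<subseteq> ?X"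
  proof (intro image_subsetI)
    fix j assume "j \<in> {j. vs j \<in> Esc}"
    then have gj: "g (vs j) \<in> Es" "s (g (vs j)) = vs j" "r (g (vs j)) \<in> H'" using g by auto
    \<comment> \<open>The hereditary set \<open>H'\<close> is disjoint from the infinite path, so an
      edge into \<open>H'\<close> can never return to it and is counted in condition (c).\<close>
    have "r (g (vs j)) \<notin> RR V Es s r (range vs)"
    proof
      assume "r (g (vs j)) \<in> RR V Es s r (range vs)"
      then obtain i p where "vpath (r (g (vs j))) p (vs i)" by (auto simp: mem_RR)
      then have "vs i \<in> H'" using vpath_hereditary H'(1) gj(3) by blast
      then show False using vs_U[of i] by (simp add: U_def)
    qed
    then show "g (vs j) \<in> ?X" using gj by (auto simp: verts)
  qed
  \<comment> \<open>Infinitely many visits to \<open>Esc\<close> share finitely many escaping edges,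
    and a common edge means a common vertex.\<close>
  ultimately have "\<not> inj_on (\<lambda>j. g (vs j)) {j. vs j \<in> Esc}"
    using inf finite_imageD finite_subset by blast
  then obtain i j where ij: "i < j" "vs i \<in> Esc" "vs j \<in> Esc" "g (vs i) = g (vs j)"
    unfolding inj_on_def by (metis (mono_tags, lifting) linorder_neqE_nat mem_Collect_eq)
  then have eq: "vs i = vs j" using g by metis
  obtain p where "vpath (vs i) p (vs j)" "length p = j - i"
    using inf_path_vpath[OF \<alpha>, of i "j - i"] ij(1) by (auto simp: s\<alpha>)
  then have "vpath (vs i) p (vs i)" "p \<noteq> []" using eq ij(1) by auto
  then obtain c where c: "cycle c" "s (hd c) = vs i" using closed_path_cycle by blast
  have "vpath (vs i) [g (vs i)] (r (g (vs i)))" using g[OF ij(2)] target by auto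
  then obtain q where "vpath (r (g (vs i))) q (vs i)"
    using extremeD[OF c(1) extreme[OF c(1)]] hd_cycle_verts[OF c(1)] c(2) by metis
  then have "vs i \<in> H'" using vpath_hereditary H'(1) g[OF ij(2)] by blast
  then show False using vs_U[of i] by (simp add: U_def)
qed

end

section \<open>Complemented ideals\<close>

context leavitt begin

definition isum :: "'a set \<Rightarrow> 'a set \<Rightarrow> 'a set" where
  "isum A B = {a + b | a b. a \<in> A \<and> b \<in> B}"

lemma isum_commute: "isum A B = isum B A"
  unfolding isum_def by (metis add.commute)

lemma mem_isum: "x \<in> isum A B \<longleftrightarrow> (\<exists>a\<in>A. \<exists>b\<in>B. x = a + b)"
  by (auto simp: isum_def)

definition complemented :: bool where
  "complemented \<longleftrightarrow> (\<forall>I. ideal I \<longrightarrow> (\<exists>B. ideal B \<and> I \<inter> B = {0} \<and> isum I B = vspan V))"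

lemma complementedE:
  assumes complemented "ideal I"
  obtains B where "ideal B" "I \<inter> B = {0}" "isum I B = vspan V"
  using assms by (auto simp: complemented_def)

lemma mem_ann: "a \<in> ann leavitt_ring I \<longleftrightarrow> a \<in> vspan V \<and> (\<forall>x\<in>I. a * x = 0 \<and> x * a = 0)"
  by (simp add: ann_def leavitt_ring_def)

lemma vspan_V_closed:
  "x \<in> vspan V \<Longrightarrow> y \<in> vspan V \<Longrightarrow> x + y \<in> vspan V"
  "x \<in> vspan V \<Longrightarrow> y \<in> vspan V \<Longrightarrow> x - y \<in> vspan V"
  "x \<in> vspan V \<Longrightarrow> y \<in> vspan V \<Longrightarrow> x * y \<in> vspan V"
  "x \<in> vspan V \<Longrightarrow> - x \<in> vspan V" "0 \<in> vspan V"
  using ideal_vspan[OF hereditary_V] subspace_vspan[of V]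
  by (auto simp: ideal_iff subspace_diff)

lemma ideal_ann:
  assumes I: "ideal I"
  shows "ideal (ann leavitt_ring I)"
  unfolding ideal_iff
proof (intro conjI ballI)
  fix a x assume ax: "a \<in> vspan V" "x \<in> ann leavitt_ring I"
  have "a * x * y = 0 \<and> y * (a * x) = 0 \<and> x * a * y = 0 \<and> y * (x * a) = 0" if y: "y \<in> I" for y
  proof -
    have "y * a \<in> I" "a * y \<in> I" using ideal_mult[OF I y ax(1)] by auto
    then have "x * y = 0" "y * x = 0" "(y * a) * x = 0" "x * (a * y) = 0"
      using ax(2) y by (auto simp: mem_ann)
    then show ?thesis by (metis mult.assoc mult_zero_left mult_zero_right)
  qed
  then show "a * x \<in> ann leavitt_ring I" "x * a \<in> ann leavitt_ring I"
    using ax by (auto simp: mem_ann vspan_V_closed)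
qed (auto simp: mem_ann vspan_V_closed distrib_left distrib_right)

lemma ideal_isum:
  assumes A: "ideal A" and B: "ideal B"
  shows "ideal (isum A B)"
  unfolding ideal_iff
proof (intro conjI ballI)
  show "isum A B \<subseteq> vspan V" using A B vspan_V_closed(1) by (auto simp: isum_def ideal_iff)
  have "0 \<in> A" "0 \<in> B" using A B by (auto simp: ideal_iff)
  then show "0 \<in> isum A B" unfolding isum_def by (intro CollectI exI[of _ 0] conjI) auto
next
  fix x y assume "x \<in> isum A B" "y \<in> isum A B"
  then obtain a b a' b' where "x = a + b" "y = a' + b'" "a \<in> A" "a' \<in> A" "b \<in> B" "b' \<in> B"
    by (auto simp: isum_def)
  moreover from this have "x + y = (a + a') + (b + b')" by (simp add: ac_simps)
  moreover have "a + a' \<in> A" "b + b' \<in> B" using A B calculation by (auto simp: ideal_iff)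
  ultimately show "x + y \<in> isum A B" unfolding isum_def by blast
next
  fix x assume "x \<in> isum A B"
  then obtain a b where "x = a + b" "a \<in> A" "b \<in> B" by (auto simp: isum_def)
  moreover from this have "- x = - a + - b" by simp
  moreover have "- a \<in> A" "- b \<in> B" using A B calculation by (auto simp: ideal_iff)
  ultimately show "- x \<in> isum A B" unfolding isum_def by blast
next
  fix c x assume c: "c \<in> vspan V" and "x \<in> isum A B"
  then obtain a b where x: "x = a + b" "a \<in> A" "b \<in> B" by (auto simp: isum_def)
  have "c * x = c * a + c * b" "x * c = a * c + b * c" using x by (simp_all add: distrib_left distrib_right)
  then show "c * x \<in> isum A B" "x * c \<in> isum A B"
    using ideal_mult[OF A x(2) c] ideal_mult[OF B x(3) c] unfolding isum_def by blast+
qed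

lemma isum_superset: "ideal A \<Longrightarrow> ideal B \<Longrightarrow> A \<subseteq> isum A B \<and> B \<subseteq> isum A B"
proof (intro conjI subsetI)
  assume "ideal A" "ideal B"
  then have 0: "0 \<in> A" "0 \<in> B" by (auto simp: ideal_iff)
  show "x \<in> isum A B" if "x \<in> A" for x
    unfolding isum_def using that 0 by (intro CollectI exI[of _ x] exI[of _ 0]) simp
  show "x \<in> isum A B" if "x \<in> B" for x
    unfolding isum_def using that 0 by (intro CollectI exI[of _ 0] exI[of _ x]) simp
qed

lemma ideal_join_isum:
  assumes A: "ideal A" and B: "ideal B"
  shows "ideal_join leavitt_ring A B = isum A B"
proof
  show "ideal_join leavitt_ring A B \<subseteq> isum A B"
    unfolding ideal_join_def using ideal_isum[OF A B] isum_superset[OF A B] by blast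
  show "isum A B \<subseteq> ideal_join leavitt_ring A B"
    unfolding ideal_join_def isum_def
  proof safe
    fix a b X assume "a \<in> A" "b \<in> B" "ideal X" "A \<union> B \<subseteq> X"
    then show "a + b \<in> X" unfolding ideal_iff by blast
  qed
qed

lemma ideal_Int: "ideal A \<Longrightarrow> ideal B \<Longrightarrow> ideal (A \<inter> B)"
  by (auto simp: ideal_iff)

lemma ideal_disjoint_mult:
  assumes "ideal A" "ideal B" "A \<inter> B = {0}" "a \<in> A" "b \<in> B"
  shows "a * b = 0"
proof -
  have "a \<in> vspan V" "b \<in> vspan V" using assms by (auto simp: ideal_iff)
  then have "a * b \<in> A \<inter> B" using assms by (auto intro: ideal_mult)
  then show ?thesis using assms(3) by simp
qed

text \<open>For \<open>x\<close> in the annihilator of \<open>A\<close>, split a local unit of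
  \<open>x\<close> along \<open>A\<close> and \<open>B\<close>: only the part in \<open>B\<close>
  contributes to the product with \<open>x\<close>.\<close>

lemma complement_unique_ann:
  assumes A: "ideal A" and B: "ideal B" and AB: "A \<inter> B = {0}"
    and sum: "isum A B = vspan V"
  shows "ann leavitt_ring A = B"
proof
  show "B \<subseteq> ann leavitt_ring A"
    using ideal_disjoint_mult[OF A B AB] ideal_disjoint_mult[OF B A] AB B
    by (auto simp: mem_ann ideal_iff Int_commute)
  show "ann leavitt_ring A \<subseteq> B"
  proof
    fix x assume x: "x \<in> ann leavitt_ring A"
    then have xV: "x \<in> vspan V" by (simp add: mem_ann)
    obtain F where F: "F \<subseteq> V" "x * sum vx F = x" using local_unit[OF xV] by blast
    obtain a b where ab: "a \<in> A" "b \<in> B" "sum vx F = a + b" 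
      using unit_vspan[OF F(1)] unfolding sum[symmetric] mem_isum by blast
    have "x = x * a + x * b" using F(2) ab(3) by (simp add: distrib_left)
    also have "x * a = 0" using x ab(1) by (simp add: mem_ann)
    finally show "x \<in> B" using ideal_mult(1)[OF B ab(2) xV] by simp
  qed
qed

text \<open>For the converse direction, whatever annihilates \<open>I + ann I\<close> lies both in
  \<open>ann I\<close> and in its annihilator, hence is zero. The double annihilator of
  \<open>I + ann I\<close> is then the whole algebra, and by assumption it equals
  \<open>I + ann I\<close>.\<close>

lemma ann_ann_iff_complemented:
  "(\<forall>I. ideal I \<longrightarrow> ann leavitt_ring (ann leavitt_ring I) = I) \<longleftrightarrow> complemented"
proof
  assume C: complemented
  show "\<forall>I. ideal I \<longrightarrow> ann leavitt_ring (ann leavitt_ring I) = I"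
  proof (intro allI impI)
    fix I assume I: "ideal I"
    obtain B where B: "ideal B" "I \<inter> B = {0}" "isum I B = vspan V"
      using complementedE[OF C I] .
    then show "ann leavitt_ring (ann leavitt_ring I) = I"
      using complement_unique_ann[OF I B] complement_unique_ann[OF B(1) I]
      by (simp add: Int_commute isum_commute)
  qed
next
  assume R: "\<forall>I. ideal I \<longrightarrow> ann leavitt_ring (ann leavitt_ring I) = I"
  have disj: "I \<inter> ann leavitt_ring I = {0}" if I: "ideal I" for I
    using semiprime[OF ideal_Int[OF I ideal_ann[OF I]]] by (auto simp: mem_ann)
  show complemented
    unfolding complemented_def
  proof (intro allI impI)
    fix I assume I: "ideal I"
    let ?B = "ann leavitt_ring I"
    let ?S = "isum I ?B"
    have S: "ideal ?S" using ideal_isum[OF I ideal_ann[OF I]] .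
    have "ann leavitt_ring ?S \<subseteq> {0}"
    proof
      fix x assume "x \<in> ann leavitt_ring ?S"
      then have "x \<in> ?B" "x \<in> ann leavitt_ring ?B"
        using isum_superset[OF I ideal_ann[OF I]] by (auto simp: mem_ann)
      then show "x \<in> {0}" using disj[OF ideal_ann[OF I]] by blast
    qed
    then have "ann leavitt_ring (ann leavitt_ring ?S) = vspan V"
      unfolding set_eq_iff mem_ann[of _ "ann leavitt_ring ?S"] by auto
    then have "?S = vspan V" using R S by blast
    then show "\<exists>B. ideal B \<and> I \<inter> B = {0} \<and> isum I B = vspan V"
      using ideal_ann[OF I] disj[OF I] by blast
  qed
qed

lemma boolean_iff_complemented: "boolean_ideal_lattice leavitt_ring \<longleftrightarrow> complemented"
proof
  assume B: "boolean_ideal_lattice leavitt_ring"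
  show complemented
    unfolding complemented_def
  proof (intro allI impI)
    fix I assume I: "ideal I"
    then obtain B where "ideal B" "I \<inter> B = {0}" "ideal_join leavitt_ring I B = vspan V"
      using B unfolding boolean_ideal_lattice_def by (auto simp: leavitt_ring_def)
    then show "\<exists>B. ideal B \<and> I \<inter> B = {0} \<and> isum I B = vspan V"
      using ideal_join_isum[OF I] by auto
  qed
next
  assume C: complemented
  have distrib: "A \<inter> isum B D = isum (A \<inter> B) (A \<inter> D)" if A: "ideal A" and B: "ideal B" and D: "ideal D" for A B D
  proof
    show "isum (A \<inter> B) (A \<inter> D) \<subseteq> A \<inter> isum B D" using A by (auto simp: isum_def ideal_iff)
    show "A \<inter> isum B D \<subseteq> isum (A \<inter> B) (A \<inter> D)"
    proof
      fix x assume x: "x \<in> A \<inter> isum B D"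
      then obtain b d where bd: "x = b + d" "b \<in> B" "d \<in> D" by (auto simp: isum_def)
      obtain A' where A': "ideal A'" "A \<inter> A' = {0}" "isum A A' = vspan V"
        using complementedE[OF C A] .
      have xV: "x \<in> vspan V" using x A by (auto simp: ideal_iff)
      obtain F where F: "F \<subseteq> V" "sum vx F * x = x" using local_unit[OF xV] by blast
      obtain a a' where aa: "a \<in> A" "a' \<in> A'" "sum vx F = a + a'"
        using unit_vspan[OF F(1)] unfolding A'(3)[symmetric] mem_isum by blast
      have aV: "a \<in> vspan V" "b \<in> vspan V" "d \<in> vspan V" using aa bd A B D by (auto simp: ideal_iff)
      \<comment> \<open>Since \<open>a'\<close> annihilates \<open>A\<close>, its partner
        \<open>a\<close> acts on \<open>x\<close> as the identity. Multiplying by \<open>a\<close>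
        moves the summands \<open>b\<close> and \<open>d\<close> into \<open>A\<close>.\<close>
      have "a' * x = 0" using ideal_disjoint_mult[OF A'(1) A] A'(2) aa x by (auto simp: Int_commute)
      then have "a * x = x" using F(2) unfolding aa(3) by (simp add: distrib_right)
      then have "x = a * b + a * d" using bd(1) by (metis distrib_left)
      moreover have "a * b \<in> A \<inter> B" "a * d \<in> A \<inter> D"
        using aa(1) bd aV A B D by (auto intro: ideal_mult)
      ultimately show "x \<in> isum (A \<inter> B) (A \<inter> D)" unfolding isum_def by blast
    qed
  qed
  have "\<exists>B. ideal B \<and> A \<inter> B = {0} \<and> ideal_join leavitt_ring A B = vspan V" if A: "ideal A" for A
    using complementedE[OF C A] ideal_join_isum[OF A] by metis
  moreover have "carr leavitt_ring = vspan V" "rzero leavitt_ring = 0" by (simp_all add: leavitt_ring_def)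
  ultimately show "boolean_ideal_lattice leavitt_ring"
    unfolding boolean_ideal_lattice_def by (simp add: ideal_join_isum ideal_Int distrib)
qed

text \<open>If the ghost of \<open>p\<close> does not annihilate \<open>q\<close> followed by
  \<open>p\<close>, then \<open>p\<close> is periodic with period \<open>length q\<close>, and its
  last edge also occurs one period earlier. A bound \<open>m\<close> on the lengths of the closed
  paths in \<open>y\<close> ensures that this earlier position exists.\<close>

lemma ghost_closed_path_zero:
  "y \<in> closed_span u \<Longrightarrow> \<exists>m. \<forall>p w. vpath u p w \<longrightarrow> m < length p \<longrightarrow> last p \<notin> set (butlast p) \<longrightarrow>
    gp p w * y * mp p w = 0"
  unfolding closed_span_def
proof (induction rule: span_induct_alt)
  case base
  show ?case by simp
next
  case (step c x y)
  then obtain m q where m: "\<forall>p w. vpath u p w \<longrightarrow> m < length p \<longrightarrow> last p \<notin> set (butlast p) \<longrightarrow>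
    gp p w * y * mp p w = 0" and q: "x = mp q u" "q \<noteq> []" "vpath u q u" by blast
  have "gp p w * x * mp p w = 0"
    if p: "vpath u p w" "length q < length p" "last p \<notin> set (butlast p)" for p w
  proof -
    have qp: "vpath u (q @ p) w" using p q by (auto simp: vpath_append)
    have "gp p w * mp (q @ p) w = 0"
    proof (cases rule: gp_mp_cases[OF p(1) qp])
      case (1 t)
      let ?n = "length p - 1"
      have lt: "?n - length q < length (butlast p)" using p(2) q(2) by (cases q) auto
      have "p \<noteq> []" using p(2) by auto
      then have "last p = (p @ t) ! ?n" by (simp add: nth_append last_conv_nth)
      also have "\<dots> = (q @ p) ! ?n" by (simp only: 1(2))
      also have "\<dots> = p ! (?n - length q)" using p(2) by (subst nth_append) (auto simp: not_less)
      also have "\<dots> = butlast p ! (?n - length q)" by (rule nth_butlast[OF lt, symmetric])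
      also have "\<dots> \<in> set (butlast p)" by (rule nth_mem[OF lt])
      finally show ?thesis using p(3) by simp
    next
      case (2 t)
      have "length p = length q + length p + length t" using arg_cong[OF 2(3), of length] by simp
      then show ?thesis using 2(2) by simp
    qed
    then show ?thesis using p q by (simp add: mp_append[of u] mult.assoc)
  qed
  then show ?case using m
    by (intro exI[of _ "max m (length q)"])
      (simp add: distrib_left distrib_right scale_mult_left scale_mult_right)
qed

text \<open>The Cuntz-Krieger uniqueness theorem. A path that winds often enough around a cycle and leaves
  it by an exit at the end kills the closed paths in \<open>vx u + y\<close>.\<close>

lemma ideal_contains_vertex:
  assumes exits: "\<And>c. cycle c \<Longrightarrow> has_exit Es s c" and I: "ideal I" "I \<noteq> {0}"
  shows "\<exists>u\<in>V. vx u \<in> I"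
proof -
  obtain x where "x \<in> I" "x \<noteq> 0" using I by (auto simp: ideal_iff)
  then obtain u y where u: "u \<in> V" "y \<in> closed_span u" "vx u + y \<in> I"
    using reduction[OF I(1)] by blast
  show ?thesis
  proof (cases "\<exists>p. p \<noteq> [] \<and> vpath u p u")
    case False
    then have E: "{mp p u | p. p \<noteq> [] \<and> vpath u p u} = {}" by blast
    then have "y = 0" using u(2) unfolding closed_span_def E by simp
    then show ?thesis using u by auto
  next
    case True
    then obtain c where c: "cycle c" "s (hd c) = u" using closed_path_cycle by blast
    obtain e where e: "e \<in> Es" "s e \<in> cycle_verts s c" "e \<notin> set c"
      using exits[OF c(1)] by (auto simp: has_exit_def is_exit_def)
    obtain k where k: "k < length c" "s e = s (c ! k)"
      using e(2) by (auto simp: cycle_verts_def in_set_conv_nth)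
    obtain m where m: "\<forall>p w. vpath u p w \<longrightarrow> m < length p \<longrightarrow> last p \<notin> set (butlast p) \<longrightarrow>
      gp p w * y * mp p w = 0" using ghost_closed_path_zero[OF u(2)] by blast
    define d where "d = concat (replicate m c)"
    have d: "vpath u d u" unfolding d_def
      using cycle_vpath[OF c(1)] c(2) u(1) by (induction m) (auto simp: vpath_append)
    have ld: "m \<le> length d"
      using cycle_nonempty[OF c(1)] unfolding d_def by (cases c) (auto simp: length_concat sum_list_replicate)
    define p where "p = d @ take k c @ [e]"
    have p: "vpath u p (r e)"
      using d vpath_split_nth(1)[OF cycle_vpath[OF c(1)] k(1)] c(2) k(2) e(1) target
      by (auto simp: p_def vpath_append)
    have "set d \<subseteq> set c" by (auto simp: d_def)
    then have "last p \<notin> set (butlast p)"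
      using e(3) set_take_subset[of k c] by (auto simp: p_def butlast_append)
    moreover have "m < length p" using ld by (simp add: p_def)
    ultimately have "gp p (r e) * y * mp p (r e) = 0" using m p by blast
    then have "gp p (r e) * (vx u + y) * mp p (r e) = vx (r e)"
      using p by (simp add: distrib_left distrib_right gp_vx gp_mp)
    moreover have "gp p (r e) * (vx u + y) * mp p (r e) \<in> I"
      using u(3) I(1) gp_vspan[OF p, of V] mp_vspan[OF p, of V] target[OF e(1)]
      by (intro ideal_mult) auto
    ultimately show ?thesis using target[OF e(1)] by auto
  qed
qed

section \<open>Vertices in ideals, and complements from the graph condition\<close>

lemma vx_vspan: "v \<in> W \<Longrightarrow> v \<in> V \<Longrightarrow> vx v \<in> vspan W"
  using mp_vspan[of v "[]" v W] by simp

lemma edge_vspan: "e \<in> Es \<Longrightarrow> ed e \<in> vspan V" "e \<in> Es \<Longrightarrow> gh e \<in> vspan V"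
  using mp_vspan[of "s e" "[e]" "r e" V] gp_vspan[of "s e" "[e]" "r e" V] target[of e]
  by (auto simp: ed_r r_gh)

lemma ideal_vertices_hereditary:
  assumes I: "ideal I"
  shows "hereditary {v \<in> V. vx v \<in> I}"
  unfolding hereditary_def
proof (intro conjI ballI impI)
  fix e assume e: "e \<in> Es" "s e \<in> {v \<in> V. vx v \<in> I}"
  have "gh e * vx (s e) * ed e \<in> I" using e I edge_vspan by (intro ideal_mult) auto
  then show "r e \<in> {v \<in> V. vx v \<in> I}" using e target by (simp add: gh_s gh_ed)
qed auto

lemma ideal_vertices_saturated:
  assumes I: "ideal I" and v: "v \<in> V" "finite {e \<in> Es. s e = v}" "{e \<in> Es. s e = v} \<noteq> {}"
    and e: "\<And>e. e \<in> Es \<Longrightarrow> s e = v \<Longrightarrow> vx (r e) \<in> I"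
  shows "vx v \<in> I"
proof -
  have "ed e * gh e \<in> I" if "e \<in> {e \<in> Es. s e = v}" for e
  proof -
    have "ed e * vx (r e) * gh e \<in> I" using that e I edge_vspan by (intro ideal_mult) auto
    then show ?thesis using that by (simp add: ed_r)
  qed
  then show ?thesis
    unfolding vx_sum[OF v] by (intro subspace_sum[OF ideal_subspace[OF I]])
qed

lemma vspan_subset_ideal:
  assumes I: "ideal I" and W: "\<And>v. v \<in> W \<Longrightarrow> v \<in> V \<Longrightarrow> vx v \<in> I"
  shows "vspan W \<subseteq> I"
  unfolding vspan_def
proof (rule span_minimal[OF _ ideal_subspace[OF I]])
  show "monomials W \<subseteq> I"
  proof
    fix x assume "x \<in> monomials W"
    then obtain p q u v w where x: "x = mp p u * gp q u" "u \<in> W" "vpath v p u" "vpath w q u"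
      by (auto simp: monomials_def)
    have "u \<in> V" using x vpath_V by blast
    then have "mp p u * vx u * gp q u \<in> I"
      using x W I mp_vspan[OF x(3), of V] gp_vspan[OF x(4), of V] by (intro ideal_mult) auto
    then show "x \<in> I" using x by (simp add: mp_vx)
  qed
qed

lemma strongly_all_reflexive_complemented:
  assumes SAR: "strongly_all_reflexive V Es s r"
  shows complemented
  unfolding complemented_def
proof (intro allI impI)
  fix I assume I: "ideal I"
  define H where "H = {v \<in> V. vx v \<in> I}"
  define H' where "H' = V - RR V Es s r H"
  have H: "hereditary H" unfolding H_def by (rule ideal_vertices_hereditary[OF I])
  have H': "hereditary H'" unfolding H'_def by (rule hereditary_compl_RR)
  let ?A = "vspan H" and ?B = "vspan H'"
  have A: "ideal ?A" and B: "ideal ?B" using H H' by (auto intro: ideal_vspan)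
  have S: "ideal (isum ?A ?B)" by (rule ideal_isum[OF A B])
  have sub: "H \<subseteq> V" "H' \<subseteq> V" using H H' by (auto simp: hereditary_def)
  \<comment> \<open>The vertices in an ideal form a hereditary and saturated set, which is what the
    covering lemma for graphs asks for.\<close>
  have "{v \<in> V. vx v \<in> isum ?A ?B} = V"
  proof (rule hereditary_saturated_cover[OF SAR H ideal_vertices_hereditary[OF S]])
    show "H \<subseteq> {v \<in> V. vx v \<in> isum ?A ?B}" "V - RR V Es s r H \<subseteq> {v \<in> V. vx v \<in> isum ?A ?B}"
      using isum_superset[OF A B] vx_vspan[of _ H] vx_vspan[of _ H'] sub unfolding H'_def by blast+
    fix v assume "v \<in> V" "finite {e \<in> Es. s e = v}" "{e \<in> Es. s e = v} \<noteq> {}"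
      "\<And>e. e \<in> Es \<Longrightarrow> s e = v \<Longrightarrow> r e \<in> {v \<in> V. vx v \<in> isum ?A ?B}"
    then show "v \<in> {v \<in> V. vx v \<in> isum ?A ?B}" using ideal_vertices_saturated[OF S, of v] by blast
  qed
  then have all: "vspan V \<subseteq> isum ?A ?B" by (intro vspan_subset_ideal[OF S]) blast
  have prod0: "x * y = 0 \<and> y * x = 0" if xy: "x \<in> ?A" "y \<in> ?B" for x y
  proof -
    \<comment> \<open>A common descendant would lie in the hereditary set \<open>H\<close>, so that
      a vertex of \<open>H'\<close> could reach \<open>H\<close>.\<close>
    have "z \<in> {}" if "u \<in> H" "u' \<in> H'" "vpath u t z" "vpath u' t' z" for u u' t t' z
      using that vpath_hereditary[OF that(3) H] by (auto simp: H'_def mem_RR)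
    then have "x * y \<in> vspan {}" "y * x \<in> vspan {}"
      using xy vspan_mult[of H H' "{}" x y] vspan_mult[of H' H "{}" y x] by blast+
    then show ?thesis by (simp add: vspan_def monomials_def)
  qed
  have AB: "?A \<inter> ?B = {0}"
    by (rule semiprime[OF ideal_Int[OF A B]]) (use prod0 in blast)
  have "I \<inter> ?B = {0}"
  proof (rule ccontr)
    assume "I \<inter> ?B \<noteq> {0}"
    moreover have "\<And>c. cycle c \<Longrightarrow> has_exit Es s c" using SAR by (simp add: strongly_all_reflexive_def)
    ultimately obtain u where u: "u \<in> V" "vx u \<in> I \<inter> ?B"
      using ideal_contains_vertex[OF _ ideal_Int[OF I B]] by blast
    then have "vx u \<in> ?A" by (intro vx_vspan) (auto simp: H_def)
    then show False using u AB vx_nonzero by blast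
  qed
  moreover have "?A \<subseteq> I" by (rule vspan_subset_ideal[OF I]) (simp add: H_def)
  moreover from this have "isum ?A ?B \<subseteq> isum I ?B" by (auto simp: isum_def)
  moreover have "isum I ?B \<subseteq> vspan V" using ideal_isum[OF I B] by (simp add: ideal_iff)
  ultimately show "\<exists>B. ideal B \<and> I \<inter> B = {0} \<and> isum I B = vspan V"
    using B all by blast
qed

end

section \<open>Graphs whose ideals are all complemented\<close>

context digraph begin

lemma cycle_edge_target:
  assumes c: "cycle c" and e: "e \<in> set c"
  shows "r e \<in> cycle_verts s c"
proof -
  obtain i where i: "i < length c" "e = c ! i" using e by (auto simp: in_set_conv_nth)
  show ?thesis
  proof (cases "Suc i < length c")
    case True
    then have "r e = s (c ! Suc i)" using c i by (simp add: is_cycle_def is_path_def)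
    then show ?thesis using True by (simp add: cycle_verts_def)
  next
    case False
    then have "i = length c - 1" "c \<noteq> []" using i(1) by auto
    then have "e = last c" using i(2) by (simp add: last_conv_nth)
    then show ?thesis using c hd_cycle_verts[OF c] by (simp add: is_cycle_def)
  qed
qed

text \<open>Every vertex of such a cycle emits just one edge, so a path is determined by its start
  and its length. This makes \<open>c\<close> commute with the closed paths at its base.\<close>

lemma path_from_exitless_cycle_unique:
  assumes c: "cycle c" "\<not> has_exit Es s c"
  shows "vpath v p u \<Longrightarrow> vpath v q w \<Longrightarrow> v \<in> cycle_verts s c \<Longrightarrow> length p = length q \<Longrightarrow> p = q"
proof (induction p arbitrary: v q)
  case (Cons e p)
  then obtain f q' where q: "q = f # q'" by (cases q) auto
  have ef: "e \<in> set c" "f \<in> set c" "s e = s f"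
    using Cons.prems q c(2) by (auto simp: has_exit_def is_exit_def)
  moreover have "inj_on s (set c)" using c(1) by (simp add: is_cycle_def distinct_map)
  ultimately have "e = f" by (auto dest: inj_onD)
  then show ?case using Cons.IH[of "r e" q'] Cons.prems q cycle_edge_target[OF c(1) ef(1)] by auto
qed simp

lemma closed_path_power:
  "vpath v c v \<Longrightarrow> vpath v (concat (replicate n c)) v"
  by (induction n) (auto simp: vpath_append dest: vpath_V)

end

lemma length_concat_replicate: "length (concat (replicate n c)) = n * length c"
  by (induction n) auto

context leavitt begin

text \<open>A path at least as long as all ghost parts of \<open>x\<close> cancels or annihilates
  each of them completely.\<close>

lemma mult_long_path_real:
  "x \<in> vspan V \<Longrightarrow> \<exists>n. \<forall>v q u. vpath v q u \<longrightarrow> n \<le> length q \<longrightarrow> x * mp q u \<in> path_span u"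
  unfolding vspan_def
proof (induction rule: span_induct_alt)
  case base
  then show ?case using subspace_path_span by (simp add: subspace_0)
next
  case (step c a x)
  then obtain n where n: "\<forall>v q u. vpath v q u \<longrightarrow> n \<le> length q \<longrightarrow> x * mp q u \<in> path_span u" by blast
  obtain p q z v w where a: "a = mp p z * gp q z" "vpath v p z" "vpath w q z"
    using step by (auto simp: monomials_def)
  have "a * mp q' u \<in> path_span u" if q': "vpath v' q' u" "length q \<le> length q'" for v' q' u
  proof (cases rule: gp_mp_cases[OF a(3) q'(1)])
    case (1 t)
    then show ?thesis using a by (auto simp: mult.assoc intro: path_span_mult mp_path_span)
  next
    case (2 t)
    then show ?thesis using q' by auto
  next
    case 3
    then show ?thesis using a subspace_path_span by (simp add: mult.assoc subspace_0)
  qed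
  then show ?case using n
    by (intro exI[of _ "max n (length q)"])
      (simp add: distrib_right scale_mult_left subspace_add subspace_scale subspace_path_span)
qed

text \<open>A ghost part is cancelled completely only by a path through the middle vertex of its
  monomial. That vertex lies in \<open>W\<close>, and then so does the end of the path.\<close>

lemma mult_long_path_zero:
  assumes W: "hereditary W"
  shows "x \<in> vspan W \<Longrightarrow> \<exists>n. \<forall>v q u. vpath v q u \<longrightarrow> n \<le> length q \<longrightarrow> u \<notin> W \<longrightarrow> x * mp q u = 0"
  unfolding vspan_def
proof (induction rule: span_induct_alt)
  case base
  then show ?case by simp
next
  case (step c a x)
  then obtain n where n: "\<forall>v q u. vpath v q u \<longrightarrow> n \<le> length q \<longrightarrow> u \<notin> W \<longrightarrow> x * mp q u = 0" by blast
  obtain p q z v w where a: "a = mp p z * gp q z" "vpath v p z" "vpath w q z" "z \<in> W"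
    using step by (auto simp: monomials_def)
  have "a * mp q' u = 0" if q': "vpath v' q' u" "length q \<le> length q'" "u \<notin> W" for v' q' u
  proof (cases rule: gp_mp_cases[OF a(3) q'(1)])
    case (1 t)
    then show ?thesis using vpath_hereditary[OF _ W a(4)] q'(3) by blast
  next
    case (2 t)
    then show ?thesis using q' by auto
  next
    case 3
    then show ?thesis using a by (simp add: mult.assoc)
  qed
  then show ?case using n
    by (intro exI[of _ "max n (length q)"]) (simp add: distrib_right scale_mult_left)
qed

text \<open>An edge at \<open>v\<close> survives only against a ghost part that starts with it: a
  monomial without ghost edges ends in \<open>W\<close>, hence not at \<open>v\<close>. The witness
  \<open>F\<close> collects all edges of the finitely many ghost parts.\<close>

lemma mult_edge_zero:
  assumes v: "v \<in> V" "v \<notin> W"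
  shows "x \<in> vspan W \<Longrightarrow> \<exists>F. finite F \<and> (\<forall>e\<in>Es. s e = v \<longrightarrow> e \<notin> F \<longrightarrow> x * ed e = 0)"
  unfolding vspan_def
proof (induction rule: span_induct_alt)
  case base
  then show ?case by auto
next
  case (step c a x)
  then obtain F where F: "finite F" "\<forall>e\<in>Es. s e = v \<longrightarrow> e \<notin> F \<longrightarrow> x * ed e = 0" by blast
  obtain p q z w where a: "a = mp p z * gp q z" "vpath w q z" "z \<in> W"
    using step by (auto simp: monomials_def)
  have "a * ed e = 0" if e: "e \<in> Es" "s e = v" "e \<notin> set q" for e
  proof -
    have "gp q z * ed e = 0"
    proof (cases q)
      case Nil
      then have "vx z * vx v = 0" using a v by (auto simp: vx_vx)
      then show ?thesis using s_ed[OF e(1)] e(2) Nil by (metis gp.simps(1) mult.assoc mult_zero_left)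
    next
      case (Cons f q')
      then show ?thesis using a e by (auto simp: mult.assoc gh_ed)
    qed
    then show ?thesis by (simp add: a mult.assoc)
  qed
  then show ?case using F
    by (intro exI[of _ "F \<union> set q"]) (simp add: distrib_right scale_mult_left)
qed

lemma complement_decomposition:
  assumes C: complemented and W: "hereditary W" and v: "v \<in> V"
  shows "\<exists>i\<in>vspan W. \<exists>b\<in>vspan V. vx v = i + b \<and> (\<forall>x\<in>vspan W. \<forall>y\<in>vspan V. b * y * x = 0)"
proof -
  obtain B where B: "ideal B" "vspan W \<inter> B = {0}" "isum (vspan W) B = vspan V"
    using complementedE[OF C ideal_vspan[OF W]] .
  obtain i b where ib: "i \<in> vspan W" "b \<in> B" "vx v = i + b"
    using vx_vspan[OF v v] unfolding B(3)[symmetric] mem_isum by blast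
  have "b * y * x = 0" if "x \<in> vspan W" "y \<in> vspan V" for x y
    using ideal_disjoint_mult[OF B(1) ideal_vspan[OF W]] B ib that
    by (auto simp: Int_commute intro: ideal_mult)
  moreover have "b \<in> vspan V" using ib(2) B(1) unfolding ideal_iff by blast
  ultimately show ?thesis using ib by blast
qed

text \<open>Applied both to cycles that are not extreme and to infinite paths violating condition
  (c). Because \<open>W\<close> is hereditary, an end outside \<open>W\<close> means that all of
  \<open>q\<close> avoids \<open>W\<close>.\<close>

lemma complemented_escape:
  assumes C: complemented and W: "hereditary W" and v: "v \<in> V"
    and long: "\<And>n. \<exists>q u t w. vpath v q u \<and> n \<le> length q \<and> u \<notin> W \<and> vpath u t w \<and> w \<in> W"
  shows False
proof -
  obtain i b where ib: "i \<in> vspan W" "b \<in> vspan V" "vx v = i + b"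
    and zero: "\<And>x y. x \<in> vspan W \<Longrightarrow> y \<in> vspan V \<Longrightarrow> b * y * x = 0"
    using complement_decomposition[OF C W v] by blast
  obtain n where n: "\<forall>v q u. vpath v q u \<longrightarrow> n \<le> length q \<longrightarrow> b * mp q u \<in> path_span u"
    using mult_long_path_real[OF ib(2)] by blast
  obtain m where m: "\<forall>v q u. vpath v q u \<longrightarrow> m \<le> length q \<longrightarrow> u \<notin> W \<longrightarrow> i * mp q u = 0"
    using mult_long_path_zero[OF W ib(1)] by blast
  obtain q u t w where q: "vpath v q u" "max n m \<le> length q" "u \<notin> W" "vpath u t w" "w \<in> W"
    using long by blast
  have "b * mp q u * mp t w = 0"
    using zero mp_vspan[OF q(4,5)] mp_vspan[OF q(1)] vpath_V[OF q(1)] by blast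
  then have "b * mp q u = 0" using right_cancel[OF _ q(4)] n q(1,2) by simp
  moreover have "i * mp q u = 0" using m q by simp
  ultimately have "vx v * mp q u = 0" unfolding ib(3) by (simp add: distrib_right)
  then show False using vx_mp[OF q(1)] mp_nonzero[OF q(1)] by simp
qed

text \<open>If \<open>v\<close> lies on no cycle, the set \<open>W\<close> of its descendants along
  nontrivial paths does not contain \<open>v\<close>. All but finitely many edges at
  \<open>v\<close> are killed by \<open>i\<close>, and all of them by \<open>b\<close>, since they
  end in \<open>W\<close>. Some edge would therefore be zero.\<close>

lemma complemented_infinite_emitter:
  assumes C: complemented and v: "v \<in> V" "infinite {e \<in> Es. s e = v}"
  shows "\<exists>c. cycle c \<and> v \<in> cycle_verts s c"
proof (rule ccontr)
  assume no: "\<not> ?thesis"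
  define W where "W = {w \<in> V. \<exists>e\<in>Es. s e = v \<and> (\<exists>p. vpath (r e) p w)}"
  have "v \<notin> W"
  proof
    assume "v \<in> W"
    then obtain e p where "e \<in> Es" "s e = v" "vpath (r e) p v" by (auto simp: W_def)
    then have "vpath v (e # p) v" by auto
    then show False using closed_path_cycle[of v "e # p"] hd_cycle_verts no by auto
  qed
  have W: "hereditary W"
    unfolding hereditary_def
  proof (intro conjI ballI impI)
    fix f assume f: "f \<in> Es" "s f \<in> W"
    then obtain e p where "e \<in> Es" "s e = v" "vpath (r e) p (s f)" by (auto simp: W_def)
    moreover from this have "vpath (r e) (p @ [f]) (r f)" using f target by (auto simp: vpath_append)
    ultimately show "r f \<in> W" using f target by (auto simp: W_def)
  qed (simp add: W_def)
  obtain i b where ib: "i \<in> vspan W" "vx v = i + b"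
    and zero: "\<And>x y. x \<in> vspan W \<Longrightarrow> y \<in> vspan V \<Longrightarrow> b * y * x = 0"
    using complement_decomposition[OF C W v(1)] by blast
  obtain F where F: "finite F" "\<forall>e\<in>Es. s e = v \<longrightarrow> e \<notin> F \<longrightarrow> i * ed e = 0"
    using mult_edge_zero[OF v(1) \<open>v \<notin> W\<close> ib(1)] by blast
  have "\<not> {e \<in> Es. s e = v} \<subseteq> F" using v(2) F(1) finite_subset by blast
  then obtain e where e: "e \<in> Es" "s e = v" "e \<notin> F" by blast
  have p: "vpath v [e] (r e)" using e target by auto
  have "vpath (r e) [] (r e)" using e target by simp
  then have "r e \<in> W" using e target unfolding W_def by blast
  then have "ed e \<in> vspan W" using mp_vspan[OF p] by (simp add: ed_r e)
  then have "b * vx v * ed e = 0" using zero vx_vspan[OF v(1) v(1)] by blast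
  then have "b * ed e = 0" using s_ed[OF e(1)] e(2) by (simp add: mult.assoc)
  then have "vx v * ed e = 0" unfolding ib(2) using F(2) e by (simp add: distrib_right)
  then show False using s_ed[OF e(1)] e(2) mp_nonzero[OF p] by (simp add: ed_r e)
qed

lemma coeff_short_zero:
  assumes t: "vpath v t u" "length q < length t"
  shows "x \<in> path_span v \<Longrightarrow> coeff u q (x * mp t u) = 0"
  unfolding path_span_def[of v]
proof (induction rule: span_induct_alt)
  case (step c x y)
  then obtain w p where p: "x = mp p v" "vpath w p v" by (auto simp: paths_to_def)
  have "x * mp t u = mp (p @ t) u" using p t by (simp add: mp_append[of w])
  moreover have "vpath w (p @ t) u" using p t by (auto simp: vpath_append)
  ultimately have "coeff u q (x * mp t u) = 0" using t(2) by (auto simp: coeff_props(3)[of w])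
  then show ?case using step by (simp add: distrib_right scale_mult_left coeff_props)
qed simp

text \<open>The two sides have different sums of coefficients.\<close>

lemma path_not_multiple:
  assumes c: "vpath v c v" and d: "vpath v d v" and Y: "Y \<in> path_span v"
  shows "mp d v \<noteq> Y - Y * mp c v"
proof
  assume eq: "mp d v = Y - Y * mp c v"
  obtain S k where S: "finite S" "S \<subseteq> paths_to v" "Y = (\<Sum>p\<in>S. k p *s mp p v)"
    using path_span_repr[OF Y] by blast
  \<comment> \<open>All paths that can occur on either side belong to \<open>F\<close>, so that
    \<open>G\<close> adds up all their coefficients.\<close>
  define F where "F = insert d (S \<union> (\<lambda>p. p @ c) ` S)"
  define G where "G x = (\<Sum>q\<in>F. coeff v q x)" for x
  have F: "finite F" using S by (simp add: F_def)
  have G1: "G (mp p v) = 1" if p: "vpath w p v" "p \<in> F" for w p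
    using F p by (simp add: G_def coeff_props(3)[OF p(1)])
  have Gsum: "G (\<Sum>p\<in>S. k p *s f p) = (\<Sum>p\<in>S. k p)" if "\<And>p. p \<in> S \<Longrightarrow> G (f p) = 1" for f
  proof -
    have "G (\<Sum>p\<in>S. k p *s f p) = (\<Sum>p\<in>S. k p * G (f p))"
      unfolding G_def coeff_sum coeff_props(2) sum_distrib_left by (rule sum.swap)
    then show ?thesis using that by simp
  qed
  have "G Y = sum k S"
    unfolding S(3)
  proof (rule Gsum)
    fix p assume p: "p \<in> S"
    then obtain w where "vpath w p v" using S(2) by (auto simp: paths_to_def)
    then show "G (mp p v) = 1" by (rule G1) (simp add: F_def p)
  qed
  moreover have "Y * mp c v = (\<Sum>p\<in>S. k p *s (mp p v * mp c v))"
    unfolding S(3) by (simp add: sum_distrib_right scale_mult_left)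
  moreover have "G (mp p v * mp c v) = 1" if p: "p \<in> S" for p
  proof -
    obtain w where w: "vpath w p v" using S(2) p by (auto simp: paths_to_def)
    then have "mp p v * mp c v = mp (p @ c) v" "vpath w (p @ c) v"
      using c by (auto simp: mp_append[of w] vpath_append)
    then show ?thesis using p G1 by (simp add: F_def)
  qed
  ultimately have "G (Y * mp c v) = G Y" by (simp add: Gsum)
  moreover have "G (Y - Y * mp c v) = G Y - G (Y * mp c v)"
    by (simp add: G_def coeff_diff sum_subtractf)
  moreover have "G (mp d v) = 1" using G1[OF d] by (simp add: F_def)
  ultimately show False using eq by simp
qed

text \<open>Let \<open>A\<close> be the ideal generated by \<open>g = v - c\<close>. Its complement
  annihilates \<open>g\<close>, so the component of \<open>v\<close> there is invariant under
  \<open>c\<close>, which forces it to vanish and puts \<open>v\<close> into \<open>A\<close>.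
  Membership in \<open>A\<close> in turn makes a power of \<open>c\<close> a multiple
  \<open>Y g\<close> in the path algebra, against \<open>path_not_multiple\<close>.\<close>

lemma complemented_cycle_exit:
  assumes C: complemented and c: "cycle c"
  shows "has_exit Es s c"
proof (rule ccontr)
  assume no: "\<not> has_exit Es s c"
  define v where "v = s (hd c)"
  have vc: "vpath v c v" "c \<noteq> []" "v \<in> cycle_verts s c"
    using cycle_vpath[OF c] cycle_nonempty[OF c] hd_cycle_verts[OF c] by (auto simp: v_def)
  have v: "v \<in> V" using vc(1) vpath_V by blast
  define cn where "cn n = concat (replicate n c)" for n
  have cn: "vpath v (cn n) v" "n \<le> length (cn n)" for n
    using closed_path_power[OF vc(1)] vc(2) by (auto simp: cn_def length_concat_replicate Suc_le_eq)
  define g where "g = vx v - mp c v"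
  have gV: "g \<in> vspan V"
    unfolding g_def using vx_vspan[OF v v] mp_vspan[OF vc(1) v] by (rule vspan_V_closed)
  have gv: "g * vx v = g" "vx v * g = g"
    using v vc(1) by (simp_all add: g_def left_diff_distrib right_diff_distrib vx_vx mp_vx vx_mp)
  define gens where "gens = {x * g * y | x y. x \<in> vspan V \<and> y \<in> vspan V}"
  define A where "A = span gens"
  have gens_mult: "a * x \<in> gens \<and> x * a \<in> gens" if a: "a \<in> vspan V" and x: "x \<in> gens" for a x
  proof -
    obtain y z where "x = y * g * z" "y \<in> vspan V" "z \<in> vspan V" using x by (auto simp: gens_def)
    then have "a * x = (a * y) * g * z" "x * a = y * g * (z * a)" "a * y \<in> vspan V" "z * a \<in> vspan V"
      using a by (auto simp: mult.assoc vspan_V_closed)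
    then show ?thesis using \<open>y \<in> _\<close> \<open>z \<in> _\<close> unfolding gens_def by blast
  qed
  have A: "ideal A"
    unfolding ideal_iff
  proof (intro conjI ballI)
    show "A \<subseteq> vspan V"
      unfolding A_def using gV by (intro span_minimal subspace_vspan) (auto simp: gens_def vspan_V_closed)
    show "a * x \<in> A" if "a \<in> vspan V" "x \<in> A" for a x
      by (rule span_mult[of A "{a}" gens]) (use that gens_mult in \<open>auto simp: A_def intro: span_base\<close>)
    show "x * a \<in> A" if "a \<in> vspan V" "x \<in> A" for a x
      by (rule span_mult[of A gens "{a}"]) (use that gens_mult in \<open>auto simp: A_def intro: span_base\<close>)
  qed (auto simp: A_def span_zero span_add span_neg)
  have gA: "g \<in> A"
    unfolding A_def gens_def using vx_vspan[OF v v] gv by (intro span_base) force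
  obtain B where B: "ideal B" "A \<inter> B = {0}" "isum A B = vspan V"
    using complementedE[OF C A] .
  obtain a b where ab: "a \<in> A" "b \<in> B" "vx v = a + b"
    using vx_vspan[OF v v] unfolding B(3)[symmetric] mem_isum by blast
  have bV: "b \<in> vspan V" using ab(2) B(1) by (auto simp: ideal_iff)
  have "b * g = 0" using ideal_disjoint_mult[OF B(1) A _ ab(2) gA] B(2) by (simp add: Int_commute)
  then have bc: "b * mp c v = b * vx v" by (simp add: g_def right_diff_distrib)
  have bcn: "b * mp (cn n) v = b * vx v" for n
  proof (induction n)
    case 0
    then show ?case by (simp add: cn_def)
  next
    case (Suc n)
    have "mp (cn (Suc n)) v = mp c v * mp (cn n) v"
      using mp_append[OF vc(1) cn(1)] by (simp add: cn_def)
    then have "b * mp (cn (Suc n)) v = b * (vx v * mp (cn n) v)"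
      using bc by (metis mult.assoc)
    then show ?case using Suc vx_mp[OF cn(1)] by simp
  qed
  \<comment> \<open>Multiplication by a high power of \<open>c\<close> takes \<open>b\<close> into
    the path algebra, but by \<open>bcn\<close> the product does not depend on the power.\<close>
  obtain n where "\<forall>v q u. vpath v q u \<longrightarrow> n \<le> length q \<longrightarrow> b * mp q u \<in> path_span u"
    using mult_long_path_real[OF bV] by blast
  then have bP: "b * vx v \<in> path_span v" using cn[of n] bcn[of n] by metis
  have "b * vx v * mp (cn n) v = b * vx v" for n
    using bcn[of n] vx_mp[OF cn(1)] by (simp add: mult.assoc)
  \<comment> \<open>Every path in the product with a power of \<open>c\<close> longer than
    \<open>q\<close> is itself longer than \<open>q\<close>, so the coefficient at \<open>q\<close>
    is zero.\<close>
  then have "coeff v q (b * vx v) = 0" for q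
    using coeff_short_zero[OF cn(1) _ bP, of q "Suc (length q)"] cn(2)[of "Suc (length q)"] by simp
  then have "b * vx v = 0" using path_span_zero[OF bP] by blast
  moreover have "vx v = (a + b) * vx v" using vx_vx[OF v v] ab(3) by simp
  ultimately have "vx v = a * vx v" by (simp add: distrib_right)
  then have vA: "vx v \<in> A" using ideal_mult(2)[OF A ab(1) vx_vspan[OF v v]] by simp
  have comm_path: "g * mp p v = mp p v * g" if p: "vpath v p v" for p
  proof -
    \<comment> \<open>Both are paths of the same length from \<open>v\<close>, and the cycle has no
      exit.\<close>
    have "c @ p = p @ c"
      using p vc by (intro path_from_exitless_cycle_unique[OF c no, of v _ v _ v]) (auto simp: vpath_append)
    then have "mp c v * mp p v = mp p v * mp c v" using mp_append[OF vc(1) p] mp_append[OF p vc(1)] by simp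
    then show ?thesis using p by (simp add: g_def left_diff_distrib right_diff_distrib vx_mp mp_vx)
  qed
  \<comment> \<open>Closed paths at \<open>v\<close> commute with \<open>g\<close>, and paths into
    \<open>v\<close> from elsewhere are annihilated by \<open>g\<close> from the left. The new
    factor \<open>y\<close> may thus differ from \<open>x\<close>.\<close>
  have comm: "x \<in> path_span v \<Longrightarrow> \<exists>y\<in>vspan V. g * x = y * g" for x
    unfolding path_span_def
  proof (induction rule: span_induct_alt)
    case base
    then show ?case by (intro bexI[of _ 0]) (auto simp: vspan_V_closed)
  next
    case (step k x x')
    then obtain y' where y': "y' \<in> vspan V" "g * x' = y' * g" by blast
    obtain w p where p: "x = mp p v" "vpath w p v" using step by (auto simp: paths_to_def)
    have "\<exists>y\<in>vspan V. g * x = y * g"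
    proof (cases "w = v")
      case True
      then show ?thesis using comm_path[of p] p mp_vspan[OF p(2) v] by auto
    next
      case False
      have "g * x = g * (vx v * mp p v)" using gv(1) p by (metis mult.assoc)
      also have "\<dots> = 0" using vx_mp_other[OF p(2) v] False by simp
      finally show ?thesis by (intro bexI[of _ 0]) (auto simp: vspan_V_closed)
    qed
    then obtain y where y: "y \<in> vspan V" "g * x = y * g" by blast
    have "k *s y + y' \<in> vspan V" using y y' subspace_vspan by (intro subspace_add subspace_scale)
    then show ?case using y y'
      by (intro bexI[of _ "k *s y + y'"]) (simp_all add: distrib_left distrib_right scale_mult_left scale_mult_right)
  qed
  \<comment> \<open>In a generator \<open>y1 * g * y2\<close>, a high power of \<open>c\<close>
    makes \<open>y2\<close> real, after which \<open>g\<close> can be moved to the right end.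
    Allowing all large \<open>m\<close> is what makes the property additive.\<close>
  have "z \<in> A \<Longrightarrow> \<exists>n. \<forall>m\<ge>n. \<exists>y\<in>vspan V. z * mp (cn m) v = y * g" for z
    unfolding A_def
  proof (induction rule: span_induct_alt)
    case base
    have "0 * mp (cn m) v = 0 * g" for m by simp
    then show ?case using vspan_V_closed(5) by blast
  next
    case (step k x z)
    then obtain n where n: "\<forall>m\<ge>n. \<exists>y\<in>vspan V. z * mp (cn m) v = y * g" by blast
    obtain y1 y2 where x: "x = y1 * g * y2" "y1 \<in> vspan V" "y2 \<in> vspan V" using step by (auto simp: gens_def)
    obtain n' where n': "\<forall>v q u. vpath v q u \<longrightarrow> n' \<le> length q \<longrightarrow> y2 * mp q u \<in> path_span u"
      using mult_long_path_real[OF x(3)] by blast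
    have "\<exists>y\<in>vspan V. (k *s x + z) * mp (cn m) v = y * g" if m: "max n n' \<le> m" for m
    proof -
      have "y2 * mp (cn m) v \<in> path_span v" using n' cn[of m] m by (meson le_trans max.cobounded2)
      then obtain y3 where y3: "y3 \<in> vspan V" "g * (y2 * mp (cn m) v) = y3 * g" using comm by blast
      obtain y where y: "y \<in> vspan V" "z * mp (cn m) v = y * g" using n m by auto
      have "x * mp (cn m) v = y1 * (g * (y2 * mp (cn m) v))" by (simp add: x mult.assoc)
      then have "(k *s x + z) * mp (cn m) v = (k *s (y1 * y3) + y) * g"
        unfolding y3 by (simp add: distrib_right scale_mult_left y mult.assoc)
      moreover have "k *s (y1 * y3) + y \<in> vspan V"
        using x y y3 subspace_vspan by (intro subspace_add subspace_scale vspan_V_closed(3))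
      ultimately show ?thesis by blast
    qed
    then show ?case by blast
  qed
  then obtain m y where y: "y \<in> vspan V" "vx v * mp (cn m) v = y * g" using vA by blast
  obtain n where n: "\<forall>v q u. vpath v q u \<longrightarrow> n \<le> length q \<longrightarrow> y * mp q u \<in> path_span u"
    using mult_long_path_real[OF y(1)] by blast
  \<comment> \<open>A second power of \<open>c\<close> clears the ghost parts of \<open>y\<close>;
    it commutes with \<open>g\<close>.\<close>
  define Y where "Y = y * mp (cn n) v"
  have YP: "Y \<in> path_span v" using n cn[of n] by (simp add: Y_def)
  have "mp (cn m @ cn n) v = y * g * mp (cn n) v"
    using mp_append[OF cn(1) cn(1)] y(2) vx_mp[OF cn(1)] by simp
  also have "\<dots> = Y * g" using comm_path[OF cn(1)] by (simp add: Y_def mult.assoc)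
  also have "\<dots> = Y - Y * mp c v"
    using mp_vx[OF cn(1)] by (simp add: g_def Y_def right_diff_distrib mult.assoc)
  finally show False
    using path_not_multiple[OF vc(1) _ YP, of "cn m @ cn n"] cn(1) by (auto simp: vpath_append)
qed

text \<open>Let \<open>W\<close> be the vertices that cannot reach \<open>v\<close>. Powers of the
  cycle are arbitrarily long paths that stay outside \<open>W\<close>, while a path without return
  leads into \<open>W\<close>.\<close>

lemma complemented_cycle_extreme:
  assumes C: complemented and c: "cycle c"
  shows "is_extreme Es s r c"
proof (rule ccontr)
  assume "\<not> is_extreme Es s r c"
  then obtain p where p: "is_path Es s r p" "s (hd p) \<in> cycle_verts s c"
    "\<forall>w\<in>cycle_verts s c. \<not> reaches Es s r (r (last p)) w"
    using complemented_cycle_exit[OF C c] by (auto simp: is_extreme_def)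
  define v where "v = s (hd c)"
  have vc: "vpath v c v" "c \<noteq> []" "v \<in> cycle_verts s c"
    using cycle_vpath[OF c] cycle_nonempty[OF c] hd_cycle_verts[OF c] by (auto simp: v_def)
  have pp: "vpath (s (hd p)) p (r (last p))" using p(1) by (simp add: is_path_iff)
  obtain t where t: "vpath v t (s (hd p))" using cycle_verts_vpath[OF c vc(3) p(2)] by blast
  define W where "W = V - RR V Es s r {v}"
  have "v \<notin> W" using vc(1) by (auto simp: W_def mem_RR)
  moreover have "r (last p) \<in> W"
    using p(3) vc(3) vpath_V[OF pp] unfolding W_def RR_def by blast
  moreover have "vpath v (t @ p) (r (last p))" using t pp by (auto simp: vpath_append)
  moreover have "vpath v (concat (replicate n c)) v" "n \<le> length (concat (replicate n c))" for n
    using closed_path_power[OF vc(1)] vc(2) by (auto simp: length_concat_replicate Suc_le_eq)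
  ultimately show False
    using complemented_escape[OF C, of W v] hereditary_compl_RR vpath_V[OF vc(1)] unfolding W_def by blast
qed

lemma complemented_strongly_all_reflexive:
  assumes C: complemented
  shows "strongly_all_reflexive V Es s r"
  unfolding strongly_all_reflexive_def all_reflexive_def
proof (intro conjI allI impI ballI)
  fix \<alpha> assume \<alpha>: "is_inf_path Es s r \<alpha>"
  let ?W = "inf_path_verts s \<alpha>"
  let ?X = "{e \<in> Es. s e \<in> ?W \<and> r e \<notin> RR V Es s r ?W}"
  show "finite ?X"
  proof (rule ccontr)
    assume inf: "infinite ?X"
    \<comment> \<open>A vertex with infinitely many such edges would lie on an extreme cycle by the
      cases already settled, and from the end of each edge there would be a way back.\<close>
    have fin: "finite {e \<in> ?X. s e = x}" if x: "x \<in> ?W" for x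
    proof (rule ccontr)
      assume inf': "infinite {e \<in> ?X. s e = x}"
      then have "infinite {e \<in> Es. s e = x}" by (rule contrapos_nn) (auto elim: finite_subset[rotated])
      moreover obtain e where e: "e \<in> ?X" "s e = x" using inf' not_finite_existsD by blast
      ultimately obtain c where c: "cycle c" "x \<in> cycle_verts s c"
        using complemented_infinite_emitter[OF C, of x] source by blast
      have "vpath x [e] (r e)" using e target by auto
      then obtain q where "vpath (r e) q x"
        using extremeD[OF c(1) complemented_cycle_extreme[OF C c(1)] c(2)] by blast
      then have "r e \<in> RR V Es s r ?W" using x unfolding mem_RR by blast
      then show False using e by simp
    qed
    define W where "W = V - RR V Es s r ?W"
    \<comment> \<open>Infinitely many escaping edges, but only finitely many at each vertex: they
      occur arbitrarily late along the path, as \<open>complemented_escape\<close> requires.\<close>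
    have esc: "\<exists>m\<ge>n. \<exists>e\<in>?X. s e = s (\<alpha> m)" for n
    proof (rule ccontr)
      assume no: "\<not> ?thesis"
      have "?X \<subseteq> (\<Union>i<n. {e \<in> ?X. s e = s (\<alpha> i)})"
      proof
        fix e assume e: "e \<in> ?X"
        then obtain i where "s e = s (\<alpha> i)" by (auto simp: inf_path_verts_def)
        moreover from this have "i < n" using no e not_le by blast
        ultimately show "e \<in> (\<Union>i<n. {e \<in> ?X. s e = s (\<alpha> i)})" using e by blast
      qed
      moreover have "finite (\<Union>i<n. {e \<in> ?X. s e = s (\<alpha> i)})"
        using fin by (intro finite_UN_I) (auto simp: inf_path_verts_def)
      ultimately show False using inf finite_subset by blast
    qed
    show False
    proof (rule complemented_escape[OF C, of W "s (\<alpha> 0)"])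
      show "hereditary W" unfolding W_def by (rule hereditary_compl_RR)
      show "s (\<alpha> 0) \<in> V" using \<alpha> source by (simp add: is_inf_path_def)
      fix n
      obtain m e where m: "n \<le> m" "e \<in> ?X" "s e = s (\<alpha> m)" using esc by blast
      obtain p where p: "vpath (s (\<alpha> 0)) p (s (\<alpha> m))" "length p = m"
        using inf_path_vpath[OF \<alpha>, of 0 m] by auto
      have "vpath (s (\<alpha> m)) [] (s (\<alpha> m))" using vpath_V[OF p(1)] by simp
      moreover have "s (\<alpha> m) \<in> ?W" by (simp add: inf_path_verts_def)
      ultimately have "s (\<alpha> m) \<in> RR V Es s r ?W" unfolding mem_RR by blast
      then have "s (\<alpha> m) \<notin> W" by (simp add: W_def)
      moreover have "vpath (s (\<alpha> m)) [e] (r e)" "r e \<in> W" using m target by (auto simp: W_def)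
      ultimately show "\<exists>q u t w. vpath (s (\<alpha> 0)) q u \<and> n \<le> length q \<and> u \<notin> W \<and> vpath u t w \<and> w \<in> W"
        using p m(1) by blast
    qed
  qed
qed (use C in \<open>auto intro: complemented_cycle_extreme complemented_infinite_emitter complemented_cycle_exit\<close>)

lemma complemented_iff: "complemented \<longleftrightarrow> strongly_all_reflexive V Es s r"
  using complemented_strongly_all_reflexive strongly_all_reflexive_complemented by blast

end

section \<open>Transfer along ring isomorphisms\<close>

locale rng_iso =
  fixes R :: "'a rng_str" and R' :: "'b rng_str" and h :: "'a \<Rightarrow> 'b"
  assumes bij: "bij_betw h (carr R) (carr R')"
    and closed: "rzero R \<in> carr R" "x \<in> carr R \<Longrightarrow> rneg R x \<in> carr R"
      "x \<in> carr R \<Longrightarrow> y \<in> carr R \<Longrightarrow> radd R x y \<in> carr R"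
      "x \<in> carr R \<Longrightarrow> y \<in> carr R \<Longrightarrow> rmul R x y \<in> carr R"
    and hom: "h (rzero R) = rzero R'" "x \<in> carr R \<Longrightarrow> h (rneg R x) = rneg R' (h x)"
      "x \<in> carr R \<Longrightarrow> y \<in> carr R \<Longrightarrow> h (radd R x y) = radd R' (h x) (h y)"
      "x \<in> carr R \<Longrightarrow> y \<in> carr R \<Longrightarrow> h (rmul R x y) = rmul R' (h x) (h y)"
begin

lemma inj: "inj_on h (carr R)" and image_carr: "h ` carr R = carr R'"
  using bij by (auto simp: bij_betw_def)

lemma mem_image: "I \<subseteq> carr R \<Longrightarrow> x \<in> carr R \<Longrightarrow> h x \<in> h ` I \<longleftrightarrow> x \<in> I"
  using inj_on_image_mem_iff[OF inj] by blast

lemma eq_iff: "x \<in> carr R \<Longrightarrow> y \<in> carr R \<Longrightarrow> h x = h y \<longleftrightarrow> x = y"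
  using inj by (auto dest: inj_onD)

lemma ideal_image:
  assumes I: "I \<subseteq> carr R"
  shows "is_ideal R' (h ` I) \<longleftrightarrow> is_ideal R I"
proof -
  have "h ` I \<subseteq> carr R'" using I image_carr by blast
  moreover have "rzero R' \<in> h ` I \<longleftrightarrow> rzero R \<in> I"
    using mem_image[OF I closed(1)] by (simp add: hom)
  moreover have "radd R' (h x) (h y) \<in> h ` I \<longleftrightarrow> radd R x y \<in> I" if "x \<in> I" "y \<in> I" for x y
  proof -
    have "x \<in> carr R" "y \<in> carr R" using that I by auto
    then show ?thesis using mem_image[OF I closed(3)] by (simp add: hom)
  qed
  moreover have "rneg R' (h x) \<in> h ` I \<longleftrightarrow> rneg R x \<in> I" if "x \<in> I" for x
  proof -
    have "x \<in> carr R" using that I by auto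
    then show ?thesis using mem_image[OF I closed(2)] by (simp add: hom)
  qed
  moreover have "rmul R' (h a) (h x) \<in> h ` I \<longleftrightarrow> rmul R a x \<in> I"
      "rmul R' (h x) (h a) \<in> h ` I \<longleftrightarrow> rmul R x a \<in> I" if "a \<in> carr R" "x \<in> I" for a x
  proof -
    have "x \<in> carr R" using that I by auto
    then show "rmul R' (h a) (h x) \<in> h ` I \<longleftrightarrow> rmul R a x \<in> I"
      "rmul R' (h x) (h a) \<in> h ` I \<longleftrightarrow> rmul R x a \<in> I"
      using mem_image[OF I closed(4)] that(1) by (simp_all flip: hom)
  qed
  ultimately show ?thesis
    using I unfolding is_ideal_def image_carr[symmetric] ball_simps by simp
qed

lemma ideal_subset: "is_ideal R I \<Longrightarrow> I \<subseteq> carr R" "is_ideal R' I' \<Longrightarrow> I' \<subseteq> carr R'"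
  by (simp_all add: is_ideal_def)

text \<open>Every ideal of \<open>R'\<close> is the image of an ideal of \<open>R\<close>, so
  statements about all ideals can be rewritten one quantifier at a time.\<close>

lemma all_ideals: "(\<forall>I'. is_ideal R' I' \<longrightarrow> P I') \<longleftrightarrow> (\<forall>I. is_ideal R I \<longrightarrow> P (h ` I))"
proof (intro iffI allI impI)
  fix I' assume P: "\<forall>I. is_ideal R I \<longrightarrow> P (h ` I)" and I': "is_ideal R' I'"
  then obtain I where I: "I \<subseteq> carr R" "I' = h ` I"
    using ideal_subset(2) image_carr by (metis subset_imageE)
  then show "P I'" using P I' ideal_image by blast
next
  fix I assume "\<forall>I'. is_ideal R' I' \<longrightarrow> P I'" "is_ideal R I"
  then show "P (h ` I)" using ideal_image ideal_subset(1) by blast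
qed

lemma ex_ideals: "(\<exists>I'. is_ideal R' I' \<and> P I') \<longleftrightarrow> (\<exists>I. is_ideal R I \<and> P (h ` I))"
  using all_ideals[of "\<lambda>I. \<not> P I"] by blast

lemma ann_image:
  assumes I: "I \<subseteq> carr R"
  shows "ann R' (h ` I) = h ` ann R I"
proof -
  have "h a \<in> ann R' (h ` I) \<longleftrightarrow> a \<in> ann R I" if a: "a \<in> carr R" for a
  proof -
    have "rmul R' (h a) (h x) = rzero R' \<longleftrightarrow> rmul R a x = rzero R"
      "rmul R' (h x) (h a) = rzero R' \<longleftrightarrow> rmul R x a = rzero R" if "x \<in> I" for x
    proof -
      have "x \<in> carr R" using that I by auto
      then show "rmul R' (h a) (h x) = rzero R' \<longleftrightarrow> rmul R a x = rzero R"
        "rmul R' (h x) (h a) = rzero R' \<longleftrightarrow> rmul R x a = rzero R"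
        using a eq_iff closed by (simp_all flip: hom)
    qed
    then show ?thesis using a image_carr by (auto simp: ann_def)
  qed
  moreover have "ann R' (h ` I) \<subseteq> h ` carr R" "ann R I \<subseteq> carr R"
    unfolding image_carr by (auto simp: ann_def)
  ultimately show ?thesis by blast
qed

lemma ideal_carr: "is_ideal R (carr R)"
  using closed by (simp add: is_ideal_def)

text \<open>An injective map commutes with intersections of nonempty families, and this family
  contains \<open>carr R\<close>.\<close>

lemma ideal_join_image:
  assumes AB: "A \<subseteq> carr R" "B \<subseteq> carr R"
  shows "ideal_join R' (h ` A) (h ` B) = h ` ideal_join R A B"
proof -
  have "{D'. is_ideal R' D' \<and> h ` A \<union> h ` B \<subseteq> D'} = (`) h ` {D. is_ideal R D \<and> A \<union> B \<subseteq> D}"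
  proof (intro set_eqI iffI)
    fix D' assume D': "D' \<in> {D'. is_ideal R' D' \<and> h ` A \<union> h ` B \<subseteq> D'}"
    then obtain D where D: "D \<subseteq> carr R" "D' = h ` D"
      using ideal_subset(2) image_carr by (metis mem_Collect_eq subset_imageE)
    then have "is_ideal R D" using D' ideal_image by blast
    moreover have "A \<union> B \<subseteq> D"
    proof
      fix x assume x: "x \<in> A \<union> B"
      then have "h x \<in> h ` D" using D' D(2) by blast
      then show "x \<in> D" using mem_image[OF D(1)] x AB by blast
    qed
    ultimately show "D' \<in> (`) h ` {D. is_ideal R D \<and> A \<union> B \<subseteq> D}" using D by blast
  next
    fix D' assume "D' \<in> (`) h ` {D. is_ideal R D \<and> A \<union> B \<subseteq> D}"
    then show "D' \<in> {D'. is_ideal R' D' \<and> h ` A \<union> h ` B \<subseteq> D'}"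
      using ideal_image ideal_subset(1) by blast
  qed
  then have "ideal_join R' (h ` A) (h ` B) = \<Inter> ((`) h ` {D. is_ideal R D \<and> A \<union> B \<subseteq> D})"
    by (simp add: ideal_join_def)
  also have "\<dots> = h ` \<Inter> {D. is_ideal R D \<and> A \<union> B \<subseteq> D}"
    using image_INT[OF inj, of "{D. is_ideal R D \<and> A \<union> B \<subseteq> D}" "\<lambda>D. D" "carr R"]
      ideal_subset(1) ideal_carr AB by auto
  finally show ?thesis by (simp add: ideal_join_def)
qed

lemma ideal_join_subset: "A \<subseteq> carr R \<Longrightarrow> B \<subseteq> carr R \<Longrightarrow> ideal_join R A B \<subseteq> carr R"
  using ideal_carr by (auto simp: ideal_join_def)

lemma image_eq_iff: "A \<subseteq> carr R \<Longrightarrow> B \<subseteq> carr R \<Longrightarrow> h ` A = h ` B \<longleftrightarrow> A = B"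
  by (rule inj_on_image_eq_iff[OF inj])

lemma image_Int: "A \<subseteq> carr R \<Longrightarrow> B \<subseteq> carr R \<Longrightarrow> h ` A \<inter> h ` B = h ` (A \<inter> B)"
  by (rule inj_on_image_Int[OF inj, symmetric])

lemma ann_ann_iso:
  "(\<forall>I. is_ideal R' I \<longrightarrow> ann R' (ann R' I) = I) \<longleftrightarrow> (\<forall>I. is_ideal R I \<longrightarrow> ann R (ann R I) = I)"
proof -
  have "ann R' (ann R' (h ` I)) = h ` I \<longleftrightarrow> ann R (ann R I) = I" if "is_ideal R I" for I
  proof -
    have "I \<subseteq> carr R" "ann R I \<subseteq> carr R" "ann R (ann R I) \<subseteq> carr R"
      using that ideal_subset by (auto simp: ann_def)
    then show ?thesis by (simp add: ann_image image_eq_iff)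
  qed
  then show ?thesis by (simp add: all_ideals)
qed

lemma boolean_iso: "boolean_ideal_lattice R' \<longleftrightarrow> boolean_ideal_lattice R"
proof -
  have 1: "h ` A \<inter> ideal_join R' (h ` B) (h ` D) = ideal_join R' (h ` A \<inter> h ` B) (h ` A \<inter> h ` D)
      \<longleftrightarrow> A \<inter> ideal_join R B D = ideal_join R (A \<inter> B) (A \<inter> D)"
    if "is_ideal R A" "is_ideal R B" "is_ideal R D" for A B D
  proof -
    have sub: "A \<subseteq> carr R" "B \<subseteq> carr R" "D \<subseteq> carr R" "A \<inter> B \<subseteq> carr R" "A \<inter> D \<subseteq> carr R"
      using that ideal_subset by auto
    then show ?thesis
      by (simp add: image_Int ideal_join_image ideal_join_subset image_eq_iff le_infI1)
  qed
  have 2: "h ` A \<inter> h ` B = {rzero R'} \<and> ideal_join R' (h ` A) (h ` B) = carr R'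
      \<longleftrightarrow> A \<inter> B = {rzero R} \<and> ideal_join R A B = carr R" if "is_ideal R A" "is_ideal R B" for A B
  proof -
    have sub: "A \<subseteq> carr R" "B \<subseteq> carr R" using that ideal_subset by auto
    have "{rzero R'} = h ` {rzero R}" by (simp add: hom)
    then show ?thesis
      using sub closed(1)
      by (simp add: image_Int ideal_join_image ideal_join_subset image_eq_iff le_infI1 flip: image_carr
          del: image_insert image_empty)
  qed
  \<comment> \<open>The definition guards three ideals by one conjunction; with nested guards
    \<open>all_ideals\<close> applies to each quantifier.\<close>
  have curry: "(\<forall>A B C. P A \<and> P B \<and> P C \<longrightarrow> Q A B C)
      \<longleftrightarrow> (\<forall>A. P A \<longrightarrow> (\<forall>B. P B \<longrightarrow> (\<forall>C. P C \<longrightarrow> Q A B C)))" for P and Q :: "'x \<Rightarrow> 'x \<Rightarrow> 'x \<Rightarrow> bool"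
    by blast
  show ?thesis
    unfolding boolean_ideal_lattice_def curry all_ideals ex_ideals using 1 2 by (simp cong: conj_cong)
qed

end

section \<open>The Leavitt path algebra as an instance\<close>

context leavitt_coset begin

abbreviation "vgen v \<equiv> emb (fa_gen (Vg v))"
abbreviation "egen e \<equiv> emb (fa_gen (Eg e))"
abbreviation "ggen e \<equiv> emb (fa_gen (Gg e))"

lemma emb_sum: "finite S \<Longrightarrow> (\<And>i. i \<in> S \<Longrightarrow> f i \<in> C) \<Longrightarrow> emb (\<lambda>w. \<Sum>i\<in>S. f i w) = (\<Sum>i\<in>S. emb (f i))"
proof (induction S rule: finite_induct)
  case empty
  then show ?case using emb_ops(1) by (simp add: fa_zero_def)
next
  case (insert i S)
  have "emb (fa_add (f i) (\<lambda>w. \<Sum>i\<in>S. f i w)) = emb (f i) + emb (\<lambda>w. \<Sum>i\<in>S. f i w)"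
    using insert by (intro emb_ops fa_sum_carrier) auto
  then show ?case using insert by (simp add: fa_add_def)
qed

lemma rel_emb: "fa_sub p q \<in> lpa_rels V Es s r \<Longrightarrow> p \<in> C \<Longrightarrow> q \<in> C \<Longrightarrow> emb p = emb q"
  using rels_J by (auto simp: emb_eq_iff)

lemma gens_C [simp]:
  "v \<in> V \<Longrightarrow> fa_gen (Vg v) \<in> C" "e \<in> Es \<Longrightarrow> fa_gen (Eg e) \<in> C" "e \<in> Es \<Longrightarrow> fa_gen (Gg e) \<in> C"
  by (simp_all add: gen_C)

lemma emb_path:
  "vpath v p u \<Longrightarrow> foldr (\<lambda>e. (*) (egen e)) p (vgen u) = emb (fa_mono (map Eg p @ [Vg u])) \<and>
    fa_mono (map Eg p @ [Vg u]) \<in> C"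
proof (induction p arbitrary: v)
  case Nil
  then show ?case by (auto simp: fa_gen_mono intro!: fa_mono_carrier)
next
  case (Cons e p)
  then have IH: "foldr (\<lambda>e. (*) (egen e)) p (vgen u) = emb (fa_mono (map Eg p @ [Vg u]))"
    "fa_mono (map Eg p @ [Vg u]) \<in> C" and e: "e \<in> Es" by auto
  have m: "fa_mul (fa_gen (Eg e)) (fa_mono (map Eg p @ [Vg u])) = fa_mono (map Eg (e # p) @ [Vg u])"
    by (simp add: fa_gen_mono fa_mul_mono)
  have "fa_mul (fa_gen (Eg e)) (fa_mono (map Eg p @ [Vg u])) \<in> C"
    using IH e by (intro C_closed) auto
  moreover have "egen e * emb (fa_mono (map Eg p @ [Vg u])) = emb (fa_mul (fa_gen (Eg e)) (fa_mono (map Eg p @ [Vg u])))"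
    using IH e by (simp add: emb_ops)
  ultimately show ?case using IH by (simp add: m)
qed

text \<open>The laws for vertices and edges are the defining relations read modulo \<open>J\<close>.
  Independence of paths, the final obligation, is where the representation on boundary paths
  enters.\<close>

sublocale alg: leavitt V Es s r alg_scale vgen egen ggen
proof (intro leavitt.intro leavitt_axioms.intro)
  show "digraph V Es s r" by unfold_locales
  show "vector_space (alg_scale :: 'k \<Rightarrow> _)" by (rule vector_space_alg_scale)
  fix c :: 'k and x y :: "(('v, 'e, 'k) fa set, 'k) alg_prod"
  show "alg_scale c x * y = alg_scale c (x * y)" by (rule alg_scale_mult_left)
  show "x * alg_scale c y = alg_scale c (x * y)" by (rule alg_scale_mult_right)
next
  fix v u assume vu: "v \<in> V" "u \<in> V"
  have "emb (fa_mul (fa_gen (Vg v)) (fa_gen (Vg u))) = emb (if v = u then fa_gen (Vg v) else fa_zero)"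
  proof (rule rel_emb)
    show "fa_sub (fa_mul (fa_gen (Vg v)) (fa_gen (Vg u))) (if v = u then fa_gen (Vg v) else fa_zero)
        \<in> lpa_rels V Es s r"
      unfolding lpa_rels_def using vu by blast
  qed (use vu in \<open>auto simp: C_closed\<close>)
  then show "vgen v * vgen u = (if v = u then vgen v else 0)"
    using vu by (auto simp: emb_ops split: if_splits)
next
  fix e assume e: "e \<in> Es"
  note V = source[OF e] target[OF e]
  have rels: "fa_sub (fa_mul (fa_gen (Vg (s e))) (fa_gen (Eg e))) (fa_gen (Eg e)) \<in> lpa_rels V Es s r"
    "fa_sub (fa_mul (fa_gen (Eg e)) (fa_gen (Vg (r e)))) (fa_gen (Eg e)) \<in> lpa_rels V Es s r"
    "fa_sub (fa_mul (fa_gen (Vg (r e))) (fa_gen (Gg e))) (fa_gen (Gg e)) \<in> lpa_rels V Es s r"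
    "fa_sub (fa_mul (fa_gen (Gg e)) (fa_gen (Vg (s e)))) (fa_gen (Gg e)) \<in> lpa_rels V Es s r"
    unfolding lpa_rels_def using e by blast+
  have "emb (fa_mul (fa_gen (Vg (s e))) (fa_gen (Eg e))) = egen e"
    "emb (fa_mul (fa_gen (Eg e)) (fa_gen (Vg (r e)))) = egen e"
    "emb (fa_mul (fa_gen (Vg (r e))) (fa_gen (Gg e))) = ggen e"
    "emb (fa_mul (fa_gen (Gg e)) (fa_gen (Vg (s e)))) = ggen e"
    using e V by (auto intro!: rel_emb C_closed rels)
  then show "vgen (s e) * egen e = egen e" "egen e * vgen (r e) = egen e"
    "vgen (r e) * ggen e = ggen e" "ggen e * vgen (s e) = ggen e"
    using e V by (simp_all add: emb_ops)
next
  fix e f assume e: "e \<in> Es" "f \<in> Es"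
  have "emb (fa_mul (fa_gen (Gg e)) (fa_gen (Eg f))) = emb (if e = f then fa_gen (Vg (r e)) else fa_zero)"
  proof (rule rel_emb)
    show "fa_sub (fa_mul (fa_gen (Gg e)) (fa_gen (Eg f))) (if e = f then fa_gen (Vg (r e)) else fa_zero)
        \<in> lpa_rels V Es s r"
      unfolding lpa_rels_def using e by blast
  qed (use e target in \<open>auto simp: C_closed\<close>)
  then show "ggen e * egen f = (if e = f then vgen (r e) else 0)"
    using e by (auto simp: emb_ops split: if_splits)
next
  fix v assume v: "v \<in> V" "finite {e \<in> Es. s e = v}" "{e \<in> Es. s e = v} \<noteq> {}"
  have "emb (fa_gen (Vg v)) = emb (\<lambda>w. \<Sum>e\<in>{e \<in> Es. s e = v}. fa_mul (fa_gen (Eg e)) (fa_gen (Gg e)) w)"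
  proof (rule rel_emb)
    show "fa_sub (fa_gen (Vg v)) (\<lambda>w. \<Sum>e\<in>{e \<in> Es. s e = v}. fa_mul (fa_gen (Eg e)) (fa_gen (Gg e)) w)
        \<in> lpa_rels V Es s r"
      unfolding lpa_rels_def using v by blast
  qed (use v in \<open>auto intro!: fa_sum_carrier C_closed\<close>)
  also have "\<dots> = (\<Sum>e\<in>{e \<in> Es. s e = v}. emb (fa_mul (fa_gen (Eg e)) (fa_gen (Gg e))))"
    using v by (intro emb_sum) (auto intro!: C_closed)
  finally show "vgen v = (\<Sum>e\<in>{e \<in> Es. s e = v}. egen e * ggen e)"
    by (simp add: emb_ops)
next
  fix u q
  show "\<exists>g :: (('v, 'e, 'k) fa set, 'k) alg_prod \<Rightarrow> 'k. (\<forall>x y. g (x + y) = g x + g y) \<and>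
    (\<forall>c x. g (alg_scale c x) = c * g x) \<and>
    (\<forall>p v. vpath v p u \<longrightarrow> g (foldr (\<lambda>e. (*) (egen e)) p (vgen u)) = (if p = q then 1 else 0))"
    using path_functional[of u q] emb_path by metis
qed

text \<open>The span of the monomials is closed under products and contains the generators, hence
  all words; conversely monomials are products of generators. So \<open>alg.leavitt_ring\<close> is
  a copy of the full algebra.\<close>

lemma emb_image: "emb ` C = alg.vspan V"
proof
  have gen: "emb (fa_gen x) \<in> alg.vspan V" if "allowed V Es x" for x
    using that alg.vx_vspan alg.edge_vspan by (cases x) auto
  have word: "emb (fa_mono w) \<in> alg.vspan V \<and> fa_mono w \<in> C"
    if "w \<noteq> []" "\<forall>x\<in>set w. allowed V Es x" for w
    using that
  proof (induction w)
    case (Cons x w)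
    show ?case
    proof (cases "w = []")
      case True
      then show ?thesis using Cons.prems gen[of x] by (simp add: fa_gen_mono fa_mono_carrier)
    next
      case False
      then have w: "emb (fa_mono w) \<in> alg.vspan V" "fa_mono w \<in> C" using Cons by auto
      have x: "fa_gen x \<in> C" using Cons.prems by (simp add: gen_C)
      have xw: "fa_mono (x # w) = fa_mul (fa_gen x) (fa_mono w)" by (simp add: fa_gen_mono fa_mul_mono)
      show ?thesis
        unfolding xw using w x gen[of x] Cons.prems by (simp add: emb_ops alg.vspan_V_closed C_closed)
    qed
  qed simp
  show "emb ` C \<subseteq> alg.vspan V"
  proof (rule image_subsetI)
    fix p assume "p \<in> C"
    then show "emb p \<in> alg.vspan V"
    proof (induction rule: fa_carrier_induct)
      case zero
      then show ?case by (simp add: emb_ops alg.vspan_V_closed)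
    next
      case (add c w p)
      then show ?case using word[of w] alg.subspace_vspan[of V]
        by (simp add: emb_ops C_closed alg.vspan_V_closed alg.subspace_scale)
    qed
  qed
  have mul: "x * y \<in> emb ` C" if "x \<in> emb ` C" "y \<in> emb ` C" for x y
    using that by (auto simp: C_closed simp flip: emb_ops)
  have mp: "alg.mp p u \<in> emb ` C" "alg.gp p u \<in> emb ` C" if "vpath v p u" for v p u
    using that by (induction p arbitrary: v) (auto intro!: mul)
  have "alg.subspace (emb ` C)"
  proof (rule alg.subspaceI)
    show "0 \<in> emb ` C" using emb_ops(1) C_closed(1) by (metis image_eqI)
    show "x + y \<in> emb ` C" if "x \<in> emb ` C" "y \<in> emb ` C" for x y
      using that by (auto simp: C_closed simp flip: emb_ops)
    show "alg_scale c x \<in> emb ` C" if "x \<in> emb ` C" for c x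
      using that by (auto simp: C_closed simp flip: emb_ops)
  qed
  then show "alg.vspan V \<subseteq> emb ` C"
    unfolding alg.vspan_def
    by (rule alg.span_minimal[rotated]) (auto simp: alg.monomials_def intro!: mul mp)
qed

lemma rng_iso_LPA: "rng_iso L alg.leavitt_ring (alg_embed (L, coset_smul))"
proof -
  have "alg_embed (L, coset_smul) ` carr L = emb ` C"
    by (simp add: carr_LPA image_image emb_def)
  also note emb_image
  finally have "alg_embed (L, coset_smul) ` carr L = alg.vspan V" .
  moreover have "inj_on (alg_embed (L, coset_smul)) (carr L)"
    using inj_on_alg_embed[OF is_algebra_LPA] by simp
  ultimately show ?thesis
    using is_algebra_closed[OF is_algebra_LPA] alg_embed_zero[OF is_algebra_LPA]
      alg_embed_add[OF is_algebra_LPA] alg_embed_mul[OF is_algebra_LPA] alg_embed_neg[OF is_algebra_LPA]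
    by (unfold_locales) (simp_all add: bij_betw_def alg.leavitt_ring_def)
qed

end

theorem theorem3p16:
  fixes V :: "'v set" and Es :: "'e set" and s r :: "'e \<Rightarrow> 'v"
  assumes "s ` Es \<subseteq> V" and "r ` Es \<subseteq> V"
  shows "((\<forall>I. is_ideal (LPA V Es s r :: ('v, 'e, 'k::field) fa set rng_str) I \<longrightarrow>
              ann (LPA V Es s r :: ('v, 'e, 'k) fa set rng_str)
                  (ann (LPA V Es s r :: ('v, 'e, 'k) fa set rng_str) I) = I)
           \<longleftrightarrow> strongly_all_reflexive V Es s r)
       \<and> (strongly_all_reflexive V Es s r
           \<longleftrightarrow> boolean_ideal_lattice (LPA V Es s r :: ('v, 'e, 'k) fa set rng_str))"
proof -
  interpret leavitt_coset V Es s r "TYPE('k)"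
    by unfold_locales (use assms in auto)
  interpret rng_iso L alg.leavitt_ring "alg_embed (L, coset_smul)"
    by (rule rng_iso_LPA)
  show ?thesis
    by (intro conjI
        trans[OF ann_ann_iso[symmetric] trans[OF alg.ann_ann_iff_complemented alg.complemented_iff]]
        trans[OF boolean_iso[symmetric] trans[OF alg.boolean_iff_complemented alg.complemented_iff], symmetric])
qed

end
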